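(* Let $H$ be a topological abelian group, let $\{G_\alpha:\alpha<\omega\}$ be a countable family of topological abelian groups, and let $\bigoplus_{\alpha<\omega}G_\alpha$ be its coproduct, i.e. the direct sum endowed with the coproduct topology. Then $\mathrm{Ext}(\bigoplus_{\alpha<\omega}G_\alpha,H)\cong\prod_{\alpha<\omega}\mathrm{Ext}(G_\alpha,H)$ (isomorphism of abelian groups).
   Context: All topological groups are Hausdorff and abelian. The coproduct topology on a direct sum $\bigoplus_{\alpha<\kappa}G_\alpha$ of topological abelian groups is the final group topology with respect to the natural inclusions $G_\gamma\hookrightarrow\bigoplus_{\alpha<\kappa}G_\alpha$; for $\kappa=\omega$ it coincides with the box topology. An extension of topological abelian groups is a short exact sequence $E:0\to H\stackrel{\imath}{\to}X\stackrel{\pi}{\to}G\to 0$ of topological abelian groups in which $\imath,\pi$ are continuous homomorphisms that are open onto their images. Two extensions $0\to H\stackrel{\imath}{\to}X\stackrel{\pi}{\to}G\to 0$ and $0\to H\stackrel{\imath'}{\to}X'\stackrel{\pi'}{\to}G\to 0$ are equivalent if there is a continuous homomorphism $T:X\to X'$ with $T\circ\imath=\imath'$ and $\pi'\circ T=\pi$ (such a $T$ is necessarily a topological isomorphism). $\mathrm{Ext}(G,H)$ is the set of equivalence classes of such extensions. It is an abelian group under the Baer sum: $[E_1]+[E_2]$ is the class of the extension obtained from the product extension $0\to H\times H\to X_1\times X_2\to G\times G\to 0$ by pulling back along the diagonal $G\to G\times G$ and then pushing out along the addition map $H\times H\to H$ (pull-backs and push-outs taken in topological abelian groups). The zero element is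 the class of the trivial extension $0\to H\to H\times G\to G\to 0$. *)

theory Defs
  imports "HOL-Analysis.Analysis" "HOL-Algebra.Product_Groups"
begin

section \<open>Topological abelian groups\<close>

record 'a topgroup = "'a monoid" +
  topo :: "'a topology"

definition with_topology :: "('a, 'm) monoid_scheme \<Rightarrow> 'a topology \<Rightarrow> 'a topgroup" where
  "with_topology M T = \<lparr>carrier = carrier M, monoid.mult = monoid.mult M, one = one M, topo = T\<rparr>"

definition group_topology :: "('a, 'm) monoid_scheme \<Rightarrow> 'a topology \<Rightarrow> bool" where
  "group_topology M T \<longleftrightarrow>
     topspace T = carrier M \<and>
     continuous_map (prod_topology T T) T (\<lambda>(x, y). x \<otimes>\<^bsub>M\<^esub> y) \<and>
     continuous_map T T (\<lambda>x. inv\<^bsub>M\<^esub> x)"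

definition top_ab_group :: "'a topgroup \<Rightarrow> bool" where
  "top_ab_group G \<longleftrightarrow> comm_group G \<and> group_topology G (topo G) \<and> Hausdorff_space (topo G)"

definition top_hom :: "'a topgroup \<Rightarrow> 'b topgroup \<Rightarrow> ('a \<Rightarrow> 'b) set" where
  "top_hom G H = {f \<in> hom G H. continuous_map (topo G) (topo H) f}"

definition open_onto_image :: "'a topgroup \<Rightarrow> 'b topgroup \<Rightarrow> ('a \<Rightarrow> 'b) \<Rightarrow> bool" where
  "open_onto_image G H f \<longleftrightarrow>
     open_map (topo G) (subtopology (topo H) (f ` carrier G)) f"

definition prod_topgroup :: "'a topgroup \<Rightarrow> 'b topgroup \<Rightarrow> ('a \<times> 'b) topgroup" where
  "prod_topgroup G H = with_topology (G \<times>\<times> H) (prod_topology (topo G) (topo H))"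

definition sub_topgroup :: "'a topgroup \<Rightarrow> 'a set \<Rightarrow> 'a topgroup" where
  "sub_topgroup G S = with_topology (G\<lparr>carrier := S\<rparr>) (subtopology (topo G) S)"

definition quotient_topology :: "'a topology \<Rightarrow> ('a \<Rightarrow> 'b) \<Rightarrow> 'b topology" where
  "quotient_topology X f =
     topology (\<lambda>U. U \<subseteq> f ` topspace X \<and> openin X {x \<in> topspace X. f x \<in> U})"

definition quot_topgroup :: "'a topgroup \<Rightarrow> 'a set \<Rightarrow> 'a set topgroup" where
  "quot_topgroup G N = with_topology (G Mod N) (quotient_topology (topo G) (r_coset G N))"


section \<open>Coproducts\<close>

definition sum_incl :: "'i set \<Rightarrow> ('i \<Rightarrow> 'a topgroup) \<Rightarrow> 'i \<Rightarrow> 'a \<Rightarrow> 'i \<Rightarrow> 'a" where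
  "sum_incl I G i x = (\<lambda>j\<in>I. if j = i then x else \<one>\<^bsub>G j\<^esub>)"

text \<open>The final group topology is the supremum of all group topologies on the direct sum that
  make the inclusions continuous. This supremum is again such a topology (hence the finest one),
  and it is Hausdorff if all summands are; see \<open>coproduct_finest\<close> and
  \<open>top_ab_group_coproduct\<close>.\<close>

definition coproduct_topology :: "'i set \<Rightarrow> ('i \<Rightarrow> 'a topgroup) \<Rightarrow> ('i \<Rightarrow> 'a) topology" where
  "coproduct_topology I G = topology_generated_by
     {U. \<exists>T. group_topology (sum_group I G) T \<and>
             (\<forall>i\<in>I. continuous_map (topo (G i)) T (sum_incl I G i)) \<and> openin T U}"

definition coproduct :: "'i set \<Rightarrow> ('i \<Rightarrow> 'a topgroup) \<Rightarrow> ('i \<Rightarrow> 'a) topgroup" where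
  "coproduct I G = with_topology (sum_group I G) (coproduct_topology I G)"


section \<open>Extensions\<close>

record ('h, 'x, 'g) extension =
  mid :: "'x topgroup"
  incl :: "'h \<Rightarrow> 'x"
  proj :: "'x \<Rightarrow> 'g"

definition top_extension :: "'h topgroup \<Rightarrow> 'g topgroup \<Rightarrow> ('h, 'x, 'g) extension \<Rightarrow> bool" where
  "top_extension H G E \<longleftrightarrow>
     top_ab_group H \<and> top_ab_group (mid E) \<and> top_ab_group G \<and>
     incl E \<in> top_hom H (mid E) \<and> open_onto_image H (mid E) (incl E) \<and>
     proj E \<in> top_hom (mid E) G \<and> open_onto_image (mid E) G (proj E) \<and>
     inj_on (incl E) (carrier H) \<and>
     incl E ` carrier H = kernel (mid E) G (proj E) \<and>
     proj E ` carrier (mid E) = carrier G"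

definition ext_equiv ::
  "'h topgroup \<Rightarrow> ('h, 'x, 'g) extension \<Rightarrow> ('h, 'y, 'g) extension \<Rightarrow> bool" where
  "ext_equiv H E E' \<longleftrightarrow>
     (\<exists>T \<in> top_hom (mid E) (mid E').
        (\<forall>h \<in> carrier H. T (incl E h) = incl E' h) \<and>
        (\<forall>x \<in> carrier (mid E). proj E' (T x) = proj E x))"

definition trivial_ext :: "'h topgroup \<Rightarrow> 'g topgroup \<Rightarrow> ('h, 'h \<times> 'g, 'g) extension" where
  "trivial_ext H G =
     \<lparr>mid = prod_topgroup H G, incl = (\<lambda>h. (h, \<one>\<^bsub>G\<^esub>)), proj = snd\<rparr>"

definition product_ext ::
  "('h, 'x, 'g) extension \<Rightarrow> ('k, 'y, 'l) extension \<Rightarrow> ('h \<times> 'k, 'x \<times> 'y, 'g \<times> 'l) extension" where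
  "product_ext E E' =
     \<lparr>mid = prod_topgroup (mid E) (mid E'),
      incl = map_prod (incl E) (incl E'),
      proj = map_prod (proj E) (proj E')\<rparr>"

text \<open>Pull-back of \<open>0 \<rightarrow> H \<rightarrow> X \<rightarrow> G \<rightarrow> 0\<close> along \<open>t : G' \<rightarrow> G\<close>: the middle group is the subgroup
  \<open>{(x, g'). \<pi> x = t g'}\<close> of \<open>X \<times> G'\<close>.\<close>

definition pullback_ext ::
  "'l topgroup \<Rightarrow> ('l \<Rightarrow> 'g) \<Rightarrow> ('h, 'x, 'g) extension \<Rightarrow> ('h, 'x \<times> 'l, 'l) extension" where
  "pullback_ext G' t E =
     \<lparr>mid = sub_topgroup (prod_topgroup (mid E) G')
              {(x, g'). x \<in> carrier (mid E) \<and> g' \<in> carrier G' \<and> proj E x = t g'},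
      incl = (\<lambda>h. (incl E h, \<one>\<^bsub>G'\<^esub>)),
      proj = snd\<rparr>"

text \<open>Push-out of \<open>0 \<rightarrow> H \<rightarrow> X \<rightarrow> G \<rightarrow> 0\<close> along \<open>s : H \<rightarrow> H'\<close>: the middle group is the quotient of
  \<open>H' \<times> X\<close> by \<open>{(s h, - \<iota> h) | h \<in> H}\<close>. This subgroup is closed because \<open>\<iota>\<close> is a closed
  embedding, so the quotient is already Hausdorff. The projection is the map that
  \<open>(h', x) \<mapsto> \<pi> x\<close> induces on cosets.\<close>

definition pushout_kernel ::
  "'h topgroup \<Rightarrow> ('h \<Rightarrow> 'k) \<Rightarrow> ('h, 'x, 'g) extension \<Rightarrow> ('k \<times> 'x) set" where
  "pushout_kernel H s E = (\<lambda>h. (s h, inv\<^bsub>mid E\<^esub> (incl E h))) ` carrier H"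

definition pushout_ext ::
  "'h topgroup \<Rightarrow> 'k topgroup \<Rightarrow> ('h \<Rightarrow> 'k) \<Rightarrow> ('h, 'x, 'g) extension \<Rightarrow>
   ('k, ('k \<times> 'x) set, 'g) extension" where
  "pushout_ext H H' s E =
     \<lparr>mid = quot_topgroup (prod_topgroup H' (mid E)) (pushout_kernel H s E),
      incl = (\<lambda>h'. pushout_kernel H s E #>\<^bsub>prod_topgroup H' (mid E)\<^esub> (h', \<one>\<^bsub>mid E\<^esub>)),
      proj = (\<lambda>C. the_elem ((\<lambda>(h', x). proj E x) ` C))\<rparr>"

definition baer_sum ::
  "'h topgroup \<Rightarrow> 'g topgroup \<Rightarrow> ('h, 'x, 'g) extension \<Rightarrow> ('h, 'y, 'g) extension \<Rightarrow>
   ('h, ('h \<times> ('x \<times> 'y) \<times> 'g) set, 'g) extension" where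
  "baer_sum H G E E' =
     pushout_ext (prod_topgroup H H) H (\<lambda>(a, b). a \<otimes>\<^bsub>H\<^esub> b)
       (pullback_ext G (\<lambda>g. (g, g)) (product_ext E E'))"


section \<open>The group Ext\<close>

text \<open>The middle group of an extension of \<open>G\<close> by \<open>H\<close> is in bijection with \<open>H \<times> G\<close>. Hence it is
  no restriction to let the representatives of the classes have their middle groups carried by
  subsets of the type \<^typ>\<open>'h \<times> 'g\<close>: every extension, whatever the type of its middle group, is
  equivalent to one of those, see \<open>top_extension_representable\<close>. The Baer sum of two
  representatives lives on a different type; its class consists of the representatives
  that are equivalent to it.\<close>

type_synonym ('h, 'g) repr = "('h, 'h \<times> 'g, 'g) extension"

definition ext_rel :: "'h topgroup \<Rightarrow> 'g topgroup \<Rightarrow> (('h, 'g) repr \<times> ('h, 'g) repr) set" where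
  "ext_rel H G = {(E, E'). top_extension H G E \<and> top_extension H G E' \<and> ext_equiv H E E'}"

definition ext_class :: "'h topgroup \<Rightarrow> 'g topgroup \<Rightarrow> ('h, 'x, 'g) extension \<Rightarrow> ('h, 'g) repr set" where
  "ext_class H G E = {E'. top_extension H G E' \<and> ext_equiv H E E'}"

definition Ext :: "'g topgroup \<Rightarrow> 'h topgroup \<Rightarrow> ('h, 'g) repr set monoid" where
  "Ext G H =
     \<lparr>carrier = {E. top_extension H G E} // ext_rel H G,
      monoid.mult = (\<lambda>C C'. \<Union>E\<in>C. \<Union>E'\<in>C'. ext_class H G (baer_sum H G E E')),
      one = ext_class H G (trivial_ext H G)\<rparr>"


section \<open>Basic facts\<close>

lemma with_topology_simps [simp]:
  "carrier (with_topology M T) = carrier M"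
  "monoid.mult (with_topology M T) = monoid.mult M"
  "one (with_topology M T) = one M"
  "topo (with_topology M T) = T"
  by (simp_all add: with_topology_def)

lemma m_inv_with_topology [simp]: "m_inv (with_topology M T) = m_inv M"
  by (intro ext) (simp add: m_inv_def)

lemma group_topology_with_topology [simp]:
  "group_topology (with_topology M T) T' \<longleftrightarrow> group_topology M T'"
  by (simp add: group_topology_def)

lemma comm_group_with_topology [simp]: "comm_group (with_topology M T) \<longleftrightarrow> comm_group M"
proof -
  have "Units (with_topology M T) = Units M"
    by (simp add: Units_def)
  moreover have "monoid (with_topology M T) \<longleftrightarrow> monoid M"
    unfolding monoid_def with_topology_simps ..
  ultimately show ?thesis
    unfolding comm_group_def group_def group_axioms_def comm_monoid_def comm_monoid_axioms_def
      with_topology_simps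
    by metis
qed

lemma openin_quotient_topology:
  "openin (quotient_topology X f) U \<longleftrightarrow>
     U \<subseteq> f ` topspace X \<and> openin X {x \<in> topspace X. f x \<in> U}"
proof -
  have "istopology (\<lambda>U. U \<subseteq> f ` topspace X \<and> openin X {x \<in> topspace X. f x \<in> U})"
    unfolding istopology_def
  proof (intro conjI allI impI, goal_cases)
    case (1 S T)
    then show ?case by blast
  next
    case (2 S T)
    have eq: "{x \<in> topspace X. f x \<in> S \<inter> T} = {x \<in> topspace X. f x \<in> S} \<inter> {x \<in> topspace X. f x \<in> T}"
      by blast
    show ?case
      unfolding eq by (rule openin_Int) (use 2 in blast)+
  next
    case (3 \<K>)
    then show ?case by blast
  next
    case (4 \<K>)
    have eq: "{x \<in> topspace X. f x \<in> \<Union>\<K>} = (\<Union>K\<in>\<K>. {x \<in> topspace X. f x \<in> K})"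
      by blast
    show ?case
      unfolding eq by (rule openin_Union) (use 4 in blast)
  qed
  from topology_inverse'[OF this] show ?thesis
    unfolding quotient_topology_def by (rule fun_cong)
qed

lemma topspace_quotient_topology [simp]: "topspace (quotient_topology X f) = f ` topspace X"
proof
  show "topspace (quotient_topology X f) \<subseteq> f ` topspace X"
    using openin_topspace[of "quotient_topology X f"] unfolding openin_quotient_topology by blast
  have "{x \<in> topspace X. f x \<in> f ` topspace X} = topspace X"
    by auto
  then have "openin (quotient_topology X f) (f ` topspace X)"
    by (simp add: openin_quotient_topology)
  then show "f ` topspace X \<subseteq> topspace (quotient_topology X f)"
    by (rule openin_subset)
qed

lemma quotient_map_quotient_topology: "quotient_map X (quotient_topology X f) f"
  by (auto simp: quotient_map_def openin_quotient_topology)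


subsection \<open>The coproduct topology\<close>

lemma group_topology_generated:
  assumes "\<T> \<noteq> {}" and gt: "\<And>T. T \<in> \<T> \<Longrightarrow> group_topology M T"
  shows "group_topology M (topology_generated_by {U. \<exists>T\<in>\<T>. openin T U})"
    (is "group_topology M ?S")
proof -
  have ts: "topspace T = carrier M" if "T \<in> \<T>" for T
    using gt[OF that] by (simp add: group_topology_def)
  have topS: "topspace ?S = carrier M"
  proof -
    have "\<Union>{U. \<exists>T\<in>\<T>. openin T U} \<subseteq> carrier M"
      using ts openin_subset by blast
    moreover obtain T where "T \<in> \<T>" using assms(1) by auto
    then have "carrier M \<subseteq> \<Union>{U. \<exists>T\<in>\<T>. openin T U}"
      using ts openin_topspace by (metis (mono_tags, lifting) Union_upper mem_Collect_eq)
    ultimately show ?thesis by simp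
  qed
  have finer: "continuous_map ?S T id" if "T \<in> \<T>" for T
    unfolding continuous_map_def
  proof (intro conjI allI impI)
    show "id \<in> topspace ?S \<rightarrow> topspace T"
      using topS ts[OF that] by auto
    fix U assume U: "openin T U"
    then have "{x \<in> topspace ?S. id x \<in> U} = U"
      using openin_subset[OF U] topS ts[OF that] by auto
    moreover have "openin ?S U"
      by (rule topology_generated_by_Basis) (use U that in auto)
    ultimately show "openin ?S {x \<in> topspace ?S. id x \<in> U}" by simp
  qed
  have into: "continuous_map Y ?S f"
    if "\<And>T. T \<in> \<T> \<Longrightarrow> continuous_map Y T f" for Y f
  proof (rule continuous_on_generated_topo)
    fix U assume "U \<in> {U. \<exists>T\<in>\<T>. openin T U}"
    then obtain T where T: "T \<in> \<T>" "openin T U" by auto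
    have "f -` U \<inter> topspace Y = {x \<in> topspace Y. f x \<in> U}" by auto
    then show "openin Y (f -` U \<inter> topspace Y)"
      using that[OF T(1)] T(2) by (simp add: continuous_map_def)
  next
    obtain T where "T \<in> \<T>" using assms(1) by auto
    then show "f ` topspace Y \<subseteq> \<Union>{U. \<exists>T\<in>\<T>. openin T U}"
      using that openin_topspace continuous_map_image_subset_topspace by fastforce
  qed
  show ?thesis
    unfolding group_topology_def
  proof (intro conjI topS into)
    fix T assume T: "T \<in> \<T>"
    have "continuous_map (prod_topology ?S ?S) (prod_topology T T) (\<lambda>p. (id (fst p), id (snd p)))"
      by (intro continuous_map_pairedI continuous_map_compose[OF _ finer[OF T], unfolded o_def]
          continuous_map_fst continuous_map_snd)
    then have "continuous_map (prod_topology ?S ?S) (prod_topology T T) id"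
      by (simp add: id_def)
    moreover have "continuous_map (prod_topology T T) T (\<lambda>(x, y). x \<otimes>\<^bsub>M\<^esub> y)"
      using gt[OF T] by (simp add: group_topology_def)
    ultimately show "continuous_map (prod_topology ?S ?S) T (\<lambda>(x, y). x \<otimes>\<^bsub>M\<^esub> y)"
      using continuous_map_compose by fastforce
    have "continuous_map T T (\<lambda>x. inv\<^bsub>M\<^esub> x)"
      using gt[OF T] by (simp add: group_topology_def)
    then show "continuous_map ?S T (\<lambda>x. inv\<^bsub>M\<^esub> x)"
      using continuous_map_compose[OF finer[OF T]] by fastforce
  qed
qed

lemma group_topology_sum_group_product:
  assumes "\<And>i. i \<in> I \<Longrightarrow> top_ab_group (G i)"
  shows "group_topology (sum_group I G)
           (subtopology (product_topology (\<lambda>i. topo (G i)) I) (carrier (sum_group I G)))"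
    (is "group_topology ?M ?P")
proof -
  have grp: "group (G i)" and top: "topspace (topo (G i)) = carrier (G i)"
    and cm: "continuous_map (prod_topology (topo (G i)) (topo (G i))) (topo (G i))
               (\<lambda>(x, y). x \<otimes>\<^bsub>G i\<^esub> y)"
    and ci: "continuous_map (topo (G i)) (topo (G i)) (\<lambda>x. inv\<^bsub>G i\<^esub> x)" if "i \<in> I" for i
    using assms[OF that] by (auto simp: top_ab_group_def group_topology_def comm_group_def)
  interpret M: group ?M
    by (intro sum_group grp)
  have sub: "carrier ?M \<subseteq> (\<Pi>\<^sub>E i\<in>I. carrier (G i))"
    using carrier_sum_group[of I G] grp by auto
  have tsp: "(\<Pi>\<^sub>E i\<in>I. topspace (topo (G i))) = (\<Pi>\<^sub>E i\<in>I. carrier (G i))"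
    by (intro PiE_cong top)
  have topP: "topspace ?P = carrier ?M"
    using sub tsp by auto
  have pr: "continuous_map ?P (topo (G i)) (\<lambda>x. x i)" if "i \<in> I" for i
    by (intro continuous_map_from_subtopology continuous_map_product_projection that)
  have into: "continuous_map Y ?P f"
    if "f \<in> topspace Y \<rightarrow> carrier ?M"
      and "\<And>i. i \<in> I \<Longrightarrow> continuous_map Y (topo (G i)) (\<lambda>y. f y i)" for Y and f :: "'c \<Rightarrow> _"
    unfolding continuous_map_in_subtopology continuous_map_componentwise
    using that sub by (auto simp: PiE_def)
  show ?thesis
    unfolding group_topology_def
  proof (intro conjI topP into)
    show "(\<lambda>(x, y). x \<otimes>\<^bsub>?M\<^esub> y) \<in> topspace (prod_topology ?P ?P) \<rightarrow> carrier ?M"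
      unfolding topspace_prod_topology topP using M.m_closed by auto
    show "(\<lambda>x. inv\<^bsub>?M\<^esub> x) \<in> topspace ?P \<rightarrow> carrier ?M"
      unfolding topP using M.inv_closed by auto
  next
    fix i assume i: "i \<in> I"
    have "continuous_map (prod_topology ?P ?P) (prod_topology (topo (G i)) (topo (G i)))
            (\<lambda>p. (fst p i, snd p i))"
      by (intro continuous_map_pairedI continuous_map_compose[OF _ pr[OF i], unfolded o_def]
          continuous_map_fst continuous_map_snd)
    from continuous_map_compose[OF this cm[OF i]]
    show "continuous_map (prod_topology ?P ?P) (topo (G i)) (\<lambda>p. (case p of (x, y) \<Rightarrow> x \<otimes>\<^bsub>?M\<^esub> y) i)"
      by (simp add: o_def case_prod_unfold i)
    have "continuous_map ?P (topo (G i)) (\<lambda>x. inv\<^bsub>G i\<^esub> (x i))"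
      using continuous_map_compose[OF pr[OF i] ci[OF i]] by (simp add: o_def)
    then show "continuous_map ?P (topo (G i)) (\<lambda>x. (inv\<^bsub>?M\<^esub> x) i)"
      by (rule continuous_map_eq) (use i topP grp in auto)
  qed
qed

lemma sum_incl_closed:
  assumes "\<And>i. i \<in> I \<Longrightarrow> group (G i)" "i \<in> I" "x \<in> carrier (G i)"
  shows "sum_incl I G i x \<in> carrier (sum_group I G)"
proof -
  have "{j \<in> I. sum_incl I G i x j \<noteq> \<one>\<^bsub>G j\<^esub>} \<subseteq> {i}"
    by (auto simp: sum_incl_def)
  then have "finite {j \<in> I. sum_incl I G i x j \<noteq> \<one>\<^bsub>G j\<^esub>}"
    by (rule finite_subset) simp
  moreover have "sum_incl I G i x \<in> (\<Pi>\<^sub>E j\<in>I. carrier (G j))"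
    using assms by (auto simp: sum_incl_def group.is_monoid)
  ultimately show ?thesis
    using carrier_sum_group[OF assms(1), of I] by auto
qed

lemma continuous_map_sum_incl_product:
  assumes "\<And>i. i \<in> I \<Longrightarrow> top_ab_group (G i)" "i \<in> I"
  shows "continuous_map (topo (G i))
           (subtopology (product_topology (\<lambda>i. topo (G i)) I) (carrier (sum_group I G)))
           (sum_incl I G i)"
proof -
  have grp: "group (G j)" and top: "topspace (topo (G j)) = carrier (G j)" if "j \<in> I" for j
    using assms(1)[OF that] by (auto simp: top_ab_group_def group_topology_def comm_group_def)
  have "continuous_map (topo (G i)) (topo (G j)) (\<lambda>x. sum_incl I G i x j)" if "j \<in> I" for j
    using that grp[OF that] top[OF that]
    by (cases "j = i") (auto simp: sum_incl_def group.is_monoid)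
  moreover have "sum_incl I G i ` topspace (topo (G i)) \<subseteq> extensional I"
    by (auto simp: sum_incl_def)
  ultimately show ?thesis
    unfolding continuous_map_in_subtopology continuous_map_componentwise
    using sum_incl_closed[of I G i] grp assms(2) top by auto
qed

lemma coproduct_finest:
  assumes "\<And>i. i \<in> I \<Longrightarrow> top_ab_group (G i)"
  shows "group_topology (sum_group I G) (coproduct_topology I G)"
    and "i \<in> I \<Longrightarrow> continuous_map (topo (G i)) (coproduct_topology I G) (sum_incl I G i)"
    and "\<lbrakk>group_topology (sum_group I G) T;
          \<And>i. i \<in> I \<Longrightarrow> continuous_map (topo (G i)) T (sum_incl I G i); openin T U\<rbrakk>
         \<Longrightarrow> openin (coproduct_topology I G) U"
proof -
  define \<T> where "\<T> = {T. group_topology (sum_group I G) T \<and>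
     (\<forall>i\<in>I. continuous_map (topo (G i)) T (sum_incl I G i))}"
  have eq: "coproduct_topology I G = topology_generated_by {U. \<exists>T\<in>\<T>. openin T U}"
    unfolding coproduct_topology_def \<T>_def by (rule arg_cong[where f = topology_generated_by]) blast
  have ne: "\<T> \<noteq> {}"
    using group_topology_sum_group_product[of I G] continuous_map_sum_incl_product[of I G] assms
    unfolding \<T>_def by blast
  show gt: "group_topology (sum_group I G) (coproduct_topology I G)"
    unfolding eq by (rule group_topology_generated[OF ne]) (simp add: \<T>_def)
  show "continuous_map (topo (G i)) (coproduct_topology I G) (sum_incl I G i)" if i: "i \<in> I"
    unfolding eq
  proof (rule continuous_on_generated_topo)
    fix U assume "U \<in> {U. \<exists>T\<in>\<T>. openin T U}"
    then obtain T where T: "continuous_map (topo (G i)) T (sum_incl I G i)" "openin T U"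
      using i by (auto simp: \<T>_def)
    have "sum_incl I G i -` U \<inter> topspace (topo (G i)) =
          {x \<in> topspace (topo (G i)). sum_incl I G i x \<in> U}" by auto
    then show "openin (topo (G i)) (sum_incl I G i -` U \<inter> topspace (topo (G i)))"
      using openin_continuous_map_preimage[OF T] by simp
  next
    obtain T where T: "T \<in> \<T>" using ne by auto
    then have "sum_incl I G i ` topspace (topo (G i)) \<subseteq> topspace T"
      using i continuous_map_image_subset_topspace unfolding \<T>_def by blast
    then show "sum_incl I G i ` topspace (topo (G i)) \<subseteq> \<Union>{U. \<exists>T\<in>\<T>. openin T U}"
      using T openin_topspace by blast
  qed
  show "openin (coproduct_topology I G) U"
    if "group_topology (sum_group I G) T"
      "\<And>i. i \<in> I \<Longrightarrow> continuous_map (topo (G i)) T (sum_incl I G i)" "openin T U"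
    unfolding eq by (rule topology_generated_by_Basis) (use that in \<open>auto simp: \<T>_def\<close>)
qed

lemma top_ab_group_coproduct:
  assumes "\<And>i. i \<in> I \<Longrightarrow> top_ab_group (G i)"
  shows "top_ab_group (coproduct I G)"
proof -
  let ?M = "sum_group I G"
  let ?P = "subtopology (product_topology (\<lambda>i. topo (G i)) I) (carrier ?M)"
  have cg: "comm_group (G i)" and hd: "Hausdorff_space (topo (G i))" if "i \<in> I" for i
    using assms[OF that] by (auto simp: top_ab_group_def)
  have grp: "group (G i)" if "i \<in> I" for i
    using cg[OF that] by (simp add: comm_group_def)
  have "comm_group ?M"
  proof (rule group.group_comm_groupI)
    show "group ?M" by (intro sum_group grp)
    fix x y assume "x \<in> carrier ?M" "y \<in> carrier ?M"
    then have "x i \<in> carrier (G i)" "y i \<in> carrier (G i)" if "i \<in> I" for i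
      using carrier_sum_group[of I G] grp that by auto
    then show "x \<otimes>\<^bsub>?M\<^esub> y = y \<otimes>\<^bsub>?M\<^esub> x"
      using cg by (auto intro!: restrict_ext comm_monoid.m_comm simp: comm_group_def)
  qed
  moreover have "Hausdorff_space (coproduct_topology I G)"
  proof (rule Hausdorff_space_injective_preimage)
    show "Hausdorff_space ?P"
      by (intro Hausdorff_space_subtopology) (auto simp: Hausdorff_space_product_topology hd)
    have top: "topspace (coproduct_topology I G) = carrier ?M" "topspace ?P = carrier ?M"
      using coproduct_finest(1)[of I G] group_topology_sum_group_product[of I G] assms
      unfolding group_topology_def by auto
    show "continuous_map (coproduct_topology I G) ?P id"
      unfolding continuous_map_def top
    proof (intro conjI allI impI)
      fix U assume U: "openin ?P U"
      then have "{x \<in> carrier ?M. id x \<in> U} = U"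
        using openin_subset[OF U] top(2) by auto
      moreover have "openin (coproduct_topology I G) U"
        by (rule coproduct_finest(3)[OF assms group_topology_sum_group_product
              continuous_map_sum_incl_product U]) (use assms in auto)
      ultimately show "openin (coproduct_topology I G) {x \<in> carrier ?M. id x \<in> U}"
        by simp
    qed auto
  qed auto
  ultimately show ?thesis
    using coproduct_finest(1)[of I G] assms by (simp add: top_ab_group_def coproduct_def)
qed

subsection \<open>Representatives on the type of pairs\<close>

definition transport_topgroup :: "('a \<Rightarrow> 'b) \<Rightarrow> 'a topgroup \<Rightarrow> 'b topgroup" where
  "transport_topgroup \<phi> X = with_topology
     \<lparr>carrier = \<phi> ` carrier X,
      monoid.mult = (\<lambda>a b. \<phi> (inv_into (carrier X) \<phi> a \<otimes>\<^bsub>X\<^esub> inv_into (carrier X) \<phi> b)),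
      one = \<phi> \<one>\<^bsub>X\<^esub>\<rparr>
     (quotient_topology (topo X) \<phi>)"

lemma transport_topgroup:
  assumes X: "top_ab_group X" and inj: "inj_on \<phi> (carrier X)"
  shows "top_ab_group (transport_topgroup \<phi> X)"
    and "\<phi> \<in> hom X (transport_topgroup \<phi> X)"
    and "homeomorphic_maps (topo X) (topo (transport_topgroup \<phi> X)) \<phi> (inv_into (carrier X) \<phi>)"
proof -
  let ?Y = "transport_topgroup \<phi> X"
  let ?\<psi> = "inv_into (carrier X) \<phi>"
  interpret X: comm_group X
    using X by (simp add: top_ab_group_def)
  have top: "topspace (topo X) = carrier X"
    and cm: "continuous_map (prod_topology (topo X) (topo X)) (topo X) (\<lambda>(x, y). x \<otimes>\<^bsub>X\<^esub> y)"
    and ci: "continuous_map (topo X) (topo X) (\<lambda>x. inv\<^bsub>X\<^esub> x)"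
    and hd: "Hausdorff_space (topo X)"
    using X by (auto simp: top_ab_group_def group_topology_def)
  have carr: "carrier ?Y = \<phi> ` carrier X" and one: "\<one>\<^bsub>?Y\<^esub> = \<phi> \<one>\<^bsub>X\<^esub>"
    and mult: "\<And>a b. a \<otimes>\<^bsub>?Y\<^esub> b = \<phi> (?\<psi> a \<otimes>\<^bsub>X\<^esub> ?\<psi> b)"
    and topo: "topo ?Y = quotient_topology (topo X) \<phi>"
    by (simp_all add: transport_topgroup_def)
  have psi: "?\<psi> (\<phi> x) = x" if "x \<in> carrier X" for x
    using inv_into_f_f[OF inj that] .
  have mult': "\<phi> x \<otimes>\<^bsub>?Y\<^esub> \<phi> y = \<phi> (x \<otimes>\<^bsub>X\<^esub> y)" if "x \<in> carrier X" "y \<in> carrier X" for x y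
    using that by (simp add: mult psi)
  show hom: "\<phi> \<in> hom X ?Y"
    by (rule homI) (simp_all add: carr mult')
  have Y: "comm_group ?Y"
  proof (rule comm_groupI)
    fix a assume "a \<in> carrier ?Y"
    then obtain x where x: "x \<in> carrier X" "a = \<phi> x"
      by (auto simp: carr)
    then show "\<exists>b\<in>carrier ?Y. b \<otimes>\<^bsub>?Y\<^esub> a = \<one>\<^bsub>?Y\<^esub>"
      by (intro bexI[of _ "\<phi> (inv\<^bsub>X\<^esub> x)"]) (simp_all add: carr one mult')
  qed (auto simp: carr one mult' X.m_ac)
  have hmap: "homeomorphic_map (topo X) (topo ?Y) \<phi>"
    unfolding homeomorphic_map_def topo using inj top by (simp add: quotient_map_quotient_topology)
  show hmaps: "homeomorphic_maps (topo X) (topo ?Y) \<phi> ?\<psi>"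
  proof -
    obtain g where g: "homeomorphic_maps (topo X) (topo ?Y) \<phi> g"
      using hmap homeomorphic_map_maps by blast
    have eq: "g y = ?\<psi> y" if "y \<in> topspace (topo ?Y)" for y
    proof -
      have "y \<in> \<phi> ` carrier X"
        using that by (simp add: topo top)
      then obtain x where "x \<in> carrier X" "y = \<phi> x"
        by blast
      then show ?thesis
        using g psi top by (simp add: homeomorphic_maps_def)
    qed
    then have "continuous_map (topo ?Y) (topo X) ?\<psi>"
      using g continuous_map_eq unfolding homeomorphic_maps_def by blast
    then show ?thesis
      using g eq unfolding homeomorphic_maps_def by (simp add: psi top)
  qed
  have ctp: "continuous_map (topo X) (topo ?Y) \<phi>" and cts: "continuous_map (topo ?Y) (topo X) ?\<psi>"
    using hmaps by (simp_all add: homeomorphic_maps_def)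
  have topY: "topspace (topo ?Y) = carrier ?Y"
    by (simp add: topo carr top)
  have invY: "inv\<^bsub>?Y\<^esub> \<phi> x = \<phi> (inv\<^bsub>X\<^esub> x)" if "x \<in> carrier X" for x
  proof -
    interpret h: group_hom X ?Y \<phi>
      using hom Y X.is_group by (simp add: group_hom_def group_hom_axioms_def comm_group_def)
    show ?thesis
      using h.hom_inv[OF that] by simp
  qed
  have "group_topology ?Y (topo ?Y)"
    unfolding group_topology_def
  proof (intro conjI topY)
    have "continuous_map (prod_topology (topo ?Y) (topo ?Y)) (prod_topology (topo X) (topo X))
            (\<lambda>p. (?\<psi> (fst p), ?\<psi> (snd p)))"
      by (intro continuous_map_pairedI continuous_map_compose[OF _ cts, unfolded o_def]
          continuous_map_fst continuous_map_snd)
    from continuous_map_compose[OF continuous_map_compose[OF this cm] ctp]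
    show "continuous_map (prod_topology (topo ?Y) (topo ?Y)) (topo ?Y) (\<lambda>(x, y). x \<otimes>\<^bsub>?Y\<^esub> y)"
      by (simp add: o_def case_prod_unfold mult)
    have "continuous_map (topo ?Y) (topo ?Y) (\<lambda>y. \<phi> (inv\<^bsub>X\<^esub> ?\<psi> y))"
      using continuous_map_compose[OF continuous_map_compose[OF cts ci] ctp] by (simp add: o_def)
    then show "continuous_map (topo ?Y) (topo ?Y) (\<lambda>y. inv\<^bsub>?Y\<^esub> y)"
      by (rule continuous_map_eq) (auto simp: topY carr psi invY)
  qed
  moreover have "Hausdorff_space (topo ?Y)"
    using hd hmap homeomorphic_Hausdorff_space homeomorphic_map_imp_homeomorphic_space by blast
  ultimately show "top_ab_group ?Y"
    using Y by (simp add: top_ab_group_def)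
qed

lemma top_extension_representable:
  fixes E :: "('h, 'x, 'g) extension"
  assumes E: "top_extension H G E"
  shows "\<exists>E' :: ('h, 'g) repr. top_extension H G E' \<and> ext_equiv H E E' \<and> ext_equiv H E' E"
proof -
  define X i p where "X = mid E" and "i = incl E" and "p = proj E"
  have H: "top_ab_group H" and X: "top_ab_group X" and G: "top_ab_group G"
    and i: "i \<in> hom H X" "continuous_map (topo H) (topo X) i" "inj_on i (carrier H)"
    and io: "open_map (topo H) (subtopology (topo X) (i ` carrier H)) i"
    and p: "p \<in> hom X G" "continuous_map (topo X) (topo G) p" "p ` carrier X = carrier G"
    and po: "open_map (topo X) (subtopology (topo G) (p ` carrier X)) p"
    and ker: "i ` carrier H = kernel X G p"
    using E unfolding top_extension_def top_hom_def open_onto_image_def X_def i_def p_def by blast+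
  interpret X: comm_group X
    using X by (simp add: top_ab_group_def)
  interpret G: comm_group G
    using G by (simp add: top_ab_group_def)
  interpret p: group_hom X G p
    using p(1) by unfold_locales
  have topX: "topspace (topo X) = carrier X" and topH: "topspace (topo H) = carrier H"
    using X H by (auto simp: top_ab_group_def group_topology_def)
  define sec where "sec = inv_into (carrier X) p"
  have sec: "sec g \<in> carrier X" "p (sec g) = g" if "g \<in> carrier G" for g
    using that p(3) unfolding sec_def by (auto intro: inv_into_into f_inv_into_f)
  define \<phi> :: "'x \<Rightarrow> 'h \<times> 'g"
    where "\<phi> x = (inv_into (carrier H) i (x \<otimes>\<^bsub>X\<^esub> inv\<^bsub>X\<^esub> sec (p x)), p x)" for x
  have inj: "inj_on \<phi> (carrier X)"
  proof (rule inj_onI)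
    fix x y assume x: "x \<in> carrier X" and y: "y \<in> carrier X" and eq: "\<phi> x = \<phi> y"
    have pxy: "p x = p y"
      using eq by (simp add: \<phi>_def)
    have s: "sec (p x) \<in> carrier X" "p (sec (p x)) = p x"
      using sec x p.hom_closed by auto
    have mem: "z \<otimes>\<^bsub>X\<^esub> inv\<^bsub>X\<^esub> sec (p x) \<in> i ` carrier H" if "z \<in> carrier X" "p z = p x" for z
      unfolding ker kernel_def using that s G.r_inv[OF p.hom_closed[OF x]] by simp
    have "x \<otimes>\<^bsub>X\<^esub> inv\<^bsub>X\<^esub> sec (p x) = y \<otimes>\<^bsub>X\<^esub> inv\<^bsub>X\<^esub> sec (p x)"
      using eq pxy inv_into_injective[OF _ mem[OF x refl] mem[OF y pxy[symmetric]]]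
      by (simp add: \<phi>_def)
    then show "x = y"
      using s x y X.right_cancel by blast
  qed
  define \<psi> where "\<psi> = inv_into (carrier X) \<phi>"
  define Y where "Y = transport_topgroup \<phi> X"
  define E' :: "('h, 'g) repr"
    where "E' = \<lparr>mid = Y, incl = (\<lambda>h. \<phi> (i h)), proj = (\<lambda>y. p (\<psi> y))\<rparr>"
  note tr = transport_topgroup[OF X inj, folded Y_def \<psi>_def]
  have ctp: "continuous_map (topo X) (topo Y) \<phi>" and cts: "continuous_map (topo Y) (topo X) \<psi>"
    using tr(3) by (simp_all add: homeomorphic_maps_def)
  have op: "open_map (topo X) (topo Y) \<phi>" and os: "open_map (topo Y) (topo X) \<psi>"
    using tr(3) by (auto simp: homeomorphic_maps_map homeomorphic_imp_open_map)
  have carrY: "carrier Y = \<phi> ` carrier X"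
    by (simp add: Y_def transport_topgroup_def)
  have psi: "\<psi> (\<phi> x) = x" if "x \<in> carrier X" for x
    unfolding \<psi>_def using inv_into_f_f[OF inj that] .
  have ic: "i h \<in> carrier X" if "h \<in> carrier H" for h
    using i(1) that by (auto simp: hom_def)
  have hps: "\<psi> \<in> hom Y X"
  proof (rule homI)
    fix a b assume "a \<in> carrier Y" "b \<in> carrier Y"
    then obtain x y where "x \<in> carrier X" "y \<in> carrier X" "a = \<phi> x" "b = \<phi> y"
      by (auto simp: carrY)
    then show "\<psi> (a \<otimes>\<^bsub>Y\<^esub> b) = \<psi> a \<otimes>\<^bsub>X\<^esub> \<psi> b"
      using hom_mult[OF tr(2)] by (metis psi X.m_closed)
  qed (auto simp: carrY psi)
  have pY: "(\<lambda>y. p (\<psi> y)) ` carrier Y = carrier G"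
    unfolding carrY image_image p(3)[symmetric] by (rule image_cong) (simp_all add: psi)
  have "top_extension H G E'"
    unfolding top_extension_def top_hom_def open_onto_image_def E'_def extension.simps mem_Collect_eq
  proof (intro conjI H G tr(1) pY)
    show "(\<lambda>h. \<phi> (i h)) \<in> hom H Y"
      using hom_compose[OF i(1) tr(2)] by (simp add: o_def)
    show "continuous_map (topo H) (topo Y) (\<lambda>h. \<phi> (i h))"
      using continuous_map_compose[OF i(2) ctp] by (simp add: o_def)
    show "(\<lambda>y. p (\<psi> y)) \<in> hom Y G"
      using hom_compose[OF hps p(1)] by (simp add: o_def)
    show "continuous_map (topo Y) (topo G) (\<lambda>y. p (\<psi> y))"
      using continuous_map_compose[OF cts p(2)] by (simp add: o_def)
    show "open_map (topo Y) (subtopology (topo G) ((\<lambda>y. p (\<psi> y)) ` carrier Y)) (\<lambda>y. p (\<psi> y))"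
      using open_map_compose[OF os po] pY p(3) by (simp add: o_def)
    show "inj_on (\<lambda>h. \<phi> (i h)) (carrier H)"
      using i(3) inj ic unfolding inj_on_def by blast
    show "(\<lambda>h. \<phi> (i h)) ` carrier H = kernel Y G (\<lambda>y. p (\<psi> y))"
    proof -
      have "(\<lambda>h. \<phi> (i h)) ` carrier H = \<phi> ` kernel X G p"
        by (simp add: image_image flip: ker)
      also have "\<dots> = kernel Y G (\<lambda>y. p (\<psi> y))"
        by (auto simp: kernel_def carrY psi)
      finally show ?thesis .
    qed
    show "open_map (topo H) (subtopology (topo Y) ((\<lambda>h. \<phi> (i h)) ` carrier H)) (\<lambda>h. \<phi> (i h))"
      unfolding open_map_def
    proof (intro allI impI)
      fix U assume "openin (topo H) U"
      then obtain V where V: "openin (topo X) V" "i ` U = V \<inter> i ` carrier H"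
        using io unfolding open_map_def openin_subtopology by meson
      have sub: "V \<subseteq> carrier X" "i ` carrier H \<subseteq> carrier X"
        using openin_subset[OF V(1)] topX ic by auto
      have "(\<lambda>h. \<phi> (i h)) ` U = \<phi> ` (V \<inter> i ` carrier H)"
        by (simp add: image_image flip: V(2))
      also have "\<dots> = \<phi> ` V \<inter> \<phi> ` i ` carrier H"
        by (rule inj_on_image_Int[OF inj sub])
      finally show "openin (subtopology (topo Y) ((\<lambda>h. \<phi> (i h)) ` carrier H)) ((\<lambda>h. \<phi> (i h)) ` U)"
        using op V(1) unfolding open_map_def openin_subtopology image_image by blast
    qed
  qed
  moreover have "ext_equiv H E E'"
    unfolding ext_equiv_def top_hom_def
    by (rule bexI[of _ \<phi>]) (auto simp: E'_def tr(2) ctp psi X_def[symmetric] i_def p_def)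
  moreover have "ext_equiv H E' E"
    unfolding ext_equiv_def top_hom_def
    by (rule bexI[of _ \<psi>]) (auto simp: E'_def hps cts psi ic X_def[symmetric] i_def[symmetric] p_def)
  ultimately show ?thesis by blast
qed

end

theory Submission
  imports Defs "HOL-Algebra.Free_Abelian_Groups"
begin

text \<open>The isomorphism sends the class of an extension \<open>X\<close> of \<open>\<Oplus>G\<^sub>n\<close> to the classes of its pull-backs
  along the inclusions \<open>\<iota>\<^sub>n : G\<^sub>n \<rightarrow> \<Oplus>G\<^sub>n\<close>. Everything is phrased through morphisms of extensions, that is,
  commutative ladders, whose left and right components are prescribed homomorphisms \<open>s\<close> and \<open>t\<close>
  (\<open>ext_mor\<close>). A ladder with identities at both ends is invertible (\<open>ext_equiv_sym\<close>, a topological five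
  lemma). Pull-backs and push-outs are again extensions, and each is characterised by which
  ladders go into it or out of it. Therefore an extension that admits a ladder \<open>(id, \<iota>\<^sub>n)\<close> into \<open>X\<close> is
  equivalent to the pull-back of \<open>X\<close>, and it may serve in place of the pull-back.

  Additivity follows because the Baer sum, being a pull-back followed by a push-out, is functorial:
  ladders \<open>(id, t)\<close> from \<open>F\<close> to \<open>E\<close> and from \<open>F'\<close> to \<open>E'\<close> induce one from \<open>F + F'\<close> to \<open>E + E'\<close>
  (\<open>ext_mor_baer_sum\<close>).

  Bijectivity is the existence and uniqueness of a glued extension (\<open>glued_extension\<close>). Given
  extensions \<open>0 \<rightarrow> H \<rightarrow> X\<^sub>n \<rightarrow> G\<^sub>n \<rightarrow> 0\<close>, push the coproduct extension
  \<open>0 \<rightarrow> \<Oplus>H \<rightarrow> \<Oplus>X\<^sub>n \<rightarrow> \<Oplus>G\<^sub>n \<rightarrow> 0\<close> out along the summation homomorphism \<open>\<Oplus>H \<rightarrow> H\<close>. The result receives a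
  ladder \<open>(id, \<iota>\<^sub>n)\<close> from every \<open>X\<^sub>n\<close>, which gives surjectivity. If some extension \<open>X\<close> also receives such
  ladders, their middle maps \<open>X\<^sub>n \<rightarrow> X\<close> add up to a continuous homomorphism \<open>\<Oplus>X\<^sub>n \<rightarrow> X\<close>, and hence
  the glued extension is equivalent to \<open>X\<close>. Thus \<open>X\<close> is determined up to equivalence by its pull-backs.

  Countability enters in one place only. That \<open>\<Oplus>H \<rightarrow> \<Oplus>X\<^sub>n\<close> is an embedding and \<open>\<Oplus>X\<^sub>n \<rightarrow> \<Oplus>G\<^sub>n\<close> is open
  is checked coordinatewise, and this is possible because every neighbourhood of the identity in a
  countable coproduct contains an open box (\<open>open_nbhd_contains_box\<close>).\<close>

section \<open>Topological groups through neighbourhoods of the identity\<close>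

lemma group_topologyD:
  assumes "group_topology M T"
  shows "topspace T = carrier M"
    and "continuous_map (prod_topology T T) T (\<lambda>(x, y). x \<otimes>\<^bsub>M\<^esub> y)"
    and "continuous_map T T (\<lambda>x. inv\<^bsub>M\<^esub> x)"
  using assms by (auto simp: group_topology_def)

lemma top_ab_groupD:
  assumes "top_ab_group G"
  shows "comm_group G" and "group G" and "group_topology G (topo G)" and "Hausdorff_space (topo G)"
    and "topspace (topo G) = carrier G"
  using assms by (auto simp: top_ab_group_def group_topology_def comm_group_def)

lemma continuous_map_group_mult:
  assumes "group_topology M T" and "continuous_map Y T f" and "continuous_map Y T g"
  shows "continuous_map Y T (\<lambda>y. f y \<otimes>\<^bsub>M\<^esub> g y)"
  using continuous_map_compose[OF continuous_map_pairedI[OF assms(2,3)] group_topologyD(2)[OF assms(1)]]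
  by (simp add: o_def)

lemma continuous_map_group_inv:
  assumes "group_topology M T" and "continuous_map Y T f"
  shows "continuous_map Y T (\<lambda>y. inv\<^bsub>M\<^esub> f y)"
  using continuous_map_compose[OF assms(2) group_topologyD(3)[OF assms(1)]]
  by (simp add: o_def)

lemma group_topologyI:
  assumes "topspace T = carrier M"
    and "\<And>x y U. \<lbrakk>x \<in> carrier M; y \<in> carrier M; openin T U; x \<otimes>\<^bsub>M\<^esub> y \<in> U\<rbrakk> \<Longrightarrow>
      \<exists>A B. openin T A \<and> openin T B \<and> x \<in> A \<and> y \<in> B \<and> (\<forall>a\<in>A. \<forall>b\<in>B. a \<otimes>\<^bsub>M\<^esub> b \<in> U)"
    and "\<And>x U. \<lbrakk>x \<in> carrier M; openin T U; inv\<^bsub>M\<^esub> x \<in> U\<rbrakk> \<Longrightarrow>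
      \<exists>A. openin T A \<and> x \<in> A \<and> (\<forall>a\<in>A. inv\<^bsub>M\<^esub> a \<in> U)"
    and "group M"
  shows "group_topology M T"
proof -
  interpret group M by fact
  show ?thesis
    unfolding group_topology_def continuous_map_def topspace_prod_topology assms(1)
  proof (intro conjI allI impI)
    fix U assume U: "openin T U"
    show "openin (prod_topology T T)
            {p \<in> carrier M \<times> carrier M. (case p of (x, y) \<Rightarrow> x \<otimes>\<^bsub>M\<^esub> y) \<in> U}"
      unfolding openin_prod_topology_alt
    proof (intro allI impI)
      fix x y assume "(x, y) \<in> {p \<in> carrier M \<times> carrier M. (case p of (x, y) \<Rightarrow> x \<otimes>\<^bsub>M\<^esub> y) \<in> U}"
      then have xy: "x \<in> carrier M" "y \<in> carrier M" "x \<otimes>\<^bsub>M\<^esub> y \<in> U" by simp_all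
      obtain A B where AB: "openin T A" "openin T B" "x \<in> A" "y \<in> B"
          "\<forall>a\<in>A. \<forall>b\<in>B. a \<otimes>\<^bsub>M\<^esub> b \<in> U"
        using assms(2)[OF xy(1,2) U xy(3)] by auto
      moreover have "A \<subseteq> carrier M" "B \<subseteq> carrier M"
        using AB openin_subset assms(1) by blast+
      ultimately show "\<exists>A B. openin T A \<and> openin T B \<and> x \<in> A \<and> y \<in> B \<and>
          A \<times> B \<subseteq> {p \<in> carrier M \<times> carrier M. (case p of (x, y) \<Rightarrow> x \<otimes>\<^bsub>M\<^esub> y) \<in> U}"
        by (intro exI[of _ A] exI[of _ B]) auto
    qed
    show "openin T {x \<in> carrier M. inv\<^bsub>M\<^esub> x \<in> U}"
    proof (subst openin_subopen, intro ballI)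
      fix x assume "x \<in> {x \<in> carrier M. inv\<^bsub>M\<^esub> x \<in> U}"
      then have x: "x \<in> carrier M" "inv\<^bsub>M\<^esub> x \<in> U" by simp_all
      obtain A where A: "openin T A" "x \<in> A" "\<forall>a\<in>A. inv\<^bsub>M\<^esub> a \<in> U"
        using assms(3)[OF x(1) U x(2)] by auto
      then show "\<exists>A. openin T A \<and> x \<in> A \<and> A \<subseteq> {x \<in> carrier M. inv\<^bsub>M\<^esub> x \<in> U}"
        using openin_subset[OF A(1)] assms(1) by (intro exI[of _ A]) auto
    qed
  qed auto
qed

lemma openin_left_translate:
  assumes "group_topology M T" and "a \<in> carrier M" and "openin T U"
  shows "openin T {x \<in> carrier M. a \<otimes>\<^bsub>M\<^esub> x \<in> U}"
proof -
  have "continuous_map T T (\<lambda>x. a \<otimes>\<^bsub>M\<^esub> x)"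
    by (intro continuous_map_group_mult[OF assms(1)])
      (use assms(2) group_topologyD(1)[OF assms(1)] in simp_all)
  from openin_continuous_map_preimage[OF this assms(3)] show ?thesis
    by (simp add: group_topologyD(1)[OF assms(1)])
qed

lemma group_nbhd_mult:
  assumes "group_topology M T" and "x \<in> carrier M" and "y \<in> carrier M"
    and "openin T U" and "x \<otimes>\<^bsub>M\<^esub> y \<in> U"
  obtains A B where "openin T A" and "openin T B" and "x \<in> A" and "y \<in> B"
    and "\<And>a b. a \<in> A \<Longrightarrow> b \<in> B \<Longrightarrow> a \<otimes>\<^bsub>M\<^esub> b \<in> U"
proof -
  have "openin (prod_topology T T) {p \<in> topspace (prod_topology T T). (case p of (x, y) \<Rightarrow> x \<otimes>\<^bsub>M\<^esub> y) \<in> U}"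
    using openin_continuous_map_preimage[OF group_topologyD(2)[OF assms(1)] assms(4)] .
  moreover have "(x, y) \<in> {p \<in> topspace (prod_topology T T). (case p of (x, y) \<Rightarrow> x \<otimes>\<^bsub>M\<^esub> y) \<in> U}"
    using assms(2,3,5) by (simp add: group_topologyD(1)[OF assms(1)])
  ultimately obtain A B where "openin T A" "openin T B" "x \<in> A" "y \<in> B"
    "A \<times> B \<subseteq> {p \<in> topspace (prod_topology T T). (case p of (x, y) \<Rightarrow> x \<otimes>\<^bsub>M\<^esub> y) \<in> U}"
    unfolding openin_prod_topology_alt by meson
  then show thesis by (intro that[of A B]) auto
qed

lemma group_nbhd_one_mult:
  assumes "group_topology M T" and "group M" and "openin T U" and "\<one>\<^bsub>M\<^esub> \<in> U"
  obtains V where "openin T V" and "\<one>\<^bsub>M\<^esub> \<in> V" and "\<And>a b. a \<in> V \<Longrightarrow> b \<in> V \<Longrightarrow> a \<otimes>\<^bsub>M\<^esub> b \<in> U"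
proof -
  interpret group M by fact
  obtain A B where "openin T A" "openin T B" "\<one>\<^bsub>M\<^esub> \<in> A" "\<one>\<^bsub>M\<^esub> \<in> B"
      "\<And>a b. a \<in> A \<Longrightarrow> b \<in> B \<Longrightarrow> a \<otimes>\<^bsub>M\<^esub> b \<in> U"
    by (rule group_nbhd_mult[OF assms(1) one_closed one_closed assms(3)]) (use assms(4) in auto)
  then show thesis by (intro that[of "A \<inter> B"]) auto
qed

lemma group_nbhd_one_div:
  assumes "group_topology M T" and "group M" and "openin T U" and "\<one>\<^bsub>M\<^esub> \<in> U"
  obtains V where "openin T V" and "\<one>\<^bsub>M\<^esub> \<in> V"
    and "\<And>a b. a \<in> V \<Longrightarrow> b \<in> V \<Longrightarrow> a \<otimes>\<^bsub>M\<^esub> inv\<^bsub>M\<^esub> b \<in> U"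
proof -
  interpret group M by fact
  obtain V where V: "openin T V" "\<one>\<^bsub>M\<^esub> \<in> V" "\<And>a b. a \<in> V \<Longrightarrow> b \<in> V \<Longrightarrow> a \<otimes>\<^bsub>M\<^esub> b \<in> U"
    using group_nbhd_one_mult[OF assms] by blast
  have "openin T {x \<in> topspace T. inv\<^bsub>M\<^esub> x \<in> V}"
    by (rule openin_continuous_map_preimage[OF group_topologyD(3)[OF assms(1)] V(1)])
  with V show thesis
    by (intro that[of "V \<inter> {x \<in> topspace T. inv\<^bsub>M\<^esub> x \<in> V}"])
      (auto simp: group_topologyD(1)[OF assms(1)])
qed

text \<open>A group topology that satisfies the \<open>T\<^sub>1\<close> axiom at the identity is Hausdorff, by homogeneity.\<close>

lemma Hausdorff_group_topologyI:
  assumes "group_topology M T" and "group M"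
    and sep: "\<And>x. \<lbrakk>x \<in> carrier M; x \<noteq> \<one>\<^bsub>M\<^esub>\<rbrakk> \<Longrightarrow> \<exists>U. openin T U \<and> \<one>\<^bsub>M\<^esub> \<in> U \<and> x \<notin> U"
  shows "Hausdorff_space T"
  unfolding Hausdorff_space_def
proof (intro allI impI)
  interpret group M by fact
  note top = group_topologyD(1)[OF assms(1)]
  fix x y assume "x \<in> topspace T \<and> y \<in> topspace T \<and> x \<noteq> y"
  then have x: "x \<in> carrier M" and y: "y \<in> carrier M" and "x \<noteq> y"
    by (auto simp: top)
  then have "x \<otimes>\<^bsub>M\<^esub> inv\<^bsub>M\<^esub> y \<noteq> \<one>\<^bsub>M\<^esub>"
    using inv_equality inv_inv by fastforce
  then obtain U where U: "openin T U" "\<one>\<^bsub>M\<^esub> \<in> U" "x \<otimes>\<^bsub>M\<^esub> inv\<^bsub>M\<^esub> y \<notin> U"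
    using sep x y by (meson inv_closed m_closed)
  \<comment> \<open>\<open>(a, b) \<mapsto> (x a\<^sup>-\<^sup>1) (b y\<^sup>-\<^sup>1)\<close> maps \<open>(x, y)\<close> into \<open>U\<close>, but no point of the diagonal.\<close>
  define f where "f p = (x \<otimes>\<^bsub>M\<^esub> inv\<^bsub>M\<^esub> fst p) \<otimes>\<^bsub>M\<^esub> (snd p \<otimes>\<^bsub>M\<^esub> inv\<^bsub>M\<^esub> y)" for p
  have "continuous_map (prod_topology T T) T f"
    unfolding f_def
    by (intro continuous_map_group_mult[OF assms(1)] continuous_map_group_inv[OF assms(1)]
        continuous_map_fst continuous_map_snd) (use x y in \<open>simp_all add: top\<close>)
  from openin_continuous_map_preimage[OF this U(1)]
  have "openin (prod_topology T T) {p \<in> topspace (prod_topology T T). f p \<in> U}" .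
  moreover have "(x, y) \<in> {p \<in> topspace (prod_topology T T). f p \<in> U}"
    using x y U(2) by (simp add: f_def top)
  ultimately obtain A B where AB: "openin T A" "openin T B" "x \<in> A" "y \<in> B"
      "A \<times> B \<subseteq> {p \<in> topspace (prod_topology T T). f p \<in> U}"
    unfolding openin_prod_topology_alt by meson
  have "disjnt A B"
    unfolding disjnt_iff
  proof (intro allI notI)
    fix c assume c: "c \<in> A \<and> c \<in> B"
    then have cM: "c \<in> carrier M" using AB(1) openin_subset top by blast
    have "inv\<^bsub>M\<^esub> c \<otimes>\<^bsub>M\<^esub> (c \<otimes>\<^bsub>M\<^esub> inv\<^bsub>M\<^esub> y) = inv\<^bsub>M\<^esub> y"
      using y cM by (simp add: m_assoc[symmetric])
    then have "f (c, c) = x \<otimes>\<^bsub>M\<^esub> inv\<^bsub>M\<^esub> y"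
      using x y cM by (simp add: f_def m_assoc)
    then show False using c AB(5) U(3) by force
  qed
  then show "\<exists>A B. openin T A \<and> openin T B \<and> x \<in> A \<and> y \<in> B \<and> disjnt A B"
    using AB by blast
qed

text \<open>By translation, openness of a homomorphism onto its image can be tested at the identity.\<close>

lemma open_map_homI:
  assumes A: "group A" "group_topology A S" and B: "group B" "group_topology B T"
    and f: "f \<in> hom A B"
    and nbhd: "\<And>U. \<lbrakk>openin S U; \<one>\<^bsub>A\<^esub> \<in> U\<rbrakk> \<Longrightarrow> \<exists>W. openin T W \<and> \<one>\<^bsub>B\<^esub> \<in> W \<and> W \<inter> f ` carrier A \<subseteq> f ` U"
  shows "open_map S (subtopology T (f ` carrier A)) f"
  unfolding open_map_def
proof (intro allI impI)
  interpret f: group_hom A B f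
    using A B f by (simp add: group_hom_def group_hom_axioms_def)
  note top = group_topologyD(1)[OF A(2)] group_topologyD(1)[OF B(2)]
  fix U assume U: "openin S U"
  then have sub: "U \<subseteq> carrier A" using openin_subset top by blast
  show "openin (subtopology T (f ` carrier A)) (f ` U)"
  proof (subst openin_subopen, intro ballI)
    fix b assume "b \<in> f ` U"
    then obtain a where a: "a \<in> U" "b = f a" by blast
    then have aA: "a \<in> carrier A" using sub by blast
    have "openin S {x \<in> carrier A. a \<otimes>\<^bsub>A\<^esub> x \<in> U}"
      by (rule openin_left_translate[OF A(2) aA U])
    then obtain W where W: "openin T W" "\<one>\<^bsub>B\<^esub> \<in> W"
        "W \<inter> f ` carrier A \<subseteq> f ` {x \<in> carrier A. a \<otimes>\<^bsub>A\<^esub> x \<in> U}"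
      using nbhd[of "{x \<in> carrier A. a \<otimes>\<^bsub>A\<^esub> x \<in> U}"] a(1) aA by auto
    \<comment> \<open>Transport the neighbourhood \<open>W\<close> of the identity to the point \<open>b\<close>.\<close>
    define V where "V = {y \<in> carrier B. inv\<^bsub>B\<^esub> b \<otimes>\<^bsub>B\<^esub> y \<in> W}"
    have "openin T V"
      unfolding V_def by (rule openin_left_translate[OF B(2) _ W(1)]) (use a aA in simp)
    moreover have "b \<in> V"
      using a aA W(2) by (simp add: V_def)
    moreover have "V \<inter> f ` carrier A \<subseteq> f ` U"
    proof
      fix y assume "y \<in> V \<inter> f ` carrier A"
      then obtain c where c: "c \<in> carrier A" "y = f c" "inv\<^bsub>B\<^esub> b \<otimes>\<^bsub>B\<^esub> y \<in> W"
        by (auto simp: V_def)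
      moreover have "inv\<^bsub>B\<^esub> b \<otimes>\<^bsub>B\<^esub> y = f (inv\<^bsub>A\<^esub> a \<otimes>\<^bsub>A\<^esub> c)"
        using a aA c by simp
      ultimately have "inv\<^bsub>B\<^esub> b \<otimes>\<^bsub>B\<^esub> y \<in> f ` {x \<in> carrier A. a \<otimes>\<^bsub>A\<^esub> x \<in> U}"
        using W(3) aA by blast
      then obtain x where x: "x \<in> carrier A" "a \<otimes>\<^bsub>A\<^esub> x \<in> U" "inv\<^bsub>B\<^esub> b \<otimes>\<^bsub>B\<^esub> y = f x"
        by blast
      have "y = b \<otimes>\<^bsub>B\<^esub> (inv\<^bsub>B\<^esub> b \<otimes>\<^bsub>B\<^esub> y)"
        using a aA c by (simp add: f.H.m_assoc[symmetric] del: f.hom_inv)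
      then have "y = f (a \<otimes>\<^bsub>A\<^esub> x)"
        using x a aA by simp
      then show "y \<in> f ` U" using x(2) by blast
    qed
    ultimately show "\<exists>V. openin (subtopology T (f ` carrier A)) V \<and> b \<in> V \<and> V \<subseteq> f ` U"
      using a aA by (intro exI[of _ "V \<inter> f ` carrier A"]) (auto simp: openin_subtopology)
  qed
qed

subsection \<open>Products, subgroups and quotients\<close>

lemma prod_topgroup_simps [simp]:
  "carrier (prod_topgroup G H) = carrier G \<times> carrier H"
  "monoid.mult (prod_topgroup G H) = (\<lambda>(a, b) (c, d). (a \<otimes>\<^bsub>G\<^esub> c, b \<otimes>\<^bsub>H\<^esub> d))"
  "\<one>\<^bsub>prod_topgroup G H\<^esub> = (\<one>\<^bsub>G\<^esub>, \<one>\<^bsub>H\<^esub>)"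
  "topo (prod_topgroup G H) = prod_topology (topo G) (topo H)"
  by (simp_all add: prod_topgroup_def DirProd_def)

lemma inv_prod_topgroup [simp]:
  assumes "group G" "group H" "a \<in> carrier G" "b \<in> carrier H"
  shows "inv\<^bsub>prod_topgroup G H\<^esub> (a, b) = (inv\<^bsub>G\<^esub> a, inv\<^bsub>H\<^esub> b)"
  using inv_DirProd[OF assms] by (simp add: prod_topgroup_def)

lemma top_ab_group_prod:
  assumes G: "top_ab_group G" and H: "top_ab_group H"
  shows "top_ab_group (prod_topgroup G H)"
proof -
  interpret G: comm_group G by (rule top_ab_groupD(1)[OF G])
  interpret H: comm_group H by (rule top_ab_groupD(1)[OF H])
  note top = top_ab_groupD(5)[OF G] top_ab_groupD(5)[OF H]
  have cg: "comm_group (prod_topgroup G H)"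
  proof (rule comm_groupI)
    fix x assume "x \<in> carrier (prod_topgroup G H)"
    then show "\<exists>y\<in>carrier (prod_topgroup G H). y \<otimes>\<^bsub>prod_topgroup G H\<^esub> x = \<one>\<^bsub>prod_topgroup G H\<^esub>"
      by (intro bexI[of _ "(inv\<^bsub>G\<^esub> fst x, inv\<^bsub>H\<^esub> snd x)"]) auto
  qed (auto simp: G.m_ac H.m_ac)
  let ?T = "prod_topology (topo G) (topo H)"
  have fst: "continuous_map (prod_topology ?T ?T) (topo G) (\<lambda>p. fst (fst p))"
      "continuous_map (prod_topology ?T ?T) (topo G) (\<lambda>p. fst (snd p))"
      "continuous_map (prod_topology ?T ?T) (topo H) (\<lambda>p. snd (fst p))"
      "continuous_map (prod_topology ?T ?T) (topo H) (\<lambda>p. snd (snd p))"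
    by (intro continuous_map_compose[OF continuous_map_fst continuous_map_fst, unfolded o_def]
        continuous_map_compose[OF continuous_map_snd continuous_map_fst, unfolded o_def]
        continuous_map_compose[OF continuous_map_fst continuous_map_snd, unfolded o_def]
        continuous_map_compose[OF continuous_map_snd continuous_map_snd, unfolded o_def])+
  have "group_topology (prod_topgroup G H) ?T"
    unfolding group_topology_def
  proof (intro conjI)
    show "topspace ?T = carrier (prod_topgroup G H)" by (simp add: top)
    have "continuous_map (prod_topology ?T ?T) ?T
        (\<lambda>p. (fst (fst p) \<otimes>\<^bsub>G\<^esub> fst (snd p), snd (fst p) \<otimes>\<^bsub>H\<^esub> snd (snd p)))"
      by (intro continuous_map_pairedI continuous_map_group_mult fst
          top_ab_groupD(3)[OF G] top_ab_groupD(3)[OF H])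
    then show "continuous_map (prod_topology ?T ?T) ?T (\<lambda>(x, y). x \<otimes>\<^bsub>prod_topgroup G H\<^esub> y)"
      by (simp add: case_prod_unfold)
    have "continuous_map ?T ?T (\<lambda>p. (inv\<^bsub>G\<^esub> fst p, inv\<^bsub>H\<^esub> snd p))"
      by (intro continuous_map_pairedI continuous_map_group_inv continuous_map_fst continuous_map_snd
          top_ab_groupD(3)[OF G] top_ab_groupD(3)[OF H])
    then show "continuous_map ?T ?T (\<lambda>x. inv\<^bsub>prod_topgroup G H\<^esub> x)"
      by (rule continuous_map_eq) (auto simp: top)
  qed
  moreover have "Hausdorff_space ?T"
    using top_ab_groupD(4)[OF G] top_ab_groupD(4)[OF H] by (simp add: Hausdorff_space_prod_topology)
  ultimately show ?thesis using cg by (simp add: top_ab_group_def)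
qed

lemma sub_topgroup_simps [simp]:
  "carrier (sub_topgroup G S) = S"
  "monoid.mult (sub_topgroup G S) = monoid.mult G"
  "\<one>\<^bsub>sub_topgroup G S\<^esub> = \<one>\<^bsub>G\<^esub>"
  "topo (sub_topgroup G S) = subtopology (topo G) S"
  by (simp_all add: sub_topgroup_def)

lemma top_ab_group_sub:
  assumes G: "top_ab_group G" and S: "subgroup S G"
  shows "top_ab_group (sub_topgroup G S)"
proof -
  interpret G: comm_group G by (rule top_ab_groupD(1)[OF G])
  note top = top_ab_groupD(5)[OF G]
  have sub: "S \<subseteq> carrier G" by (rule subgroup.subset[OF S])
  have "comm_group (G\<lparr>carrier := S\<rparr>)"
    by (rule group.group_comm_groupI[OF subgroup.subgroup_is_group[OF S G.is_group]])
      (use sub in \<open>auto intro!: G.m_comm\<close>)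
  then have cg: "comm_group (sub_topgroup G S)"
    by (simp add: sub_topgroup_def)
  have inv: "inv\<^bsub>sub_topgroup G S\<^esub> x = inv\<^bsub>G\<^esub> x" if "x \<in> S" for x
    using G.m_inv_consistent[OF S that] by (simp add: sub_topgroup_def)
  let ?T = "subtopology (topo G) S"
  have "group_topology (sub_topgroup G S) ?T"
    unfolding group_topology_def
  proof (intro conjI)
    show "topspace ?T = carrier (sub_topgroup G S)" using sub by (auto simp: top)
    have id: "continuous_map ?T (topo G) (\<lambda>x. x)"
      by (simp add: continuous_map_from_subtopology)
    have "continuous_map (prod_topology ?T ?T) (topo G) (\<lambda>p. fst p \<otimes>\<^bsub>G\<^esub> snd p)"
      by (rule continuous_map_group_mult[OF top_ab_groupD(3)[OF G]
            continuous_map_into_fulltopology[OF continuous_map_fst]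
            continuous_map_into_fulltopology[OF continuous_map_snd]])
    then show "continuous_map (prod_topology ?T ?T) ?T (\<lambda>(x, y). x \<otimes>\<^bsub>sub_topgroup G S\<^esub> y)"
      using subgroup.m_closed[OF S]
      by (auto intro!: continuous_map_into_subtopology simp: case_prod_unfold)
    have "continuous_map ?T (topo G) (\<lambda>x. inv\<^bsub>G\<^esub> x)"
      by (intro continuous_map_group_inv[OF top_ab_groupD(3)[OF G]] id)
    then have "continuous_map ?T ?T (\<lambda>x. inv\<^bsub>G\<^esub> x)"
      using subgroup.m_inv_closed[OF S] by (auto intro!: continuous_map_into_subtopology)
    then show "continuous_map ?T ?T (\<lambda>x. inv\<^bsub>sub_topgroup G S\<^esub> x)"
      by (rule continuous_map_eq) (auto simp: inv)
  qed
  moreover have "Hausdorff_space ?T"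
    using top_ab_groupD(4)[OF G] by (rule Hausdorff_space_subtopology)
  ultimately show ?thesis using cg by (simp add: top_ab_group_def)
qed

lemma quot_topgroup_simps [simp]:
  "carrier (quot_topgroup G N) = (\<lambda>x. N #>\<^bsub>G\<^esub> x) ` carrier G"
  "monoid.mult (quot_topgroup G N) = set_mult G"
  "\<one>\<^bsub>quot_topgroup G N\<^esub> = N"
  "topo (quot_topgroup G N) = quotient_topology (topo G) (r_coset G N)"
  by (simp_all add: quot_topgroup_def carrier_FactGroup)

text \<open>The quotient map is open because the saturation of an open set is a union of translates of it. The
  openness also carries continuity of the operations over to the quotient. The quotient is
  Hausdorff only if the subgroup is closed; in the push-out this is obtained from the
  exact sequence, see \<open>top_extensionI\<close>.\<close>

lemma quot_topgroup:
  assumes G: "top_ab_group G" and N: "subgroup N G"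
  shows "comm_group (quot_topgroup G N)"
    and "r_coset G N \<in> top_hom G (quot_topgroup G N)"
    and "open_map (topo G) (topo (quot_topgroup G N)) (r_coset G N)"
    and "group_topology (quot_topgroup G N) (topo (quot_topgroup G N))"
proof -
  interpret G: comm_group G by (rule top_ab_groupD(1)[OF G])
  interpret N: normal N G by (rule G.subgroup_imp_normal[OF N])
  note top = top_ab_groupD(5)[OF G]
  let ?q = "r_coset G N" and ?Q = "quot_topgroup G N"
  have sub: "N \<subseteq> carrier G" by (rule subgroup.subset[OF N])
  show cg: "comm_group ?Q"
    using G.abelian_FactGroup[OF N] by (simp add: quot_topgroup_def)
  interpret Q: comm_group ?Q by (rule cg)
  have q: "?q \<in> hom G ?Q"
    using N.r_coset_hom_Mod by (simp add: quot_topgroup_def hom_def)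
  interpret q: group_hom G ?Q ?q
    using q by unfold_locales
  have cq: "continuous_map (topo G) (topo ?Q) ?q"
    by (simp add: quotient_imp_continuous_map quotient_map_quotient_topology)
  with q show "?q \<in> top_hom G ?Q" by (simp add: top_hom_def)
  show oq: "open_map (topo G) (topo ?Q) ?q"
    unfolding open_map_def
  proof (intro allI impI)
    fix U assume U: "openin (topo G) U"
    then have UG: "U \<subseteq> carrier G" using openin_subset top by blast
    have "{x \<in> topspace (topo G). ?q x \<in> ?q ` U} = (\<Union>n\<in>N. {x \<in> carrier G. n \<otimes>\<^bsub>G\<^esub> x \<in> U})"
    proof (intro equalityI subsetI)
      fix x assume "x \<in> {x \<in> topspace (topo G). ?q x \<in> ?q ` U}"
      then obtain u where u: "x \<in> carrier G" "u \<in> U" "?q x = ?q u" by (auto simp: top)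
      then have "u \<in> N #>\<^bsub>G\<^esub> x" using G.rcos_self[OF subsetD[OF UG u(2)] N] by simp
      then show "x \<in> (\<Union>n\<in>N. {x \<in> carrier G. n \<otimes>\<^bsub>G\<^esub> x \<in> U})"
        using u by (auto simp: r_coset_def)
    next
      fix x assume "x \<in> (\<Union>n\<in>N. {x \<in> carrier G. n \<otimes>\<^bsub>G\<^esub> x \<in> U})"
      then obtain n where n: "n \<in> N" "x \<in> carrier G" "n \<otimes>\<^bsub>G\<^esub> x \<in> U" by blast
      then have "?q (n \<otimes>\<^bsub>G\<^esub> x) = ?q x"
        using G.coset_mult_assoc[OF sub subsetD[OF sub n(1)] n(2)]
          G.coset_join2[OF subsetD[OF sub n(1)] N n(1)] by simp
      then have "?q x \<in> ?q ` U" by (metis imageI n(3))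
      then show "x \<in> {x \<in> topspace (topo G). ?q x \<in> ?q ` U}"
        using n(2) by (simp add: top)
    qed
    moreover have "openin (topo G) (\<Union>n\<in>N. {x \<in> carrier G. n \<otimes>\<^bsub>G\<^esub> x \<in> U})"
      using openin_left_translate[OF top_ab_groupD(3)[OF G] _ U] sub by blast
    ultimately show "openin (topo ?Q) (?q ` U)"
      using UG by (auto simp: openin_quotient_topology top)
  qed
  have topQ: "topspace (topo ?Q) = carrier ?Q" by (simp add: top)
  show "group_topology ?Q (topo ?Q)"
  proof (rule group_topologyI[OF topQ])
    fix X Y U assume "X \<in> carrier ?Q" "Y \<in> carrier ?Q" and U: "openin (topo ?Q) U" "X \<otimes>\<^bsub>?Q\<^esub> Y \<in> U"
    then obtain x y where x: "x \<in> carrier G" "X = ?q x" and y: "y \<in> carrier G" "Y = ?q y" by auto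
    have mem: "x \<otimes>\<^bsub>G\<^esub> y \<in> {z \<in> topspace (topo G). ?q z \<in> U}"
      using U(2) x(1) y(1) q.hom_mult[OF x(1) y(1)] unfolding x(2) y(2) top by simp
    obtain A B where AB: "openin (topo G) A" "openin (topo G) B" "x \<in> A" "y \<in> B"
        "\<And>a b. a \<in> A \<Longrightarrow> b \<in> B \<Longrightarrow> a \<otimes>\<^bsub>G\<^esub> b \<in> {z \<in> topspace (topo G). ?q z \<in> U}"
      by (rule group_nbhd_mult[OF top_ab_groupD(3)[OF G] x(1) y(1)
          openin_continuous_map_preimage[OF cq U(1)] mem]) (rule that, assumption+)
    have sub: "A \<subseteq> carrier G" "B \<subseteq> carrier G"
      using openin_subset[OF AB(1)] openin_subset[OF AB(2)] by (simp_all add: top)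
    show "\<exists>A B. openin (topo ?Q) A \<and> openin (topo ?Q) B \<and> X \<in> A \<and> Y \<in> B \<and>
        (\<forall>a\<in>A. \<forall>b\<in>B. a \<otimes>\<^bsub>?Q\<^esub> b \<in> U)"
    proof (rule exI[of _ "?q ` A"], rule exI[of _ "?q ` B"], intro conjI)
      show "openin (topo ?Q) (?q ` A)" "openin (topo ?Q) (?q ` B)"
        using oq AB by (simp_all add: open_map_def)
      show "X \<in> ?q ` A" "Y \<in> ?q ` B" using AB x y by simp_all
      show "\<forall>a\<in>?q ` A. \<forall>b\<in>?q ` B. a \<otimes>\<^bsub>?Q\<^esub> b \<in> U"
      proof (intro ballI)
        fix c d assume "c \<in> ?q ` A" "d \<in> ?q ` B"
        then obtain a b where ab: "a \<in> A" "b \<in> B" "c = ?q a" "d = ?q b" by blast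
        have "c \<otimes>\<^bsub>?Q\<^esub> d = ?q (a \<otimes>\<^bsub>G\<^esub> b)"
          unfolding ab(3,4)
          by (rule q.hom_mult[OF subsetD[OF sub(1) ab(1)] subsetD[OF sub(2) ab(2)], symmetric])
        then show "c \<otimes>\<^bsub>?Q\<^esub> d \<in> U" using AB(5)[OF ab(1,2)] by simp
      qed
    qed
  next
    fix X U assume "X \<in> carrier ?Q" and U: "openin (topo ?Q) U" "inv\<^bsub>?Q\<^esub> X \<in> U"
    then obtain x where x: "x \<in> carrier G" "X = ?q x" by auto
    define A where "A = {z \<in> topspace (topo G). ?q (inv\<^bsub>G\<^esub> z) \<in> U}"
    have "openin (topo G) A"
      unfolding A_def
      by (rule openin_continuous_map_preimage[OF _ U(1)])
        (use continuous_map_compose[OF group_topologyD(3)[OF top_ab_groupD(3)[OF G]] cq] in \<open>simp add: o_def\<close>)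
    then have "openin (topo ?Q) (?q ` A)" using oq by (simp add: open_map_def)
    moreover have "x \<in> A"
      using U(2) x q.hom_inv[OF x(1)] by (simp add: A_def top)
    then have "X \<in> ?q ` A"
      using x(2) by blast
    moreover have "inv\<^bsub>?Q\<^esub> a \<in> U" if "a \<in> ?q ` A" for a
    proof -
      obtain z where "z \<in> A" "a = ?q z" using \<open>a \<in> ?q ` A\<close> by blast
      moreover from this have "?q (inv\<^bsub>G\<^esub> z) = inv\<^bsub>?Q\<^esub> ?q z" by (intro q.hom_inv) (simp add: A_def top)
      ultimately show ?thesis by (simp add: A_def)
    qed
    ultimately show "\<exists>A. openin (topo ?Q) A \<and> X \<in> A \<and> (\<forall>a\<in>A. inv\<^bsub>?Q\<^esub> a \<in> U)" by blast
  qed (rule Q.is_group)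
qed

section \<open>Extensions and their morphisms\<close>

locale top_ext =
  fixes H :: "'h topgroup" and G :: "'g topgroup" and E :: "('h, 'x, 'g) extension"
  assumes ext: "top_extension H G E"
begin

lemma top_ab: "top_ab_group H" "top_ab_group (mid E)" "top_ab_group G"
  using ext by (auto simp: top_extension_def)

lemma homs: "incl E \<in> hom H (mid E)" "proj E \<in> hom (mid E) G"
  and cont: "continuous_map (topo H) (topo (mid E)) (incl E)"
    "continuous_map (topo (mid E)) (topo G) (proj E)"
  using ext by (auto simp: top_extension_def top_hom_def)

sublocale H: comm_group H using top_ab_groupD(1)[OF top_ab(1)] .
sublocale X: comm_group "mid E" using top_ab_groupD(1)[OF top_ab(2)] .
sublocale G: comm_group G using top_ab_groupD(1)[OF top_ab(3)] .
sublocale i: group_hom H "mid E" "incl E" using homs(1) by unfold_locales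
sublocale p: group_hom "mid E" G "proj E" using homs(2) by unfold_locales

lemma topspaces [simp]:
  "topspace (topo H) = carrier H" "topspace (topo (mid E)) = carrier (mid E)"
  "topspace (topo G) = carrier G"
  using top_ab top_ab_groupD(5) by blast+

lemma group_topologies:
  "group_topology H (topo H)" "group_topology (mid E) (topo (mid E))" "group_topology G (topo G)"
  using top_ab top_ab_groupD(3) by blast+

lemma kernel_proj: "incl E ` carrier H = kernel (mid E) G (proj E)"
  using ext by (simp add: top_extension_def)

lemma proj_incl [simp]: "h \<in> carrier H \<Longrightarrow> proj E (incl E h) = \<one>\<^bsub>G\<^esub>"
  using kernel_proj by (auto simp: kernel_def)

lemma kernel_projE:
  assumes "x \<in> carrier (mid E)" and "proj E x = \<one>\<^bsub>G\<^esub>"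
  obtains h where "h \<in> carrier H" and "x = incl E h"
  using assms kernel_proj by (auto simp: kernel_def)

lemma proj_surj:
  assumes "g \<in> carrier G"
  obtains x where "x \<in> carrier (mid E)" and "proj E x = g"
proof -
  have "g \<in> proj E ` carrier (mid E)"
    using assms ext by (simp add: top_extension_def)
  then show thesis using that by blast
qed

lemma incl_eq_oneD: "h \<in> carrier H \<Longrightarrow> incl E h = \<one>\<^bsub>mid E\<^esub> \<Longrightarrow> h = \<one>\<^bsub>H\<^esub>"
  using ext i.hom_one H.one_closed unfolding top_extension_def inj_on_def by metis

lemma open_map_proj: "open_map (topo (mid E)) (topo G) (proj E)"
proof -
  have "proj E ` carrier (mid E) = carrier G"
    using ext by (simp add: top_extension_def)
  moreover have "subtopology (topo G) (carrier G) = topo G"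
    using subtopology_topspace[of "topo G"] by simp
  ultimately show ?thesis
    using ext by (simp add: top_extension_def open_onto_image_def)
qed

lemma incl_embedding:
  assumes "openin (topo H) U"
  obtains W where "openin (topo (mid E)) W" and "\<And>h. h \<in> carrier H \<Longrightarrow> incl E h \<in> W \<longleftrightarrow> h \<in> U"
proof -
  have "openin (subtopology (topo (mid E)) (incl E ` carrier H)) (incl E ` U)"
    using ext assms by (auto simp: top_extension_def open_onto_image_def open_map_def)
  then obtain W where W: "openin (topo (mid E)) W" "incl E ` U = W \<inter> incl E ` carrier H"
    unfolding openin_subtopology by blast
  have inj: "inj_on (incl E) (carrier H)"
    using ext by (simp add: top_extension_def)
  have U: "U \<subseteq> carrier H"
    using openin_subset[OF assms] by simp
  show thesis
  proof (rule that[OF W(1)])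
    fix h assume h: "h \<in> carrier H"
    have "incl E h \<in> W \<longleftrightarrow> incl E h \<in> incl E ` U"
      using h W(2) by auto
    also have "\<dots> \<longleftrightarrow> h \<in> U"
      using inj_on_image_mem_iff[OF inj h U] .
    finally show "incl E h \<in> W \<longleftrightarrow> h \<in> U" .
  qed
qed

end

lemma top_homD:
  assumes "f \<in> top_hom A B"
  shows "f \<in> hom A B" and "continuous_map (topo A) (topo B) f"
    and "x \<in> carrier A \<Longrightarrow> f x \<in> carrier B"
    and "\<lbrakk>x \<in> carrier A; y \<in> carrier A\<rbrakk> \<Longrightarrow> f (x \<otimes>\<^bsub>A\<^esub> y) = f x \<otimes>\<^bsub>B\<^esub> f y"
  using assms by (auto simp: top_hom_def hom_def)

lemma top_hom_one:
  assumes "f \<in> top_hom A B" "group A" "group B"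
  shows "f \<one>\<^bsub>A\<^esub> = \<one>\<^bsub>B\<^esub>"
  using hom_one[OF top_homD(1)[OF assms(1)] assms(2,3)] .

lemma top_hom_compose: "f \<in> top_hom A B \<Longrightarrow> g \<in> top_hom B C \<Longrightarrow> (\<lambda>x. g (f x)) \<in> top_hom A C"
  using hom_compose[of f A B g C] continuous_map_compose[of "topo A" "topo B" f "topo C" g]
  by (simp add: top_hom_def o_def)

lemma top_hom_id: "(\<lambda>x. x) \<in> top_hom A A"
  by (simp add: top_hom_def hom_def)

text \<open>To recognise an extension it suffices to test the two topological conditions at the identity. The
  Hausdorff property of the middle group is a consequence: a point outside the kernel is
  separated from the identity in \<open>G\<close>, a point of the kernel in the embedded copy of \<open>H\<close>.\<close>

lemma top_extensionI:
  fixes E :: "('h, 'x, 'g) extension"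
  assumes H: "top_ab_group H" and G: "top_ab_group G"
    and X: "comm_group (mid E)" "group_topology (mid E) (topo (mid E))"
    and i: "incl E \<in> top_hom H (mid E)" and p: "proj E \<in> top_hom (mid E) G"
    and inj: "\<And>h. \<lbrakk>h \<in> carrier H; incl E h = \<one>\<^bsub>mid E\<^esub>\<rbrakk> \<Longrightarrow> h = \<one>\<^bsub>H\<^esub>"
    and ker1: "\<And>h. h \<in> carrier H \<Longrightarrow> proj E (incl E h) = \<one>\<^bsub>G\<^esub>"
    and ker2: "\<And>x. \<lbrakk>x \<in> carrier (mid E); proj E x = \<one>\<^bsub>G\<^esub>\<rbrakk> \<Longrightarrow> \<exists>h\<in>carrier H. x = incl E h"
    and surj: "\<And>g. g \<in> carrier G \<Longrightarrow> \<exists>x\<in>carrier (mid E). proj E x = g"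
    and emb: "\<And>U. \<lbrakk>openin (topo H) U; \<one>\<^bsub>H\<^esub> \<in> U\<rbrakk> \<Longrightarrow>
      \<exists>W. openin (topo (mid E)) W \<and> \<one>\<^bsub>mid E\<^esub> \<in> W \<and> (\<forall>h\<in>carrier H. incl E h \<in> W \<longrightarrow> h \<in> U)"
    and opn: "\<And>U. \<lbrakk>openin (topo (mid E)) U; \<one>\<^bsub>mid E\<^esub> \<in> U\<rbrakk> \<Longrightarrow>
      \<exists>W. openin (topo G) W \<and> \<one>\<^bsub>G\<^esub> \<in> W \<and> W \<subseteq> proj E ` U"
  shows "top_extension H G E"
proof -
  interpret H: comm_group H by (rule top_ab_groupD(1)[OF H])
  interpret G: comm_group G by (rule top_ab_groupD(1)[OF G])
  interpret X: comm_group "mid E" by (rule X(1))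
  interpret i: group_hom H "mid E" "incl E"
    using top_homD(1)[OF i] by unfold_locales
  interpret p: group_hom "mid E" G "proj E"
    using top_homD(1)[OF p] by unfold_locales
  have "Hausdorff_space (topo (mid E))"
  proof (rule Hausdorff_group_topologyI[OF X(2) X.is_group])
    fix x assume x: "x \<in> carrier (mid E)" "x \<noteq> \<one>\<^bsub>mid E\<^esub>"
    show "\<exists>U. openin (topo (mid E)) U \<and> \<one>\<^bsub>mid E\<^esub> \<in> U \<and> x \<notin> U"
    proof (cases "proj E x = \<one>\<^bsub>G\<^esub>")
      case False
      then obtain V where V: "openin (topo G) V" "\<one>\<^bsub>G\<^esub> \<in> V" "proj E x \<notin> V"
        using top_ab_groupD(4,5)[OF G] p.hom_closed[OF x(1)] G.one_closed
        unfolding Hausdorff_space_def disjnt_iff by metis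
      have "openin (topo (mid E)) {y \<in> topspace (topo (mid E)). proj E y \<in> V}"
        by (rule openin_continuous_map_preimage[OF top_homD(2)[OF p] V(1)])
      then show ?thesis
        using V(2,3) group_topologyD(1)[OF X(2)]
        by (intro exI[of _ "{y \<in> topspace (topo (mid E)). proj E y \<in> V}"]) simp
    next
      case True
      then obtain h where h: "h \<in> carrier H" "x = incl E h"
        using ker2[OF x(1)] by blast
      then have "h \<noteq> \<one>\<^bsub>H\<^esub>" using x(2) by auto
      then obtain U where U: "openin (topo H) U" "\<one>\<^bsub>H\<^esub> \<in> U" "h \<notin> U"
        using top_ab_groupD(4,5)[OF H] h(1) H.one_closed
        unfolding Hausdorff_space_def disjnt_iff by metis
      show ?thesis using emb[OF U(1,2)] U(3) h by blast
    qed
  qed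
  then have "top_ab_group (mid E)"
    using X by (simp add: top_ab_group_def)
  moreover have "inj_on (incl E) (carrier H)"
    using inj i.inj_on_one_iff by blast
  moreover have "open_map (topo H) (subtopology (topo (mid E)) (incl E ` carrier H)) (incl E)"
  proof (rule open_map_homI[OF H.is_group top_ab_groupD(3)[OF H] X.is_group X(2) top_homD(1)[OF i]])
    fix U assume "openin (topo H) U" "\<one>\<^bsub>H\<^esub> \<in> U"
    from emb[OF this] show "\<exists>W. openin (topo (mid E)) W \<and> \<one>\<^bsub>mid E\<^esub> \<in> W \<and>
        W \<inter> incl E ` carrier H \<subseteq> incl E ` U"
      by blast
  qed
  moreover have "open_map (topo (mid E)) (subtopology (topo G) (proj E ` carrier (mid E))) (proj E)"
  proof (rule open_map_homI[OF X.is_group X(2) G.is_group top_ab_groupD(3)[OF G] top_homD(1)[OF p]])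
    fix U assume "openin (topo (mid E)) U" "\<one>\<^bsub>mid E\<^esub> \<in> U"
    from opn[OF this] show "\<exists>W. openin (topo G) W \<and> \<one>\<^bsub>G\<^esub> \<in> W \<and>
        W \<inter> proj E ` carrier (mid E) \<subseteq> proj E ` U"
      by blast
  qed
  moreover have "incl E ` carrier H = kernel (mid E) G (proj E)"
    using ker1 ker2 by (auto simp: kernel_def)
  moreover have "proj E ` carrier (mid E) = carrier G"
    using surj p.hom_closed by blast
  ultimately show ?thesis
    using H G i p by (simp add: top_extension_def open_onto_image_def)
qed

text \<open>Existence of a ladder with outer components \<open>s\<close> and \<open>t\<close>. The middle homomorphism is left
  anonymous because only its existence is ever transported.\<close>

definition ext_mor :: "'h topgroup \<Rightarrow> ('h \<Rightarrow> 'k) \<Rightarrow> ('g \<Rightarrow> 'l) \<Rightarrow>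
    ('h, 'x, 'g) extension \<Rightarrow> ('k, 'y, 'l) extension \<Rightarrow> bool" where
  "ext_mor H s t E E' \<longleftrightarrow> (\<exists>T\<in>top_hom (mid E) (mid E').
     (\<forall>h\<in>carrier H. T (incl E h) = incl E' (s h)) \<and>
     (\<forall>x\<in>carrier (mid E). proj E' (T x) = t (proj E x)))"

lemma ext_equiv_iff_ext_mor: "ext_equiv H E E' \<longleftrightarrow> ext_mor H (\<lambda>h. h) (\<lambda>g. g) E E'"
  by (simp add: ext_equiv_def ext_mor_def)

lemma ext_mor_trans:
  assumes "ext_mor H s t E E'" and "ext_mor H' s' t' E' E''"
    and "\<And>h. h \<in> carrier H \<Longrightarrow> s h \<in> carrier H'"
  shows "ext_mor H (\<lambda>h. s' (s h)) (\<lambda>g. t' (t g)) E E''"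
proof -
  obtain T where T: "T \<in> top_hom (mid E) (mid E')"
      "\<forall>h\<in>carrier H. T (incl E h) = incl E' (s h)" "\<forall>x\<in>carrier (mid E). proj E' (T x) = t (proj E x)"
    using assms(1) by (auto simp: ext_mor_def)
  obtain T' where T': "T' \<in> top_hom (mid E') (mid E'')"
      "\<forall>h\<in>carrier H'. T' (incl E' h) = incl E'' (s' h)"
      "\<forall>x\<in>carrier (mid E'). proj E'' (T' x) = t' (proj E' x)"
    using assms(2) by (auto simp: ext_mor_def)
  show ?thesis
    unfolding ext_mor_def
    by (rule bexI[OF _ top_hom_compose[OF T(1) T'(1)]])
      (use T T' assms(3) top_homD(3)[OF T(1)] in auto)
qed

lemma ext_equiv_trans: "ext_equiv H E E' \<Longrightarrow> ext_equiv H E' E'' \<Longrightarrow> ext_equiv H E E''"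
  unfolding ext_equiv_iff_ext_mor by (drule (1) ext_mor_trans) auto

text \<open>The short five lemma makes the comparison map \<open>T\<close> bijective; the point is that it is open. Let \<open>U\<close>
  be a neighbourhood of the identity in \<open>X\<close>. Since the projection of \<open>X\<close> is open and that of \<open>X'\<close> is
  continuous, an element \<open>y\<close> of \<open>X'\<close> close to the identity has the same image in \<open>G\<close> as \<open>T v\<close> for some
  small \<open>v\<close>. The quotient \<open>y (T v)\<^sup>-\<^sup>1\<close> is a small element of the copy of \<open>H\<close> in \<open>X'\<close>, hence comes from a
  small \<open>h\<close>, because \<open>H\<close> is embedded. So \<open>y = T (h v)\<close> with \<open>h v\<close> in \<open>U\<close>.\<close>

lemma ext_equiv_sym:
  assumes E: "top_extension H G E" and E': "top_extension H G E'" and "ext_equiv H E E'"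
  shows "ext_equiv H E' E"
proof -
  interpret E: top_ext H G E using E by (rule top_ext.intro)
  interpret E': top_ext H G E' using E' by (rule top_ext.intro)
  obtain T where Tt: "T \<in> top_hom (mid E) (mid E')"
      and Ti: "\<And>h. h \<in> carrier H \<Longrightarrow> T (incl E h) = incl E' h"
      and Tp: "\<And>x. x \<in> carrier (mid E) \<Longrightarrow> proj E' (T x) = proj E x"
    using assms(3) by (auto simp: ext_equiv_def)
  interpret T: group_hom "mid E" "mid E'" T
    using top_homD(1)[OF Tt] by unfold_locales
  have inj: "inj_on T (carrier (mid E))"
  proof (rule T.inj_on_one_iff[THEN iffD2], intro allI impI)
    fix x assume x: "x \<in> carrier (mid E)" "T x = \<one>\<^bsub>mid E'\<^esub>"
    then have "proj E x = \<one>\<^bsub>G\<^esub>" using Tp[OF x(1)] by simp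
    then obtain h where h: "h \<in> carrier H" "x = incl E h" using E.kernel_projE[OF x(1)] by blast
    then have "h = \<one>\<^bsub>H\<^esub>" using Ti x(2) E'.incl_eq_oneD by simp
    then show "x = \<one>\<^bsub>mid E\<^esub>" using h by simp
  qed
  have surj: "T ` carrier (mid E) = carrier (mid E')"
  proof
    show "carrier (mid E') \<subseteq> T ` carrier (mid E)"
    proof
      fix y assume y: "y \<in> carrier (mid E')"
      then obtain x where x: "x \<in> carrier (mid E)" "proj E x = proj E' y"
        using E.proj_surj[OF E'.p.hom_closed[OF y]] by blast
      have "proj E' (y \<otimes>\<^bsub>mid E'\<^esub> inv\<^bsub>mid E'\<^esub> T x) = \<one>\<^bsub>G\<^esub>"
        using x y Tp by simp
      then obtain h where h: "h \<in> carrier H" "y \<otimes>\<^bsub>mid E'\<^esub> inv\<^bsub>mid E'\<^esub> T x = incl E' h"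
        using E'.kernel_projE x y by (metis E'.X.inv_closed E'.X.m_closed T.hom_closed)
      then have "y = incl E' h \<otimes>\<^bsub>mid E'\<^esub> T x"
        using x y by (simp add: E'.X.inv_solve_right')
      then have "y = T (incl E h \<otimes>\<^bsub>mid E\<^esub> x)"
        using h x Ti by simp
      then show "y \<in> T ` carrier (mid E)"
        by (rule image_eqI) (use h(1) x(1) in simp)
    qed
  qed auto
  have "open_map (topo (mid E)) (subtopology (topo (mid E')) (T ` carrier (mid E))) T"
  proof (rule open_map_homI[OF E.X.is_group E.group_topologies(2) E'.X.is_group
        E'.group_topologies(2) top_homD(1)[OF Tt]])
    fix U assume U: "openin (topo (mid E)) U" "\<one>\<^bsub>mid E\<^esub> \<in> U"
    obtain U0 where U0: "openin (topo (mid E)) U0" "\<one>\<^bsub>mid E\<^esub> \<in> U0"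
        "\<And>a b. a \<in> U0 \<Longrightarrow> b \<in> U0 \<Longrightarrow> a \<otimes>\<^bsub>mid E\<^esub> b \<in> U"
      using group_nbhd_one_mult[OF E.group_topologies(2) E.X.is_group U] by blast
    have "openin (topo H) {h \<in> topspace (topo H). incl E h \<in> U0}"
      by (rule openin_continuous_map_preimage[OF E.cont(1) U0(1)])
    then obtain W0 where W0: "openin (topo (mid E')) W0"
        "\<And>h. h \<in> carrier H \<Longrightarrow> incl E' h \<in> W0 \<longleftrightarrow> incl E h \<in> U0"
      by (rule E'.incl_embedding) simp
    have "\<one>\<^bsub>mid E'\<^esub> \<in> W0"
      using W0(2)[OF E.H.one_closed] U0(2) by simp
    then obtain W1 where W1: "openin (topo (mid E')) W1" "\<one>\<^bsub>mid E'\<^esub> \<in> W1"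
        "\<And>a b. a \<in> W1 \<Longrightarrow> b \<in> W1 \<Longrightarrow> a \<otimes>\<^bsub>mid E'\<^esub> inv\<^bsub>mid E'\<^esub> b \<in> W0"
      using group_nbhd_one_div[OF E'.group_topologies(2) E'.X.is_group W0(1)] by blast
    \<comment> \<open>The small elements \<open>v\<close>, whose images in \<open>G\<close> form an open set.\<close>
    define V where "V = U0 \<inter> {x \<in> topspace (topo (mid E)). T x \<in> W1}"
    have V: "openin (topo (mid E)) V"
      unfolding V_def
      by (intro openin_Int U0(1) openin_continuous_map_preimage[OF top_homD(2)[OF Tt] W1(1)])
    then have "openin (topo G) (proj E ` V)"
      using E.open_map_proj by (simp add: open_map_def)
    define W where "W = {y \<in> topspace (topo (mid E')). proj E' y \<in> proj E ` V} \<inter> W1"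
    have "openin (topo (mid E')) W"
      unfolding W_def
      by (intro openin_Int W1(1) openin_continuous_map_preimage[OF E'.cont(2)] \<open>openin (topo G) (proj E ` V)\<close>)
    moreover have "\<one>\<^bsub>mid E\<^esub> \<in> V"
      using U0(2) W1(2) by (simp add: V_def)
    then have "proj E' \<one>\<^bsub>mid E'\<^esub> \<in> proj E ` V"
      using E.p.hom_one E'.p.hom_one by (metis imageI)
    then have "\<one>\<^bsub>mid E'\<^esub> \<in> W"
      using W1(2) by (simp add: W_def)
    moreover have "W \<subseteq> T ` U"
    proof
      fix y assume "y \<in> W"
      then obtain v where y: "y \<in> carrier (mid E')" "y \<in> W1" and v: "v \<in> V" "proj E' y = proj E v"
        by (auto simp: W_def)
      have v': "v \<in> carrier (mid E)" "v \<in> U0" "T v \<in> W1"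
        using v(1) by (simp_all add: V_def)
      define z where "z = y \<otimes>\<^bsub>mid E'\<^esub> inv\<^bsub>mid E'\<^esub> T v"
      have z: "z \<in> carrier (mid E')" "proj E' z = \<one>\<^bsub>G\<^esub>" "z \<in> W0"
        unfolding z_def using y v v' Tp W1(3) by simp_all
      obtain h where h: "h \<in> carrier H" "z = incl E' h"
        using E'.kernel_projE[OF z(1,2)] by blast
      then have "incl E h \<in> U0" using z(3) W0(2) by simp
      then have mem: "incl E h \<otimes>\<^bsub>mid E\<^esub> v \<in> U" using U0(3) v' by simp
      have "y = z \<otimes>\<^bsub>mid E'\<^esub> T v"
        using y v' by (simp add: z_def E'.X.m_assoc)
      then have "y = T (incl E h \<otimes>\<^bsub>mid E\<^esub> v)"
        using h v' Ti by simp
      then show "y \<in> T ` U" using mem by (rule image_eqI)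
    qed
    ultimately show "\<exists>W. openin (topo (mid E')) W \<and> \<one>\<^bsub>mid E'\<^esub> \<in> W \<and> W \<inter> T ` carrier (mid E) \<subseteq> T ` U"
      by blast
  qed
  then have "open_map (topo (mid E)) (topo (mid E')) T"
    using surj subtopology_topspace[of "topo (mid E')"] by simp
  then have "homeomorphic_map (topo (mid E)) (topo (mid E')) T"
    using bijective_open_imp_homeomorphic_map[OF top_homD(2)[OF Tt]] surj inj by simp
  then obtain S where "homeomorphic_maps (topo (mid E)) (topo (mid E')) T S"
    using homeomorphic_map_maps by blast
  then have S: "continuous_map (topo (mid E')) (topo (mid E)) S"
      and ST: "\<And>x. x \<in> carrier (mid E) \<Longrightarrow> S (T x) = x"
      and TS: "\<And>y. y \<in> carrier (mid E') \<Longrightarrow> T (S y) = y"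
    by (auto simp: homeomorphic_maps_def)
  have Sc: "S y \<in> carrier (mid E)" if "y \<in> carrier (mid E')" for y
    using continuous_map_funspace[OF S] that by auto
  have "S \<in> hom (mid E') (mid E)"
  proof (rule homI[OF Sc])
    fix a b assume ab: "a \<in> carrier (mid E')" "b \<in> carrier (mid E')"
    have "S (T (S a \<otimes>\<^bsub>mid E\<^esub> S b)) = S a \<otimes>\<^bsub>mid E\<^esub> S b"
      using ab Sc by (intro ST) simp
    then show "S (a \<otimes>\<^bsub>mid E'\<^esub> b) = S a \<otimes>\<^bsub>mid E\<^esub> S b"
      using ab Sc TS by simp
  qed
  with S have "S \<in> top_hom (mid E') (mid E)" by (simp add: top_hom_def)
  moreover have "S (incl E' h) = incl E h" if "h \<in> carrier H" for h
    using ST[of "incl E h"] Ti[OF that] that by simp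
  moreover have "proj E (S y) = proj E' y" if "y \<in> carrier (mid E')" for y
    using Tp[OF Sc[OF that]] TS[OF that] by simp
  ultimately show ?thesis by (auto simp: ext_equiv_def)
qed

section \<open>Pull-backs, products and push-outs of extensions\<close>

lemma top_extension_pullback:
  fixes E :: "('h, 'x, 'g) extension"
  assumes E: "top_extension H G E" and L: "top_ab_group L" and t: "t \<in> top_hom L G"
  shows "top_extension H L (pullback_ext L t E)"
proof -
  interpret E: top_ext H G E using E by (rule top_ext.intro)
  interpret L: comm_group L by (rule top_ab_groupD(1)[OF L])
  interpret t: group_hom L G t
    using top_homD(1)[OF t] by unfold_locales
  note topL [simp] = top_ab_groupD(5)[OF L]
  let ?P = "prod_topgroup (mid E) L"
  define S where "S = {(x, g'). x \<in> carrier (mid E) \<and> g' \<in> carrier L \<and> proj E x = t g'}"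
  have P: "top_ab_group ?P" by (rule top_ab_group_prod[OF E.top_ab(2) L])
  interpret P: comm_group ?P by (rule top_ab_groupD(1)[OF P])
  have S: "subgroup S ?P"
    by (rule P.subgroupI) (auto simp: S_def intro!: exI[of _ "\<one>\<^bsub>mid E\<^esub>"] exI[of _ "\<one>\<^bsub>L\<^esub>"])
  have mid: "mid (pullback_ext L t E) = sub_topgroup ?P S"
    by (simp add: pullback_ext_def S_def)
  have M: "top_ab_group (sub_topgroup ?P S)" by (rule top_ab_group_sub[OF P S])
  have incl: "incl (pullback_ext L t E) = (\<lambda>h. (incl E h, \<one>\<^bsub>L\<^esub>))" and proj: "proj (pullback_ext L t E) = snd"
    by (simp_all add: pullback_ext_def)
  have S_iff: "(x, l) \<in> S \<longleftrightarrow> x \<in> carrier (mid E) \<and> l \<in> carrier L \<and> proj E x = t l" for x l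
    by (simp add: S_def)
  show ?thesis
  proof (rule top_extensionI[OF E.top_ab(1) L])
    show "comm_group (mid (pullback_ext L t E))"
      "group_topology (mid (pullback_ext L t E)) (topo (mid (pullback_ext L t E)))"
      unfolding mid by (rule top_ab_groupD[OF M])+
    have "(\<lambda>h. (incl E h, \<one>\<^bsub>L\<^esub>)) \<in> hom H (sub_topgroup ?P S)"
      by (rule homI) (auto simp: S_iff)
    moreover have "continuous_map (topo H) (topo (sub_topgroup ?P S)) (\<lambda>h. (incl E h, \<one>\<^bsub>L\<^esub>))"
      using E.cont(1) by (auto simp: continuous_map_in_subtopology continuous_map_paired S_iff)
    ultimately show "incl (pullback_ext L t E) \<in> top_hom H (mid (pullback_ext L t E))"
      unfolding mid incl by (simp add: top_hom_def)
    have "snd \<in> hom (sub_topgroup ?P S) L"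
      by (rule homI) (auto simp: S_def)
    moreover have "continuous_map (topo (sub_topgroup ?P S)) (topo L) snd"
      by (simp add: continuous_map_from_subtopology continuous_map_snd)
    ultimately show "proj (pullback_ext L t E) \<in> top_hom (mid (pullback_ext L t E)) L"
      unfolding mid proj by (simp add: top_hom_def)
  next
    fix h assume "h \<in> carrier H"
    then show "proj (pullback_ext L t E) (incl (pullback_ext L t E) h) = \<one>\<^bsub>L\<^esub>"
      by (simp add: incl proj)
    assume "incl (pullback_ext L t E) h = \<one>\<^bsub>mid (pullback_ext L t E)\<^esub>"
    then show "h = \<one>\<^bsub>H\<^esub>"
      using E.incl_eq_oneD[OF \<open>h \<in> carrier H\<close>] by (simp add: incl mid)
  next
    fix x assume "x \<in> carrier (mid (pullback_ext L t E))" "proj (pullback_ext L t E) x = \<one>\<^bsub>L\<^esub>"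
    then obtain y where y: "x = (y, \<one>\<^bsub>L\<^esub>)" "y \<in> carrier (mid E)" "proj E y = \<one>\<^bsub>G\<^esub>"
      by (cases x) (auto simp: mid proj S_iff)
    then show "\<exists>h\<in>carrier H. x = incl (pullback_ext L t E) h"
      using E.kernel_projE[OF y(2,3)] by (auto simp: incl)
  next
    fix l assume l: "l \<in> carrier L"
    obtain x where "x \<in> carrier (mid E)" "proj E x = t l"
      using E.proj_surj[OF t.hom_closed[OF l]] by blast
    then show "\<exists>x\<in>carrier (mid (pullback_ext L t E)). proj (pullback_ext L t E) x = l"
      using l by (intro bexI[of _ "(x, l)"]) (auto simp: mid proj S_iff)
  next
    fix U assume U: "openin (topo H) U" "\<one>\<^bsub>H\<^esub> \<in> U"
    obtain W where W: "openin (topo (mid E)) W" "\<And>h. h \<in> carrier H \<Longrightarrow> incl E h \<in> W \<longleftrightarrow> h \<in> U"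
      using E.incl_embedding[OF U(1)] by blast
    have "\<one>\<^bsub>mid E\<^esub> \<in> W" using W(2)[OF E.H.one_closed] U(2) by simp
    moreover have "openin (prod_topology (topo (mid E)) (topo L)) (W \<times> carrier L)"
      using W(1) openin_topspace[of "topo L"] by (simp add: openin_prod_Times_iff)
    ultimately show "\<exists>W. openin (topo (mid (pullback_ext L t E))) W \<and> \<one>\<^bsub>mid (pullback_ext L t E)\<^esub> \<in> W \<and>
        (\<forall>h\<in>carrier H. incl (pullback_ext L t E) h \<in> W \<longrightarrow> h \<in> U)"
      using W(2) unfolding mid incl
      by (intro exI[of _ "(W \<times> carrier L) \<inter> S"]) (auto simp: openin_subtopology_Int S_iff)
  next
    fix U assume U: "openin (topo (mid (pullback_ext L t E))) U" "\<one>\<^bsub>mid (pullback_ext L t E)\<^esub> \<in> U"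
    then obtain O' where O': "openin (prod_topology (topo (mid E)) (topo L)) O'" "U = O' \<inter> S"
      by (auto simp: mid openin_subtopology)
    have "(\<one>\<^bsub>mid E\<^esub>, \<one>\<^bsub>L\<^esub>) \<in> O'" using U(2) O'(2) by (simp add: mid)
    then obtain A B where AB: "openin (topo (mid E)) A" "openin (topo L) B"
        "\<one>\<^bsub>mid E\<^esub> \<in> A" "\<one>\<^bsub>L\<^esub> \<in> B" "A \<times> B \<subseteq> O'"
      using O'(1) unfolding openin_prod_topology_alt by meson
    define W where "W = B \<inter> {l \<in> topspace (topo L). t l \<in> proj E ` A}"
    have "openin (topo G) (proj E ` A)"
      using E.open_map_proj AB(1) by (simp add: open_map_def)
    then have "openin (topo L) W"
      unfolding W_def by (intro openin_Int AB(2) openin_continuous_map_preimage[OF top_homD(2)[OF t]])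
    moreover have "proj E \<one>\<^bsub>mid E\<^esub> \<in> proj E ` A"
      using AB(3) by (rule imageI)
    then have "\<one>\<^bsub>L\<^esub> \<in> W"
      using AB(4) by (simp add: W_def)
    moreover have "W \<subseteq> snd ` U"
    proof
      fix l assume "l \<in> W"
      then obtain a where a: "a \<in> A" "l \<in> B" "l \<in> carrier L" "t l = proj E a"
        by (auto simp: W_def)
      moreover have "a \<in> carrier (mid E)"
        using openin_subset[OF AB(1)] a(1) by auto
      ultimately have "(a, l) \<in> U" using AB(5) by (auto simp: O'(2) S_iff)
      then show "l \<in> snd ` U" by force
    qed
    ultimately show "\<exists>W. openin (topo L) W \<and> \<one>\<^bsub>L\<^esub> \<in> W \<and> W \<subseteq> proj (pullback_ext L t E) ` U"
      by (auto simp: proj)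
  qed
qed

lemma ext_mor_pullback:
  fixes E :: "('h, 'x, 'g) extension"
  shows "ext_mor H (\<lambda>h. h) t (pullback_ext L t E) E"
proof -
  have "fst \<in> top_hom (mid (pullback_ext L t E)) (mid E)"
    by (auto simp: top_hom_def hom_def pullback_ext_def continuous_map_from_subtopology
        continuous_map_fst)
  then show ?thesis
    unfolding ext_mor_def by (rule bexI[rotated]) (auto simp: pullback_ext_def)
qed

text \<open>Universal property of the pull-back: the right component of a ladder may be split off as a factor.\<close>

lemma ext_mor_into_pullback:
  fixes E :: "('h, 'x, 'g) extension" and F :: "('k, 'y, 'm) extension"
  assumes F: "top_extension K M F" and L: "top_ab_group L" and u: "u \<in> top_hom M L"
    and mor: "ext_mor K s (\<lambda>m. t (u m)) F E"
  shows "ext_mor K s u F (pullback_ext L t E)"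
proof -
  interpret F: top_ext K M F using F by (rule top_ext.intro)
  interpret L: comm_group L by (rule top_ab_groupD(1)[OF L])
  interpret u: group_hom M L u
    using top_homD(1)[OF u] by unfold_locales
  obtain T where T: "T \<in> top_hom (mid F) (mid E)" "\<And>k. k \<in> carrier K \<Longrightarrow> T (incl F k) = incl E (s k)"
      "\<And>x. x \<in> carrier (mid F) \<Longrightarrow> proj E (T x) = t (u (proj F x))"
    using mor by (auto simp: ext_mor_def)
  let ?T = "\<lambda>x. (T x, u (proj F x))"
  have "?T \<in> hom (mid F) (mid (pullback_ext L t E))"
    by (rule homI) (auto simp: pullback_ext_def T(3) top_homD(3,4)[OF T(1)])
  moreover have "continuous_map (topo (mid F)) (topo (mid (pullback_ext L t E))) ?T"
    using top_homD(2)[OF T(1)] continuous_map_compose[OF F.cont(2) top_homD(2)[OF u]]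
    by (auto simp: pullback_ext_def continuous_map_in_subtopology continuous_map_paired o_def T(3)
        top_homD(3)[OF T(1)])
  ultimately have "?T \<in> top_hom (mid F) (mid (pullback_ext L t E))"
    by (simp add: top_hom_def)
  then show ?thesis
    unfolding ext_mor_def by (rule bexI[rotated]) (auto simp: pullback_ext_def T(2))
qed

lemma continuous_map_map_prod:
  assumes "continuous_map S S' f" and "continuous_map T T' g"
  shows "continuous_map (prod_topology S T) (prod_topology S' T') (map_prod f g)"
  using continuous_map_pairedI[OF continuous_map_compose[OF continuous_map_fst assms(1)]
      continuous_map_compose[OF continuous_map_snd assms(2)]]
  by (simp add: o_def map_prod_def case_prod_unfold)

lemma top_extension_product:
  fixes E :: "('h, 'x, 'g) extension" and F :: "('k, 'y, 'l) extension"
  assumes E: "top_extension H G E" and F: "top_extension K L F"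
  shows "top_extension (prod_topgroup H K) (prod_topgroup G L) (product_ext E F)"
proof -
  interpret E: top_ext H G E using E by (rule top_ext.intro)
  interpret F: top_ext K L F using F by (rule top_ext.intro)
  have sel: "mid (product_ext E F) = prod_topgroup (mid E) (mid F)"
      "incl (product_ext E F) = map_prod (incl E) (incl F)"
      "proj (product_ext E F) = map_prod (proj E) (proj F)"
    by (simp_all add: product_ext_def)
  have M: "top_ab_group (prod_topgroup (mid E) (mid F))"
    by (rule top_ab_group_prod[OF E.top_ab(2) F.top_ab(2)])
  show ?thesis
  proof (rule top_extensionI[OF top_ab_group_prod[OF E.top_ab(1) F.top_ab(1)]
        top_ab_group_prod[OF E.top_ab(3) F.top_ab(3)]], unfold sel)
    show "comm_group (prod_topgroup (mid E) (mid F))"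
      "group_topology (prod_topgroup (mid E) (mid F)) (topo (prod_topgroup (mid E) (mid F)))"
      by (rule top_ab_groupD[OF M])+
    show "map_prod (incl E) (incl F) \<in> top_hom (prod_topgroup H K) (prod_topgroup (mid E) (mid F))"
      using continuous_map_map_prod[OF E.cont(1) F.cont(1)] by (auto simp: top_hom_def hom_def)
    show "map_prod (proj E) (proj F) \<in> top_hom (prod_topgroup (mid E) (mid F)) (prod_topgroup G L)"
      using continuous_map_map_prod[OF E.cont(2) F.cont(2)] by (auto simp: top_hom_def hom_def)
  next
    fix h assume h: "h \<in> carrier (prod_topgroup H K)"
    then show "map_prod (proj E) (proj F) (map_prod (incl E) (incl F) h) = \<one>\<^bsub>prod_topgroup G L\<^esub>"
      by auto
    assume "map_prod (incl E) (incl F) h = \<one>\<^bsub>prod_topgroup (mid E) (mid F)\<^esub>"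
    then show "h = \<one>\<^bsub>prod_topgroup H K\<^esub>"
      using h E.incl_eq_oneD F.incl_eq_oneD by (cases h) auto
  next
    fix x assume "x \<in> carrier (prod_topgroup (mid E) (mid F))"
      "map_prod (proj E) (proj F) x = \<one>\<^bsub>prod_topgroup G L\<^esub>"
    then obtain a b where ab: "x = (a, b)" "a \<in> carrier (mid E)" "proj E a = \<one>\<^bsub>G\<^esub>"
        "b \<in> carrier (mid F)" "proj F b = \<one>\<^bsub>L\<^esub>"
      by (cases x) auto
    obtain h k where "h \<in> carrier H" "a = incl E h" "k \<in> carrier K" "b = incl F k"
      using E.kernel_projE[OF ab(2,3)] F.kernel_projE[OF ab(4,5)] by metis
    then show "\<exists>h\<in>carrier (prod_topgroup H K). x = map_prod (incl E) (incl F) h"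
      using ab(1) by (intro bexI[of _ "(h, k)"]) auto
  next
    fix g assume "g \<in> carrier (prod_topgroup G L)"
    then obtain a b where ab: "g = (a, b)" "a \<in> carrier G" "b \<in> carrier L"
      by (cases g) auto
    obtain x y where "x \<in> carrier (mid E)" "proj E x = a" "y \<in> carrier (mid F)" "proj F y = b"
      using E.proj_surj[OF ab(2)] F.proj_surj[OF ab(3)] by metis
    then show "\<exists>x\<in>carrier (prod_topgroup (mid E) (mid F)). map_prod (proj E) (proj F) x = g"
      using ab(1) by (intro bexI[of _ "(x, y)"]) auto
  next
    fix U assume U: "openin (topo (prod_topgroup H K)) U" "\<one>\<^bsub>prod_topgroup H K\<^esub> \<in> U"
    then obtain A B where AB: "openin (topo H) A" "openin (topo K) B" "\<one>\<^bsub>H\<^esub> \<in> A" "\<one>\<^bsub>K\<^esub> \<in> B"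
        "A \<times> B \<subseteq> U"
      unfolding prod_topgroup_simps openin_prod_topology_alt by meson
    obtain V where V: "openin (topo (mid E)) V" "\<And>h. h \<in> carrier H \<Longrightarrow> incl E h \<in> V \<longleftrightarrow> h \<in> A"
      using E.incl_embedding[OF AB(1)] by blast
    obtain W where W: "openin (topo (mid F)) W" "\<And>k. k \<in> carrier K \<Longrightarrow> incl F k \<in> W \<longleftrightarrow> k \<in> B"
      using F.incl_embedding[OF AB(2)] by blast
    have "\<one>\<^bsub>mid E\<^esub> \<in> V" "\<one>\<^bsub>mid F\<^esub> \<in> W"
      using V(2)[OF E.H.one_closed] W(2)[OF F.H.one_closed] AB by simp_all
    then show "\<exists>W. openin (topo (prod_topgroup (mid E) (mid F))) W \<and> \<one>\<^bsub>prod_topgroup (mid E) (mid F)\<^esub> \<in> W \<and>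
        (\<forall>h\<in>carrier (prod_topgroup H K). map_prod (incl E) (incl F) h \<in> W \<longrightarrow> h \<in> U)"
      using V W AB(5) by (intro exI[of _ "V \<times> W"]) (auto simp: openin_prod_Times_iff)
  next
    fix U assume U: "openin (topo (prod_topgroup (mid E) (mid F))) U" "\<one>\<^bsub>prod_topgroup (mid E) (mid F)\<^esub> \<in> U"
    then obtain A B where AB: "openin (topo (mid E)) A" "openin (topo (mid F)) B"
        "\<one>\<^bsub>mid E\<^esub> \<in> A" "\<one>\<^bsub>mid F\<^esub> \<in> B" "A \<times> B \<subseteq> U"
      unfolding prod_topgroup_simps openin_prod_topology_alt by meson
    have "openin (prod_topology (topo G) (topo L)) (proj E ` A \<times> proj F ` B)"
      using E.open_map_proj F.open_map_proj AB by (simp add: openin_prod_Times_iff open_map_def)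
    moreover have "proj E \<one>\<^bsub>mid E\<^esub> \<in> proj E ` A" "proj F \<one>\<^bsub>mid F\<^esub> \<in> proj F ` B"
      using AB by (auto simp del: E.p.hom_one F.p.hom_one)
    moreover have "proj E ` A \<times> proj F ` B \<subseteq> map_prod (proj E) (proj F) ` U"
      using AB(5) by force
    ultimately show "\<exists>W. openin (topo (prod_topgroup G L)) W \<and> \<one>\<^bsub>prod_topgroup G L\<^esub> \<in> W \<and>
        W \<subseteq> map_prod (proj E) (proj F) ` U"
      by (intro exI[of _ "proj E ` A \<times> proj F ` B"]) simp
  qed
qed

lemma ext_mor_product:
  fixes E :: "('h, 'x, 'g) extension" and E' :: "('h2, 'x2, 'g2) extension"
    and F :: "('k, 'y, 'l) extension" and F' :: "('k2, 'y2, 'l2) extension"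
  assumes "ext_mor H s t E E'" and "ext_mor K s' t' F F'"
  shows "ext_mor (prod_topgroup H K) (map_prod s s') (map_prod t t') (product_ext E F) (product_ext E' F')"
proof -
  obtain T where T: "T \<in> top_hom (mid E) (mid E')"
      "\<And>h. h \<in> carrier H \<Longrightarrow> T (incl E h) = incl E' (s h)"
      "\<And>x. x \<in> carrier (mid E) \<Longrightarrow> proj E' (T x) = t (proj E x)"
    using assms(1) by (auto simp: ext_mor_def)
  obtain T' where T': "T' \<in> top_hom (mid F) (mid F')"
      "\<And>h. h \<in> carrier K \<Longrightarrow> T' (incl F h) = incl F' (s' h)"
      "\<And>x. x \<in> carrier (mid F) \<Longrightarrow> proj F' (T' x) = t' (proj F x)"
    using assms(2) by (auto simp: ext_mor_def)
  have "continuous_map (prod_topology (topo (mid E)) (topo (mid F)))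
      (prod_topology (topo (mid E')) (topo (mid F'))) (map_prod T T')"
    by (rule continuous_map_map_prod[OF top_homD(2)[OF T(1)] top_homD(2)[OF T'(1)]])
  then have "map_prod T T' \<in> top_hom (mid (product_ext E F)) (mid (product_ext E' F'))"
    using top_homD(3,4)[OF T(1)] top_homD(3,4)[OF T'(1)]
    by (auto simp: top_hom_def hom_def product_ext_def)
  then show ?thesis
    unfolding ext_mor_def by (rule bexI[rotated]) (auto simp: product_ext_def T T')
qed

text \<open>The push-out of \<open>E\<close> along \<open>s : H \<rightarrow> K\<close> is the quotient \<open>Q\<close> of \<open>M = K \<times> X\<close> by the antidiagonal \<open>N\<close>.\<close>

locale pushout_data = top_ext H G E
  for H :: "'h topgroup" and G :: "'g topgroup" and E :: "('h, 'x, 'g) extension" +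
  fixes K :: "'k topgroup" and s :: "'h \<Rightarrow> 'k"
  assumes K: "top_ab_group K" and s: "s \<in> top_hom H K"
begin

sublocale K: comm_group K by (rule top_ab_groupD(1)[OF K])
sublocale s: group_hom H K s using top_homD(1)[OF s] by unfold_locales

abbreviation "M \<equiv> prod_topgroup K (mid E)"
abbreviation "N \<equiv> pushout_kernel H s E"

lemma top_ab_M: "top_ab_group M"
  by (rule top_ab_group_prod[OF K top_ab(2)])

sublocale M: comm_group M by (rule top_ab_groupD(1)[OF top_ab_M])

lemma topspace_K [simp]: "topspace (topo K) = carrier K"
  by (rule top_ab_groupD(5)[OF K])

lemma pushout_kernel_iff: "(k, x) \<in> N \<longleftrightarrow> (\<exists>h\<in>carrier H. k = s h \<and> x = inv\<^bsub>mid E\<^esub> incl E h)"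
  by (auto simp: pushout_kernel_def)

lemma subgroup_N: "subgroup N M"
proof (rule M.subgroupI)
  show "N \<subseteq> carrier M" by (auto simp: pushout_kernel_def)
  show "N \<noteq> {}" by (auto simp: pushout_kernel_def)
next
  fix a assume "a \<in> N"
  then obtain h where h: "h \<in> carrier H" "a = (s h, inv\<^bsub>mid E\<^esub> incl E h)"
    by (auto simp: pushout_kernel_def)
  then show "inv\<^bsub>M\<^esub> a \<in> N"
    unfolding pushout_kernel_def by (intro image_eqI[of _ _ "inv\<^bsub>H\<^esub> h"]) simp_all
next
  fix a b assume "a \<in> N" "b \<in> N"
  then obtain h k where h: "h \<in> carrier H" "a = (s h, inv\<^bsub>mid E\<^esub> incl E h)"
    and k: "k \<in> carrier H" "b = (s k, inv\<^bsub>mid E\<^esub> incl E k)"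
    by (auto simp: pushout_kernel_def)
  then show "a \<otimes>\<^bsub>M\<^esub> b \<in> N"
    unfolding pushout_kernel_def by (intro image_eqI[of _ _ "h \<otimes>\<^bsub>H\<^esub> k"]) (simp_all add: X.inv_mult)
qed

sublocale N: normal N M by (rule M.subgroup_imp_normal[OF subgroup_N])

abbreviation "Q \<equiv> quot_topgroup M N"
abbreviation "q \<equiv> r_coset M N"

lemmas Q = quot_topgroup[OF top_ab_M subgroup_N]

sublocale Q: comm_group Q by (rule Q(1))
sublocale q: group_hom M Q q using top_homD(1)[OF Q(2)] by unfold_locales

lemma mem_coset_iff:
  "(k', x') \<in> q (k, x) \<longleftrightarrow> (\<exists>h\<in>carrier H. k' = s h \<otimes>\<^bsub>K\<^esub> k \<and> x' = inv\<^bsub>mid E\<^esub> incl E h \<otimes>\<^bsub>mid E\<^esub> x)"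
  by (auto simp: r_coset_def pushout_kernel_def)

lemma pushout_sel:
  "mid (pushout_ext H K s E) = Q"
  "incl (pushout_ext H K s E) = (\<lambda>k. q (k, \<one>\<^bsub>mid E\<^esub>))"
  by (simp_all add: pushout_ext_def)

lemma pushout_proj:
  assumes "k \<in> carrier K" "x \<in> carrier (mid E)"
  shows "proj (pushout_ext H K s E) (q (k, x)) = proj E x"
proof -
  have "(\<lambda>(h', x). proj E x) ` q (k, x) = {proj E x}"
  proof (intro equalityI subsetI)
    fix y assume "y \<in> (\<lambda>(h', x). proj E x) ` q (k, x)"
    then obtain k' x' where "(k', x') \<in> q (k, x)" "y = proj E x'" by auto
    then show "y \<in> {proj E x}" using assms by (auto simp: mem_coset_iff)
  next
    fix y assume "y \<in> {proj E x}"
    moreover have "(k, x) \<in> q (k, x)" using M.rcos_self[OF _ subgroup_N] assms by simp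
    ultimately show "y \<in> (\<lambda>(h', x). proj E x) ` q (k, x)" by force
  qed
  then show ?thesis by (simp add: pushout_ext_def)
qed

lemma carrier_QE:
  assumes "z \<in> carrier Q"
  obtains k x where "k \<in> carrier K" "x \<in> carrier (mid E)" "z = q (k, x)"
  using assms by auto

lemma q_mult:
  assumes "k \<in> carrier K" "x \<in> carrier (mid E)" "k' \<in> carrier K" "x' \<in> carrier (mid E)"
  shows "q (k, x) \<otimes>\<^bsub>Q\<^esub> q (k', x') = q (k \<otimes>\<^bsub>K\<^esub> k', x \<otimes>\<^bsub>mid E\<^esub> x')"
  using q.hom_mult[of "(k, x)" "(k', x')"] assms by simp

lemma q_closed: "k \<in> carrier K \<Longrightarrow> x \<in> carrier (mid E) \<Longrightarrow> q (k, x) \<in> carrier Q"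
  using q.hom_closed[of "(k, x)"] by simp

text \<open>In the push-out the copy of \<open>H\<close> in \<open>X\<close> is identified with its image in \<open>K\<close>.\<close>

lemma q_incl:
  assumes "k \<in> carrier K" "h \<in> carrier H"
  shows "q (k, incl E h) = q (k \<otimes>\<^bsub>K\<^esub> s h, \<one>\<^bsub>mid E\<^esub>)"
proof (rule M.repr_independence[OF _ _ subgroup_N])
  show "(k \<otimes>\<^bsub>K\<^esub> s h, \<one>\<^bsub>mid E\<^esub>) \<in> q (k, incl E h)"
    using assms by (auto simp: mem_coset_iff K.m_comm intro!: bexI[of _ h])
qed (use assms in simp)

lemma quotient_map_q: "quotient_map (topo M) (topo Q) q"
  unfolding quot_topgroup_simps by (rule quotient_map_quotient_topology)

lemma continuous_pushout_incl: "continuous_map (topo K) (topo Q) (\<lambda>k. q (k, \<one>\<^bsub>mid E\<^esub>))"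
proof -
  have "continuous_map (topo K) (topo M) (\<lambda>k. (k, \<one>\<^bsub>mid E\<^esub>))"
    by (simp add: continuous_map_paired)
  from continuous_map_compose[OF this top_homD(2)[OF Q(2)]] show ?thesis by (simp add: o_def)
qed

text \<open>The substantial point is that \<open>K\<close> is embedded in the quotient. Given \<open>U\<close>, choose \<open>U\<^sub>1\<close> with
  \<open>U\<^sub>1 U\<^sub>1 \<subseteq> U\<close> and an open \<open>V\<close> in \<open>X\<close> that meets \<open>H\<close> in \<open>s\<^sup>-\<^sup>1(U\<^sub>1)\<close>. If the class of \<open>(k, 1)\<close> lies in the
  image of \<open>U\<^sub>1 \<times> V\<close>, then \<open>k = s(h) u\<close> with \<open>u\<close> in \<open>U\<^sub>1\<close> and \<open>h\<close> in \<open>V\<close>, so \<open>k\<close> lies in \<open>U\<close>.\<close>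

lemma top_extension_pushout: "top_extension K G (pushout_ext H K s E)"
proof (rule top_extensionI[OF K top_ab(3)], unfold pushout_sel)
  let ?\<pi> = "proj (pushout_ext H K s E)"
  show "comm_group Q" "group_topology Q (topo Q)" by (rule Q)+
  have "(\<lambda>k. q (k, \<one>\<^bsub>mid E\<^esub>)) \<in> hom K Q"
    by (rule homI) (simp_all add: q_closed q_mult del: quot_topgroup_simps)
  then show "(\<lambda>k. q (k, \<one>\<^bsub>mid E\<^esub>)) \<in> top_hom K Q"
    using continuous_pushout_incl by (simp add: top_hom_def)
  have "?\<pi> \<in> hom Q G"
  proof (rule homI)
    fix z assume "z \<in> carrier Q"
    then obtain k x where z: "k \<in> carrier K" "x \<in> carrier (mid E)" "z = q (k, x)"
      by (rule carrier_QE)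
    then show "?\<pi> z \<in> carrier G" by (simp add: pushout_proj)
    fix z' assume "z' \<in> carrier Q"
    then obtain k' x' where "k' \<in> carrier K" "x' \<in> carrier (mid E)" "z' = q (k', x')"
      by (rule carrier_QE)
    with z show "?\<pi> (z \<otimes>\<^bsub>Q\<^esub> z') = ?\<pi> z \<otimes>\<^bsub>G\<^esub> ?\<pi> z'"
      by (simp add: pushout_proj q_mult del: quot_topgroup_simps)
  qed
  moreover have "continuous_map (topo Q) (topo G) ?\<pi>"
  proof (rule continuous_compose_quotient_map[OF quotient_map_q])
    have "continuous_map (topo M) (topo G) (\<lambda>p. proj E (snd p))"
      using continuous_map_compose[OF continuous_map_snd cont(2)] by (simp add: o_def)
    then show "continuous_map (topo M) (topo G) (?\<pi> \<circ> q)"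
      by (rule continuous_map_eq) (auto simp: pushout_proj)
  qed
  ultimately show "?\<pi> \<in> top_hom Q G" by (simp add: top_hom_def)
next
  fix k assume k: "k \<in> carrier K"
  then show "proj (pushout_ext H K s E) (q (k, \<one>\<^bsub>mid E\<^esub>)) = \<one>\<^bsub>G\<^esub>"
    by (simp add: pushout_proj)
  assume "q (k, \<one>\<^bsub>mid E\<^esub>) = \<one>\<^bsub>Q\<^esub>"
  then have "(k, \<one>\<^bsub>mid E\<^esub>) \<in> N"
    using M.rcos_self[OF _ subgroup_N, of "(k, \<one>\<^bsub>mid E\<^esub>)"] k by simp
  then obtain h where h: "h \<in> carrier H" "k = s h" "\<one>\<^bsub>mid E\<^esub> = inv\<^bsub>mid E\<^esub> incl E h"
    by (auto simp: pushout_kernel_iff)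
  then have "incl E h = \<one>\<^bsub>mid E\<^esub>"
    using X.inv_eq_1_iff[OF i.hom_closed[OF h(1)]] by metis
  then show "k = \<one>\<^bsub>K\<^esub>" using incl_eq_oneD[OF h(1)] h(2) by simp
next
  fix z assume "z \<in> carrier Q" and pz: "proj (pushout_ext H K s E) z = \<one>\<^bsub>G\<^esub>"
  then obtain k x where z: "k \<in> carrier K" "x \<in> carrier (mid E)" "z = q (k, x)"
    by (metis carrier_QE)
  then have "proj E x = \<one>\<^bsub>G\<^esub>" using pz by (simp add: pushout_proj)
  then obtain h where "h \<in> carrier H" "x = incl E h" using kernel_projE[OF z(2)] by blast
  then show "\<exists>k\<in>carrier K. z = q (k, \<one>\<^bsub>mid E\<^esub>)"
    using z(1,3) q_incl by (intro bexI[of _ "k \<otimes>\<^bsub>K\<^esub> s h"]) simp_all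
next
  fix g assume "g \<in> carrier G"
  then obtain x where "x \<in> carrier (mid E)" "proj E x = g" by (rule proj_surj)
  then show "\<exists>z\<in>carrier Q. proj (pushout_ext H K s E) z = g"
    using pushout_proj[OF K.one_closed] q_closed[OF K.one_closed]
    by (intro bexI[of _ "q (\<one>\<^bsub>K\<^esub>, x)"]) simp_all
next
  fix U assume U: "openin (topo K) U" "\<one>\<^bsub>K\<^esub> \<in> U"
  obtain U1 where U1: "openin (topo K) U1" "\<one>\<^bsub>K\<^esub> \<in> U1"
      "\<And>a b. a \<in> U1 \<Longrightarrow> b \<in> U1 \<Longrightarrow> a \<otimes>\<^bsub>K\<^esub> b \<in> U"
    using group_nbhd_one_mult[OF top_ab_groupD(3)[OF K] K.is_group U] by blast
  have "openin (topo H) {h \<in> topspace (topo H). s h \<in> U1}"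
    by (rule openin_continuous_map_preimage[OF top_homD(2)[OF s] U1(1)])
  then obtain V where V: "openin (topo (mid E)) V"
      "\<And>h. h \<in> carrier H \<Longrightarrow> incl E h \<in> V \<longleftrightarrow> s h \<in> U1"
    by (rule incl_embedding) simp
  have "openin (topo Q) (q ` (U1 \<times> V))"
    using Q(3) U1(1) V(1) by (simp add: open_map_def openin_prod_Times_iff)
  moreover have "\<one>\<^bsub>mid E\<^esub> \<in> V"
    using V(2)[OF H.one_closed] U1(2) by simp
  then have "\<one>\<^bsub>Q\<^esub> \<in> q ` (U1 \<times> V)"
    using q.hom_one U1(2) by (metis SigmaI imageI prod_topgroup_simps(3))
  moreover have "k \<in> U" if k: "k \<in> carrier K" and kq: "q (k, \<one>\<^bsub>mid E\<^esub>) \<in> q ` (U1 \<times> V)" for k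
  proof -
    obtain u v where uv: "u \<in> U1" "v \<in> V" "q (k, \<one>\<^bsub>mid E\<^esub>) = q (u, v)" using kq by auto
    have v: "v \<in> carrier (mid E)" using openin_subset[OF V(1)] uv(2) by auto
    have "(k, \<one>\<^bsub>mid E\<^esub>) \<in> q (u, v)"
      using M.rcos_self[OF _ subgroup_N, of "(k, \<one>\<^bsub>mid E\<^esub>)"] k uv(3) by simp
    then obtain h where h: "h \<in> carrier H" "k = s h \<otimes>\<^bsub>K\<^esub> u"
        "\<one>\<^bsub>mid E\<^esub> = inv\<^bsub>mid E\<^esub> incl E h \<otimes>\<^bsub>mid E\<^esub> v"
      by (auto simp: mem_coset_iff)
    have "incl E h = incl E h \<otimes>\<^bsub>mid E\<^esub> (inv\<^bsub>mid E\<^esub> incl E h \<otimes>\<^bsub>mid E\<^esub> v)"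
      unfolding h(3)[symmetric] using h(1) by simp
    also have "\<dots> = v"
      using h(1) v by (simp add: X.m_assoc[symmetric])
    finally have "s h \<in> U1" using V(2)[OF h(1)] uv(2) by simp
    then show "k \<in> U" using U1(3) uv(1) h(2) by simp
  qed
  ultimately show "\<exists>W. openin (topo Q) W \<and> \<one>\<^bsub>Q\<^esub> \<in> W \<and>
      (\<forall>k\<in>carrier K. q (k, \<one>\<^bsub>mid E\<^esub>) \<in> W \<longrightarrow> k \<in> U)"
    by blast
next
  fix U assume U: "openin (topo Q) U" "\<one>\<^bsub>Q\<^esub> \<in> U"
  have "openin (topo M) {p \<in> topspace (topo M). q p \<in> U}"
    by (rule openin_continuous_map_preimage[OF top_homD(2)[OF Q(2)] U(1)])
  moreover have "q (\<one>\<^bsub>K\<^esub>, \<one>\<^bsub>mid E\<^esub>) \<in> U"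
    using q.hom_one U(2) by simp
  then have "(\<one>\<^bsub>K\<^esub>, \<one>\<^bsub>mid E\<^esub>) \<in> {p \<in> topspace (topo M). q p \<in> U}" by simp
  ultimately obtain A B where AB: "openin (topo K) A" "openin (topo (mid E)) B" "\<one>\<^bsub>K\<^esub> \<in> A"
      "\<one>\<^bsub>mid E\<^esub> \<in> B" "A \<times> B \<subseteq> {p \<in> topspace (topo M). q p \<in> U}"
    unfolding prod_topgroup_simps openin_prod_topology_alt by meson
  have "openin (topo G) (proj E ` B)"
    using open_map_proj AB(2) by (simp add: open_map_def)
  moreover have "proj E \<one>\<^bsub>mid E\<^esub> \<in> proj E ` B"
    using AB(4) by (rule imageI)
  then have "\<one>\<^bsub>G\<^esub> \<in> proj E ` B" by simp
  moreover have "proj E ` B \<subseteq> proj (pushout_ext H K s E) ` U"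
  proof
    fix g assume "g \<in> proj E ` B"
    then obtain b where b: "b \<in> B" "g = proj E b" by blast
    have "b \<in> carrier (mid E)" using openin_subset[OF AB(2)] b(1) by auto
    then have "g = proj (pushout_ext H K s E) (q (\<one>\<^bsub>K\<^esub>, b))"
      using b(2) by (simp add: pushout_proj)
    moreover have "q (\<one>\<^bsub>K\<^esub>, b) \<in> U" using AB(3,5) b(1) by blast
    ultimately show "g \<in> proj (pushout_ext H K s E) ` U" by (rule image_eqI)
  qed
  ultimately show "\<exists>W. openin (topo G) W \<and> \<one>\<^bsub>G\<^esub> \<in> W \<and> W \<subseteq> proj (pushout_ext H K s E) ` U"
    by blast
qed

lemma ext_mor_pushout: "ext_mor H s (\<lambda>g. g) E (pushout_ext H K s E)"
proof -
  have "(\<lambda>x. q (\<one>\<^bsub>K\<^esub>, x)) \<in> hom (mid E) Q"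
    by (rule homI) (simp_all add: q_closed q_mult del: quot_topgroup_simps)
  moreover have "continuous_map (topo (mid E)) (topo M) (\<lambda>x. (\<one>\<^bsub>K\<^esub>, x))"
    by (simp add: continuous_map_paired)
  from continuous_map_compose[OF this top_homD(2)[OF Q(2)]]
  have "continuous_map (topo (mid E)) (topo Q) (\<lambda>x. q (\<one>\<^bsub>K\<^esub>, x))" by (simp add: o_def)
  ultimately have "(\<lambda>x. q (\<one>\<^bsub>K\<^esub>, x)) \<in> top_hom (mid E) (mid (pushout_ext H K s E))"
    by (simp add: top_hom_def pushout_sel)
  then show ?thesis
    unfolding ext_mor_def
    by (rule bexI[rotated]) (auto simp: pushout_sel pushout_proj q_incl)
qed

text \<open>Universal property of the push-out: the left component of a ladder may be split off as a
  factor. The map \<open>(k, x) \<mapsto> \<iota>(u k) T x\<close> is constant on the cosets of \<open>N\<close>.\<close>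

lemma ext_mor_from_pushout:
  fixes F :: "('m, 'y, 'l) extension"
  assumes F: "top_extension C L F" and u: "u \<in> top_hom K C"
    and mor: "ext_mor H (\<lambda>h. u (s h)) t E F"
  shows "ext_mor K u t (pushout_ext H K s E) F"
proof -
  interpret F: top_ext C L F using F by (rule top_ext.intro)
  interpret u: group_hom K C u
    using top_homD(1)[OF u] by unfold_locales
  obtain T where T: "T \<in> top_hom (mid E) (mid F)"
      and Ti: "\<And>h. h \<in> carrier H \<Longrightarrow> T (incl E h) = incl F (u (s h))"
      and Tp: "\<And>x. x \<in> carrier (mid E) \<Longrightarrow> proj F (T x) = t (proj E x)"
    using mor by (auto simp: ext_mor_def)
  interpret T: group_hom "mid E" "mid F" T
    using top_homD(1)[OF T] by unfold_locales
  define f where "f p = incl F (u (fst p)) \<otimes>\<^bsub>mid F\<^esub> T (snd p)" for p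
  have f: "f \<in> hom M (mid F)"
    by (rule homI) (auto simp: f_def F.X.m_ac)
  have "f x = f y" if "x \<in> carrier M" "y \<in> carrier M" "q x = q y" for x y
  proof -
    obtain k a l b where eq: "x = (k, a)" "y = (l, b)"
      by (metis prod.exhaust)
    then have xy: "x = (k, a)" "y = (l, b)" "k \<in> carrier K" "a \<in> carrier (mid E)"
        "l \<in> carrier K" "b \<in> carrier (mid E)"
      using that by simp_all
    have "(k, a) \<in> q (l, b)"
      using M.rcos_self[OF _ subgroup_N, of "(k, a)"] that xy by simp
    then obtain h where h: "h \<in> carrier H" "k = s h \<otimes>\<^bsub>K\<^esub> l"
        "a = inv\<^bsub>mid E\<^esub> incl E h \<otimes>\<^bsub>mid E\<^esub> b"
      by (auto simp: mem_coset_iff)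
    let ?c = "incl F (u (s h))"
    have c: "?c \<in> carrier (mid F)" using h(1) by simp
    have "f x = (?c \<otimes>\<^bsub>mid F\<^esub> incl F (u l)) \<otimes>\<^bsub>mid F\<^esub> (inv\<^bsub>mid F\<^esub> ?c \<otimes>\<^bsub>mid F\<^esub> T b)"
      using xy h(1) Ti[OF h(1)] by (simp add: f_def h(2,3))
    also have "\<dots> = (?c \<otimes>\<^bsub>mid F\<^esub> inv\<^bsub>mid F\<^esub> ?c) \<otimes>\<^bsub>mid F\<^esub> (incl F (u l) \<otimes>\<^bsub>mid F\<^esub> T b)"
      using xy c by (simp add: F.X.m_ac del: F.X.r_inv)
    also have "\<dots> = f y"
      using xy c by (simp add: f_def)
    finally show ?thesis .
  qed
  from FactGroup_universal[OF f N.normal_axioms this]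
  obtain g where g: "g \<in> hom (M Mod N) (mid F)" "\<And>x. x \<in> carrier M \<Longrightarrow> g (q x) = f x"
    by blast
  have "g \<in> hom Q (mid F)"
    using g(1) by (simp add: quot_topgroup_def hom_def)
  moreover have "continuous_map (topo Q) (topo (mid F)) g"
  proof (rule continuous_compose_quotient_map[OF quotient_map_q])
    have "continuous_map (topo M) (topo (mid F)) f"
      unfolding f_def prod_topgroup_simps
    proof (rule continuous_map_group_mult[OF F.group_topologies(2)])
      show "continuous_map (prod_topology (topo K) (topo (mid E))) (topo (mid F)) (\<lambda>p. incl F (u (fst p)))"
        using continuous_map_compose[OF continuous_map_compose[OF continuous_map_fst top_homD(2)[OF u]] F.cont(1)]
        by (simp add: o_def)
      show "continuous_map (prod_topology (topo K) (topo (mid E))) (topo (mid F)) (\<lambda>p. T (snd p))"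
        using continuous_map_compose[OF continuous_map_snd top_homD(2)[OF T]] by (simp add: o_def)
    qed
    then show "continuous_map (topo M) (topo (mid F)) (g \<circ> q)"
      by (rule continuous_map_eq) (simp add: g(2))
  qed
  ultimately have "g \<in> top_hom (mid (pushout_ext H K s E)) (mid F)"
    by (simp add: top_hom_def pushout_sel)
  moreover have "g (incl (pushout_ext H K s E) k) = incl F (u k)" if "k \<in> carrier K" for k
    using g(2)[of "(k, \<one>\<^bsub>mid E\<^esub>)"] that by (simp add: pushout_sel f_def)
  moreover have "proj F (g z) = t (proj (pushout_ext H K s E) z)" if z: "z \<in> carrier Q" for z
  proof -
    obtain k x where kx: "k \<in> carrier K" "x \<in> carrier (mid E)" "z = q (k, x)"
      using z by (rule carrier_QE)
    then have "proj F (g z) = proj F (T x)" using g(2)[of "(k, x)"] by (simp add: f_def)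
    then show ?thesis using Tp kx by (simp add: pushout_proj)
  qed
  ultimately show ?thesis
    unfolding ext_mor_def by (auto simp: pushout_sel(1) simp del: quot_topgroup_simps)
qed

end

section \<open>Functoriality of the Baer sum\<close>

lemma top_hom_mult:
  assumes H: "top_ab_group H"
  shows "(\<lambda>(a, b). a \<otimes>\<^bsub>H\<^esub> b) \<in> top_hom (prod_topgroup H H) H"
proof -
  interpret comm_group H by (rule top_ab_groupD(1)[OF H])
  show ?thesis
    using group_topologyD(2)[OF top_ab_groupD(3)[OF H]] by (auto simp: top_hom_def hom_def m_ac)
qed

lemma top_hom_diag: "(\<lambda>g. (g, g)) \<in> top_hom G (prod_topgroup G G)"
  by (auto simp: top_hom_def hom_def continuous_map_paired)

lemma pushout_data_baer:
  assumes E: "top_extension H G E" and E': "top_extension H G E'"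
  shows "pushout_data (prod_topgroup H H) G (pullback_ext G (\<lambda>g. (g, g)) (product_ext E E')) H
    (\<lambda>(a, b). a \<otimes>\<^bsub>H\<^esub> b)"
proof -
  interpret top_ext H G E using E by (rule top_ext.intro)
  show ?thesis
    by (intro pushout_data.intro pushout_data_axioms.intro top_ext.intro top_ab(1) top_hom_mult
        top_extension_pullback[OF top_extension_product[OF E E'] top_ab(3) top_hom_diag])
qed

lemma top_extension_baer_sum:
  assumes "top_extension H G E" and "top_extension H G E'"
  shows "top_extension H G (baer_sum H G E E')"
  using pushout_data.top_extension_pushout[OF pushout_data_baer[OF assms]] by (simp add: baer_sum_def)

text \<open>A ladder from \<open>E \<times> E'\<close> to \<open>F \<times> F'\<close> lifts to the pull-backs along the diagonals, can be continued into
  the push-out that defines \<open>F + F'\<close>, and then factors through the push-out that defines \<open>E + E'\<close>.\<close>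

lemma ext_mor_baer_sum:
  assumes E: "top_extension H G E" and E': "top_extension H G E'"
    and F: "top_extension H L F" and F': "top_extension H L F'"
    and t: "t \<in> top_hom G L"
    and mor: "ext_mor H (\<lambda>h. h) t E F" "ext_mor H (\<lambda>h. h) t E' F'"
  shows "ext_mor H (\<lambda>h. h) t (baer_sum H G E E') (baer_sum H L F F')"
proof -
  interpret E: top_ext H G E using E by (rule top_ext.intro)
  interpret F: top_ext H L F using F by (rule top_ext.intro)
  let ?P = "pullback_ext G (\<lambda>g. (g, g)) (product_ext E E')"
  let ?R = "pullback_ext L (\<lambda>g. (g, g)) (product_ext F F')"
  let ?HH = "prod_topgroup H H"
  have "ext_mor ?HH (\<lambda>h. map_prod (\<lambda>h. h) (\<lambda>h. h) h) (\<lambda>g. map_prod t t (g, g)) ?P (product_ext F F')"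
    by (rule ext_mor_trans[OF ext_mor_pullback ext_mor_product[OF mor]])
  then have "ext_mor ?HH (\<lambda>h. h) (\<lambda>g. (t g, t g)) ?P (product_ext F F')"
    by (simp add: map_prod_def)
  then have "ext_mor ?HH (\<lambda>h. h) t ?P ?R"
    by (intro ext_mor_into_pullback[OF top_extension_pullback[OF top_extension_product[OF E E']
            E.top_ab(3) top_hom_diag] F.top_ab(3) t])
  from ext_mor_trans[OF this pushout_data.ext_mor_pushout[OF pushout_data_baer[OF F F']]]
  have "ext_mor ?HH (\<lambda>h. (case h of (a, b) \<Rightarrow> a \<otimes>\<^bsub>H\<^esub> b)) t ?P (baer_sum H L F F')"
    by (simp add: baer_sum_def)
  from pushout_data.ext_mor_from_pushout[OF pushout_data_baer[OF E E'] top_extension_baer_sum[OF F F']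
      top_hom_id this]
  show ?thesis by (simp add: baer_sum_def)
qed

section \<open>Coproducts\<close>

locale coproduct_family =
  fixes G :: "'i \<Rightarrow> 'a topgroup"
  assumes G: "\<And>n. top_ab_group (G n)"
begin

abbreviation "C \<equiv> coproduct UNIV G"
abbreviation "inc \<equiv> sum_incl UNIV G"

lemma top_ab_C: "top_ab_group C"
  by (rule top_ab_group_coproduct) (rule G)

sublocale C: comm_group C by (rule top_ab_groupD(1)[OF top_ab_C])

lemma group_G [simp]: "group (G n)"
  and topspace_G [simp]: "topspace (topo (G n)) = carrier (G n)"
  using top_ab_groupD[OF G] by blast+

lemma topspace_C [simp]: "topspace (topo C) = carrier C"
  by (rule top_ab_groupD(5)[OF top_ab_C])

lemma monoid_G [simp]: "monoid (G n)"
  by (rule group.is_monoid) simp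

lemma C_simps [simp]:
  "x \<otimes>\<^bsub>C\<^esub> y = (\<lambda>n. x n \<otimes>\<^bsub>G n\<^esub> y n)"
  "\<one>\<^bsub>C\<^esub> = (\<lambda>n. \<one>\<^bsub>G n\<^esub>)"
  by (simp_all add: coproduct_def restrict_def)

lemma carrier_C: "x \<in> carrier C \<longleftrightarrow> (\<forall>n. x n \<in> carrier (G n)) \<and> finite {n. x n \<noteq> \<one>\<^bsub>G n\<^esub>}"
  by (simp add: coproduct_def carrier_sum_group PiE_iff)

lemma inc_apply: "inc n a m = (if m = n then a else \<one>\<^bsub>G m\<^esub>)"
  by (simp add: sum_incl_def)

lemma top_hom_inc: "inc n \<in> top_hom (G n) C"
proof -
  have "inc n \<in> hom (G n) C"
  proof (rule homI)
    fix a assume "a \<in> carrier (G n)"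
    then show "inc n a \<in> carrier C"
      using sum_incl_closed[of UNIV G n a] by (simp add: coproduct_def)
  qed (auto simp: inc_apply fun_eq_iff)
  moreover have "continuous_map (topo (G n)) (topo C) (inc n)"
    using coproduct_finest(2)[of UNIV G n] G by (simp add: coproduct_def)
  ultimately show ?thesis by (simp add: top_hom_def)
qed

lemma inc_closed: "a \<in> carrier (G n) \<Longrightarrow> inc n a \<in> carrier C"
  by (rule top_homD(3)[OF top_hom_inc])

lemma coproduct_split:
  assumes "x \<in> carrier C"
  shows "x(n := \<one>\<^bsub>G n\<^esub>) \<in> carrier C" and "x = inc n (x n) \<otimes>\<^bsub>C\<^esub> x(n := \<one>\<^bsub>G n\<^esub>)"
proof -
  have "{m. (x(n := \<one>\<^bsub>G n\<^esub>)) m \<noteq> \<one>\<^bsub>G m\<^esub>} \<subseteq> {m. x m \<noteq> \<one>\<^bsub>G m\<^esub>}" by auto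
  then show "x(n := \<one>\<^bsub>G n\<^esub>) \<in> carrier C"
    using assms by (auto simp: carrier_C group.is_monoid intro: finite_subset)
  show "x = inc n (x n) \<otimes>\<^bsub>C\<^esub> x(n := \<one>\<^bsub>G n\<^esub>)"
    using assms by (auto simp: carrier_C inc_apply fun_eq_iff group.is_monoid)
qed

text \<open>Elements of the direct sum are finite products of elements of the summands. Consequently two
  homomorphisms that agree on the summands are equal, see \<open>hom_coproduct_eqI\<close>.\<close>

lemma coproduct_induct [consumes 1, case_names one mult]:
  assumes x: "x \<in> carrier C" and one: "P \<one>\<^bsub>C\<^esub>"
    and mult: "\<And>n a y. \<lbrakk>a \<in> carrier (G n); y \<in> carrier C; P y\<rbrakk> \<Longrightarrow> P (inc n a \<otimes>\<^bsub>C\<^esub> y)"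
  shows "P x"
proof -
  have "P x" if "finite S" "x \<in> carrier C" "{n. x n \<noteq> \<one>\<^bsub>G n\<^esub>} \<subseteq> S" for S x
    using that
  proof (induction S arbitrary: x)
    case empty
    then have "x = \<one>\<^bsub>C\<^esub>" by auto
    then show ?case using one by simp
  next
    case (insert n S)
    have "P (x(n := \<one>\<^bsub>G n\<^esub>))"
      by (rule insert.IH[OF coproduct_split(1)[OF insert.prems(1)]]) (use insert.prems(2) in auto)
    then have "P (inc n (x n) \<otimes>\<^bsub>C\<^esub> x(n := \<one>\<^bsub>G n\<^esub>))"
      using insert.prems(1) by (intro mult coproduct_split(1)) (simp_all add: carrier_C)
    then show ?case using coproduct_split(2)[OF insert.prems(1)] by metis
  qed
  then show ?thesis using x by (auto simp: carrier_C)
qed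

lemma hom_coproduct_eqI:
  assumes f: "f \<in> hom C Y" and g: "g \<in> hom C Y" and Y: "group Y"
    and eq: "\<And>n a. a \<in> carrier (G n) \<Longrightarrow> f (inc n a) = g (inc n a)" and x: "x \<in> carrier C"
  shows "f x = g x"
  using x
proof (induction rule: coproduct_induct)
  case one
  show ?case using hom_one[OF f C.is_group Y] hom_one[OF g C.is_group Y] by metis
next
  case (mult n a y)
  then show ?case
    using hom_mult[OF f inc_closed[OF mult(1)] mult(2)] hom_mult[OF g inc_closed[OF mult(1)] mult(2)]
      eq by metis
qed

lemma openin_coproductI:
  assumes "group_topology C T" and "\<And>n. continuous_map (topo (G n)) T (inc n)" and "openin T U"
  shows "openin (topo C) U"
  using coproduct_finest(3)[of UNIV G T U] assms G by (simp add: coproduct_def)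

text \<open>The inverse image under \<open>f\<close> of the topology of \<open>Y\<close> is a group topology on the direct sum, not
  necessarily Hausdorff, that makes all inclusions continuous. The coproduct topology is finer.\<close>

lemma continuous_map_coproductI:
  assumes f: "f \<in> hom C Y" and Y: "group Y" "group_topology Y T"
    and cont: "\<And>n. continuous_map (topo (G n)) T (\<lambda>a. f (inc n a))"
  shows "continuous_map (topo C) T f"
proof -
  interpret f: group_hom C Y f
    using f Y(1) by (simp add: group_hom_def group_hom_axioms_def)
  note topY [simp] = group_topologyD(1)[OF Y(2)]
  let ?S = "pullback_topology (carrier C) f T"
  have S: "topspace ?S = carrier C" by (auto simp: topspace_pullback_topology)
  have pre: "openin ?S {x \<in> carrier C. f x \<in> U}" if "openin T U" for U
    using that by (auto simp: openin_pullback_topology)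
  have "group_topology C ?S"
  proof (rule group_topologyI[OF S])
    fix x y U assume x: "x \<in> carrier C" and y: "y \<in> carrier C" and U: "openin ?S U" "x \<otimes>\<^bsub>C\<^esub> y \<in> U"
    then obtain V where V: "openin T V" "U = f -` V \<inter> carrier C" by (auto simp: openin_pullback_topology)
    have "f x \<otimes>\<^bsub>Y\<^esub> f y \<in> V" using U(2) x y f.hom_mult[OF x y] V(2) by (simp del: C_simps)
    then obtain A B where "openin T A" "openin T B" "f x \<in> A" "f y \<in> B"
        "\<And>a b. a \<in> A \<Longrightarrow> b \<in> B \<Longrightarrow> a \<otimes>\<^bsub>Y\<^esub> b \<in> V"
      using group_nbhd_mult[OF Y(2) f.hom_closed[OF x] f.hom_closed[OF y] V(1)] by metis
    then show "\<exists>A B. openin ?S A \<and> openin ?S B \<and> x \<in> A \<and> y \<in> B \<and> (\<forall>a\<in>A. \<forall>b\<in>B. a \<otimes>\<^bsub>C\<^esub> b \<in> U)"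
      using pre x y V(2)
      by (intro exI[of _ "{x \<in> carrier C. f x \<in> A}"] exI[of _ "{x \<in> carrier C. f x \<in> B}"])
        (auto simp del: C_simps)
  next
    fix x U assume x: "x \<in> carrier C" and U: "openin ?S U" "inv\<^bsub>C\<^esub> x \<in> U"
    then obtain V where V: "openin T V" "U = f -` V \<inter> carrier C" by (auto simp: openin_pullback_topology)
    define A where "A = {y \<in> topspace T. inv\<^bsub>Y\<^esub> y \<in> V}"
    have "openin T A"
      unfolding A_def by (rule openin_continuous_map_preimage[OF group_topologyD(3)[OF Y(2)] V(1)])
    then have "openin ?S {x \<in> carrier C. f x \<in> A}" by (rule pre)
    moreover have "x \<in> {x \<in> carrier C. f x \<in> A}"
      using x U(2) V(2) by (simp add: A_def)
    moreover have "inv\<^bsub>C\<^esub> a \<in> U" if "a \<in> {x \<in> carrier C. f x \<in> A}" for a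
      using that V(2) by (simp add: A_def)
    ultimately show "\<exists>A. openin ?S A \<and> x \<in> A \<and> (\<forall>a\<in>A. inv\<^bsub>C\<^esub> a \<in> U)"
      by blast
  qed (rule C.is_group)
  moreover have "continuous_map (topo (G n)) ?S (inc n)" for n
    unfolding continuous_map_def S
  proof (intro conjI allI impI)
    fix U assume "openin ?S U"
    then obtain V where V: "openin T V" "U = f -` V \<inter> carrier C" by (auto simp: openin_pullback_topology)
    have "{a \<in> topspace (topo (G n)). inc n a \<in> U} = {a \<in> topspace (topo (G n)). f (inc n a) \<in> V}"
      using V(2) inc_closed by auto
    then show "openin (topo (G n)) {a \<in> topspace (topo (G n)). inc n a \<in> U}"
      using openin_continuous_map_preimage[OF cont V(1)] by simp
  qed (use inc_closed in auto)
  ultimately have "openin (topo C) {x \<in> carrier C. f x \<in> U}" if "openin T U" for U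
    using pre[OF that] by (rule openin_coproductI)
  then show ?thesis by (simp add: continuous_map_def)
qed

text \<open>The homomorphism induced by a family \<open>f\<close> is \<open>x \<mapsto> \<Prod>f\<^sub>n(x\<^sub>n)\<close>, a product with finitely many nontrivial factors.\<close>

lemma coproduct_universal:
  assumes Y: "top_ab_group Y" and f: "\<And>n. f n \<in> top_hom (G n) Y"
  obtains s where "s \<in> top_hom C Y" and "\<And>n a. a \<in> carrier (G n) \<Longrightarrow> s (inc n a) = f n a"
proof -
  interpret Y: comm_group Y by (rule top_ab_groupD(1)[OF Y])
  have f1: "f n \<one>\<^bsub>G n\<^esub> = \<one>\<^bsub>Y\<^esub>" for n
    using top_hom_one[OF f] by simp
  have fc: "f n a \<in> carrier Y" if "a \<in> carrier (G n)" for n a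
    using top_homD(3)[OF f that] .
  define s where "s x = gfinprod Y (\<lambda>n. f n (x n)) UNIV" for x
  have fin: "finite {n \<in> UNIV. f n (x n) \<noteq> \<one>\<^bsub>Y\<^esub>}" if "x \<in> carrier C" for x
  proof (rule finite_subset)
    show "{n \<in> UNIV. f n (x n) \<noteq> \<one>\<^bsub>Y\<^esub>} \<subseteq> {n. x n \<noteq> \<one>\<^bsub>G n\<^esub>}" using f1 by force
  qed (use that in \<open>simp add: carrier_C\<close>)
  have s: "s \<in> hom C Y"
  proof (rule homI)
    fix x assume x: "x \<in> carrier C"
    then show "s x \<in> carrier Y"
      unfolding s_def using fc by (intro Y.gfinprod_closed) (auto simp: carrier_C)
    fix y assume y: "y \<in> carrier C"
    have "s (x \<otimes>\<^bsub>C\<^esub> y) = gfinprod Y (\<lambda>n. f n (x n) \<otimes>\<^bsub>Y\<^esub> f n (y n)) UNIV"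
      using x y top_homD(4)[OF f] by (simp add: s_def carrier_C)
    also have "\<dots> = s x \<otimes>\<^bsub>Y\<^esub> s y"
      unfolding s_def using fin[OF x] fin[OF y] x y fc
      by (intro Y.gfinprod_distrib) (auto simp: carrier_C)
    finally show "s (x \<otimes>\<^bsub>C\<^esub> y) = s x \<otimes>\<^bsub>Y\<^esub> s y" .
  qed
  have inc: "s (inc n a) = f n a" if a: "a \<in> carrier (G n)" for n a
  proof -
    have "gfinprod Y (\<lambda>m. f m (inc n a m)) {n} = gfinprod Y (\<lambda>m. f m (inc n a m)) UNIV"
      using fc f1 a
      by (intro Y.gfinprod_mono_neutral_cong_left) (auto simp: inc_apply)
    moreover have "gfinprod Y (\<lambda>m. f m (inc n a m)) {n} = f n a"
      using fc[OF a] by (simp add: inc_apply)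
    ultimately show ?thesis by (simp add: s_def)
  qed
  have "continuous_map (topo (G n)) (topo Y) (\<lambda>a. s (inc n a))" for n
    by (rule continuous_map_eq[OF top_homD(2)[OF f[of n]]]) (simp add: inc)
  then have "continuous_map (topo C) (topo Y) s"
    by (rule continuous_map_coproductI[OF s Y.is_group top_ab_groupD(3)[OF Y]])
  with s inc show thesis by (intro that[of s]) (simp_all add: top_hom_def)
qed

definition prod_box :: "('i \<Rightarrow> 'a set) \<Rightarrow> ('i \<Rightarrow> 'a) set" where
  "prod_box V = {x \<in> carrier C. \<forall>n. x n \<in> V n}"

text \<open>The box topology is a group topology that makes the inclusions continuous, so the coproduct
  topology is finer. This half of the comparison is valid for any number of summands.\<close>

lemma openin_box:
  assumes V: "\<And>n. openin (topo (G n)) (V n)"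
  shows "openin (topo C) (prod_box V)"
proof -
  \<comment> \<open>\<open>O'\<close> are the open sets of the box topology on the direct sum.\<close>
  define O' where "O' U \<longleftrightarrow> U \<subseteq> carrier C \<and>
      (\<forall>x\<in>U. \<exists>V. (\<forall>n. openin (topo (G n)) (V n)) \<and> x \<in> prod_box V \<and> prod_box V \<subseteq> U)" for U
  have Int: "prod_box (\<lambda>n. V n \<inter> W n) = prod_box V \<inter> prod_box W" for V W
    by (auto simp: prod_box_def)
  have "istopology O'"
    unfolding istopology_def
  proof (intro conjI allI impI)
    fix U W assume U: "O' U" and W: "O' W"
    show "O' (U \<inter> W)"
      unfolding O'_def
    proof (intro conjI ballI)
      fix x assume x: "x \<in> U \<inter> W"
      obtain A where A: "\<forall>n. openin (topo (G n)) (A n)" "x \<in> prod_box A" "prod_box A \<subseteq> U"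
        using U x unfolding O'_def by blast
      obtain B where B: "\<forall>n. openin (topo (G n)) (B n)" "x \<in> prod_box B" "prod_box B \<subseteq> W"
        using W x unfolding O'_def by blast
      show "\<exists>V. (\<forall>n. openin (topo (G n)) (V n)) \<and> x \<in> prod_box V \<and> prod_box V \<subseteq> U \<inter> W"
        using A B by (intro exI[of _ "\<lambda>n. A n \<inter> B n"]) (auto simp: Int)
    qed (use U in \<open>auto simp: O'_def\<close>)
  next
    fix \<K> assume "\<forall>K\<in>\<K>. O' K"
    then show "O' (\<Union>\<K>)" unfolding O'_def by (meson UnionE Union_least Union_upper subset_trans)
  qed
  then have open_iff: "openin (topology O') U \<longleftrightarrow> O' U" for U by simp
  have openE: thesis
    if "openin (topology O') U" "x \<in> U"
      "\<And>V. \<lbrakk>\<And>n. openin (topo (G n)) (V n); x \<in> prod_box V; prod_box V \<subseteq> U\<rbrakk> \<Longrightarrow> thesis"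
    for U x thesis
    using that unfolding open_iff O'_def by blast
  have box: "openin (topology O') (prod_box V)" if "\<And>n. openin (topo (G n)) (V n)" for V
    unfolding open_iff O'_def using that by (auto simp: prod_box_def)
  have "prod_box (\<lambda>n. carrier (G n)) = carrier C" by (auto simp: prod_box_def carrier_C)
  moreover have "openin (topo (G n)) (carrier (G n))" for n
    using openin_topspace[of "topo (G n)"] by simp
  ultimately have "openin (topology O') (carrier C)" using box[of "\<lambda>n. carrier (G n)"] by simp
  then have top: "topspace (topology O') = carrier C"
    using open_iff[of "topspace (topology O')"] openin_subset by (auto simp: O'_def)
  have inv: "inv\<^bsub>C\<^esub> x = (\<lambda>n. inv\<^bsub>G n\<^esub> x n)" if "x \<in> carrier C" for x
    using inv_sum_group[of UNIV G x] that by (simp add: coproduct_def restrict_def)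
  have "group_topology C (topology O')"
  proof (rule group_topologyI[OF top])
    fix x y U assume x: "x \<in> carrier C" and y: "y \<in> carrier C" and U: "openin (topology O') U" "x \<otimes>\<^bsub>C\<^esub> y \<in> U"
    obtain W where W: "\<And>n. openin (topo (G n)) (W n)" "x \<otimes>\<^bsub>C\<^esub> y \<in> prod_box W" "prod_box W \<subseteq> U"
      using openE[OF U] by metis
    have "\<exists>A B. openin (topo (G n)) A \<and> openin (topo (G n)) B \<and> x n \<in> A \<and> y n \<in> B \<and>
        (\<forall>a\<in>A. \<forall>b\<in>B. a \<otimes>\<^bsub>G n\<^esub> b \<in> W n)" for n
    proof -
      have mem: "x n \<in> carrier (G n)" "y n \<in> carrier (G n)" "x n \<otimes>\<^bsub>G n\<^esub> y n \<in> W n"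
        using W(2) x y by (simp_all add: prod_box_def carrier_C)
      show ?thesis
        by (rule group_nbhd_mult[OF top_ab_groupD(3)[OF G] mem(1,2) W(1) mem(3)]) blast
    qed
    then obtain A B where AB: "\<And>n. openin (topo (G n)) (A n)" "\<And>n. openin (topo (G n)) (B n)"
        "\<And>n. x n \<in> A n" "\<And>n. y n \<in> B n" "\<And>n a b. a \<in> A n \<Longrightarrow> b \<in> B n \<Longrightarrow> a \<otimes>\<^bsub>G n\<^esub> b \<in> W n"
      by metis
    have "a \<otimes>\<^bsub>C\<^esub> b \<in> U" if "a \<in> prod_box A" "b \<in> prod_box B" for a b
    proof -
      have "a \<otimes>\<^bsub>C\<^esub> b \<in> carrier C" using that by (intro C.m_closed) (simp_all add: prod_box_def)
      then have "a \<otimes>\<^bsub>C\<^esub> b \<in> prod_box W" using that AB(5) by (simp add: prod_box_def)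
      then show ?thesis using W(3) by blast
    qed
    moreover have "x \<in> prod_box A" "y \<in> prod_box B" using x y AB by (simp_all add: prod_box_def)
    ultimately show "\<exists>A B. openin (topology O') A \<and> openin (topology O') B \<and> x \<in> A \<and> y \<in> B \<and>
        (\<forall>a\<in>A. \<forall>b\<in>B. a \<otimes>\<^bsub>C\<^esub> b \<in> U)"
      using box[OF AB(1)] box[OF AB(2)] by blast
  next
    fix x U assume x: "x \<in> carrier C" and U: "openin (topology O') U" "inv\<^bsub>C\<^esub> x \<in> U"
    obtain W where W: "\<And>n. openin (topo (G n)) (W n)" "inv\<^bsub>C\<^esub> x \<in> prod_box W" "prod_box W \<subseteq> U"
      using openE[OF U] by metis
    define A where "A n = {y \<in> topspace (topo (G n)). inv\<^bsub>G n\<^esub> y \<in> W n}" for n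
    have A: "openin (topo (G n)) (A n)" for n
      unfolding A_def
      by (rule openin_continuous_map_preimage[OF group_topologyD(3)[OF top_ab_groupD(3)[OF G]] W(1)])
    have "inv\<^bsub>C\<^esub> a \<in> U" if a: "a \<in> prod_box A" for a
    proof -
      have aC: "a \<in> carrier C" using a by (simp add: prod_box_def)
      then have "inv\<^bsub>C\<^esub> a \<in> carrier C" by (rule C.inv_closed)
      then have "inv\<^bsub>C\<^esub> a \<in> prod_box W" using a by (simp add: prod_box_def inv[OF aC] A_def)
      then show ?thesis using W(3) by blast
    qed
    moreover have "x \<in> prod_box A" using W(2) x by (simp add: prod_box_def inv[OF x] A_def) (simp add: carrier_C)
    ultimately show "\<exists>A. openin (topology O') A \<and> x \<in> A \<and> (\<forall>a\<in>A. inv\<^bsub>C\<^esub> a \<in> U)"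
      using box[OF A] by blast
  qed (rule C.is_group)
  moreover have "continuous_map (topo (G n)) (topology O') (inc n)" for n
    unfolding continuous_map_def top
  proof (intro conjI allI impI)
    fix U assume U: "openin (topology O') U"
    show "openin (topo (G n)) {a \<in> topspace (topo (G n)). inc n a \<in> U}"
    proof (subst openin_subopen, intro ballI)
      fix a assume "a \<in> {a \<in> topspace (topo (G n)). inc n a \<in> U}"
      then have "inc n a \<in> U" by simp
      then obtain W where W: "\<And>n. openin (topo (G n)) (W n)" "inc n a \<in> prod_box W" "prod_box W \<subseteq> U"
        using openE[OF U] by metis
      have "a \<in> W n" using W(2) by (auto simp: prod_box_def inc_apply dest: spec[of _ n])
      moreover have "W n \<subseteq> {a \<in> topspace (topo (G n)). inc n a \<in> U}"
      proof
        fix b assume b: "b \<in> W n"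
        then have bG: "b \<in> carrier (G n)" using openin_subset[OF W(1)[of n]] by auto
        have "inc n b m \<in> W m" for m
          using W(2) b by (auto simp: prod_box_def inc_apply dest: spec[of _ m])
        then have "inc n b \<in> prod_box W" using inc_closed[OF bG] by (simp add: prod_box_def)
        then show "b \<in> {a \<in> topspace (topo (G n)). inc n a \<in> U}" using bG W(3) by auto
      qed
      ultimately show "\<exists>T. openin (topo (G n)) T \<and> a \<in> T \<and> T \<subseteq> {a \<in> topspace (topo (G n)). inc n a \<in> U}"
        using W(1) by blast
    qed
  qed (use inc_closed in auto)
  ultimately show ?thesis using box[OF V] by (rule openin_coproductI)
qed

end

lemma (in coproduct_family) top_hom_coproduct_map:
  fixes K :: "'i \<Rightarrow> 'b topgroup"
  assumes K: "\<And>n. top_ab_group (K n)" and f: "\<And>n. f n \<in> top_hom (G n) (K n)"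
  shows "(\<lambda>x n. f n (x n)) \<in> top_hom C (coproduct UNIV K)"
proof -
  interpret K: coproduct_family K by unfold_locales (rule K)
  have f1: "f n \<one>\<^bsub>G n\<^esub> = \<one>\<^bsub>K n\<^esub>" for n
    using top_hom_one[OF f] by simp
  let ?f = "\<lambda>x n. f n (x n)"
  have hom: "?f \<in> hom C K.C"
  proof (rule homI)
    fix x assume x: "x \<in> carrier C"
    have "{n. f n (x n) \<noteq> \<one>\<^bsub>K n\<^esub>} \<subseteq> {n. x n \<noteq> \<one>\<^bsub>G n\<^esub>}" using f1 by force
    then show "?f x \<in> carrier K.C"
      using x top_homD(3)[OF f] by (auto simp: carrier_C K.carrier_C intro: finite_subset)
    fix y assume "y \<in> carrier C"
    then show "?f (x \<otimes>\<^bsub>C\<^esub> y) = ?f x \<otimes>\<^bsub>K.C\<^esub> ?f y"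
      using x top_homD(4)[OF f] by (simp add: carrier_C)
  qed
  have eq: "?f (inc n a) = K.inc n (f n a)" for n a
    by (auto simp: inc_apply K.inc_apply f1 fun_eq_iff)
  have "continuous_map (topo (G n)) (topo K.C) (\<lambda>a. ?f (inc n a))" for n
    unfolding eq by (rule top_homD(2)[OF top_hom_compose[OF f K.top_hom_inc]])
  then have "continuous_map (topo C) (topo K.C) ?f"
    by (rule continuous_map_coproductI[OF hom K.C.is_group top_ab_groupD(3)[OF K.top_ab_C]])
  with hom show ?thesis by (simp add: top_hom_def)
qed

text \<open>The other half of the comparison with the box topology needs countably many summands. Choose
  \<open>U = W\<^sub>0, W\<^sub>1, \<dots>\<close> with \<open>W\<^sub>n\<^sub>+\<^sub>1 W\<^sub>n\<^sub>+\<^sub>1 \<subseteq> W\<^sub>n\<close> and let \<open>V\<^sub>n\<close> be the trace of \<open>W\<^sub>n\<^sub>+\<^sub>1\<close> on the \<open>n\<close>-th summand. An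
  element of the box that is supported in \<open>{k, k + 1, \<dots>}\<close> then lies in \<open>W\<^sub>k\<close>: its \<open>k\<close>-th
  component and, inductively, the remaining part are both in \<open>W\<^sub>k\<^sub>+\<^sub>1\<close>.\<close>

lemma open_nbhd_contains_box:
  fixes G :: "nat \<Rightarrow> 'a topgroup"
  assumes G: "\<And>n. top_ab_group (G n)"
    and U: "openin (topo (coproduct UNIV G)) U" "\<one>\<^bsub>coproduct UNIV G\<^esub> \<in> U"
  obtains V where "\<And>n. openin (topo (G n)) (V n)" and "\<And>n. \<one>\<^bsub>G n\<^esub> \<in> V n"
    and "coproduct_family.prod_box G V \<subseteq> U"
proof -
  interpret coproduct_family G by unfold_locales (rule G)
  define W where "W = rec_nat U (\<lambda>_ A. SOME B. openin (topo C) B \<and> \<one>\<^bsub>C\<^esub> \<in> B \<and>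
      (\<forall>a\<in>B. \<forall>b\<in>B. a \<otimes>\<^bsub>C\<^esub> b \<in> A))"
  have step: "openin (topo C) (W (Suc n)) \<and> \<one>\<^bsub>C\<^esub> \<in> W (Suc n) \<and>
      (\<forall>a\<in>W (Suc n). \<forall>b\<in>W (Suc n). a \<otimes>\<^bsub>C\<^esub> b \<in> W n)"
    if "openin (topo C) (W n)" "\<one>\<^bsub>C\<^esub> \<in> W n" for n
  proof -
    have "\<exists>B. openin (topo C) B \<and> \<one>\<^bsub>C\<^esub> \<in> B \<and> (\<forall>a\<in>B. \<forall>b\<in>B. a \<otimes>\<^bsub>C\<^esub> b \<in> W n)"
      by (rule group_nbhd_one_mult[OF top_ab_groupD(3)[OF top_ab_C] C.is_group that]) blast
    from someI_ex[OF this] show ?thesis by (simp add: W_def del: C_simps)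
  qed
  have W: "openin (topo C) (W n)" "\<one>\<^bsub>C\<^esub> \<in> W n" for n
  proof (induction n)
    case 0
    show "openin (topo C) (W 0)" "\<one>\<^bsub>C\<^esub> \<in> W 0" using U by (simp_all add: W_def del: C_simps)
  next
    case (Suc n)
    then show "openin (topo C) (W (Suc n))" "\<one>\<^bsub>C\<^esub> \<in> W (Suc n)" using step by blast+
  qed
  have Wmult: "a \<otimes>\<^bsub>C\<^esub> b \<in> W n" if "a \<in> W (Suc n)" "b \<in> W (Suc n)" for a b n
    using step[OF W] that by blast
  define V where "V n = {a \<in> topspace (topo (G n)). inc n a \<in> W (Suc n)}" for n
  have mem: "x \<in> W k"
    if "x \<in> carrier C" "\<And>n. x n \<in> V n" "\<And>n. x n \<noteq> \<one>\<^bsub>G n\<^esub> \<Longrightarrow> k \<le> n \<and> n < k + m" for x k m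
    using that
  proof (induction m arbitrary: x k)
    case 0
    have "x n = \<one>\<^bsub>G n\<^esub>" for n
      using 0(3)[of n] by linarith
    then have "x = \<one>\<^bsub>C\<^esub>" by (simp add: fun_eq_iff)
    then show ?case using W(2) by simp
  next
    case (Suc m)
    let ?y = "x(k := \<one>\<^bsub>G k\<^esub>)"
    have one: "\<one>\<^bsub>G k\<^esub> \<in> V k"
    proof -
      have "inc k \<one>\<^bsub>G k\<^esub> = \<one>\<^bsub>C\<^esub>" by (auto simp: inc_apply)
      then show ?thesis using W(2)[of "Suc k"] by (simp add: V_def)
    qed
    have "?y \<in> W (Suc k)"
    proof (rule Suc.IH[OF coproduct_split(1)[OF Suc.prems(1)]])
      show "?y n \<in> V n" for n using Suc.prems(2)[of n] one by auto
      show "Suc k \<le> n \<and> n < Suc k + m" if "?y n \<noteq> \<one>\<^bsub>G n\<^esub>" for n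
        using Suc.prems(3)[of n] that by (auto split: if_splits)
    qed
    moreover have "inc k (x k) \<in> W (Suc k)"
      using Suc.prems(2)[of k] by (simp add: V_def)
    ultimately have "inc k (x k) \<otimes>\<^bsub>C\<^esub> ?y \<in> W k" by (intro Wmult)
    then show ?case using coproduct_split(2)[OF Suc.prems(1), of k] by metis
  qed
  show thesis
  proof (rule that[of V])
    show "openin (topo (G n)) (V n)" for n
      unfolding V_def by (rule openin_continuous_map_preimage[OF top_homD(2)[OF top_hom_inc] W(1)])
    show "\<one>\<^bsub>G n\<^esub> \<in> V n" for n
    proof -
      have "inc n \<one>\<^bsub>G n\<^esub> = \<one>\<^bsub>C\<^esub>" by (auto simp: inc_apply)
      then show ?thesis using W(2)[of "Suc n"] by (simp add: V_def)
    qed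
    show "prod_box V \<subseteq> U"
    proof
      fix x assume "x \<in> prod_box V"
      then have x: "x \<in> carrier C" "\<And>n. x n \<in> V n" by (auto simp: prod_box_def)
      have "finite {n. x n \<noteq> \<one>\<^bsub>G n\<^esub>}" using x(1) by (simp add: carrier_C)
      then obtain m where "\<And>n. x n \<noteq> \<one>\<^bsub>G n\<^esub> \<Longrightarrow> n < m"
        using finite_nat_set_iff_bounded by auto
      then have "x \<in> W 0" using mem[OF x, of 0 m] by simp
      then show "x \<in> U" by (simp add: W_def)
    qed
  qed
qed

definition coproduct_ext :: "(nat \<Rightarrow> ('h, 'x, 'g) extension) \<Rightarrow> (nat \<Rightarrow> 'h, nat \<Rightarrow> 'x, nat \<Rightarrow> 'g) extension" where
  "coproduct_ext F = \<lparr>mid = coproduct UNIV (\<lambda>n. mid (F n)),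
     incl = (\<lambda>h n. incl (F n) (h n)), proj = (\<lambda>x n. proj (F n) (x n))\<rparr>"

text \<open>Exactness is coordinatewise; preimages are chosen trivial wherever possible, which keeps
  supports finite. By the two comparisons with boxes the embedding and openness conditions reduce to
  the individual extensions.\<close>

lemma top_extension_coproduct:
  fixes F :: "nat \<Rightarrow> ('h, 'x, 'g) extension"
  assumes F: "\<And>n. top_extension (K n) (G n) (F n)"
  shows "top_extension (coproduct UNIV K) (coproduct UNIV G) (coproduct_ext F)"
proof -
  interpret F: top_ext "K n" "G n" "F n" for n by (rule top_ext.intro[OF F])
  interpret K: coproduct_family K by unfold_locales (rule F.top_ab)
  interpret G: coproduct_family G by unfold_locales (rule F.top_ab)
  interpret X: coproduct_family "\<lambda>n. mid (F n)" by unfold_locales (rule F.top_ab)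
  have ih: "incl (F n) \<in> top_hom (K n) (mid (F n))" and ph: "proj (F n) \<in> top_hom (mid (F n)) (G n)" for n
    using F[of n] by (simp_all add: top_extension_def)
  have sel: "mid (coproduct_ext F) = X.C" "incl (coproduct_ext F) = (\<lambda>h n. incl (F n) (h n))"
      "proj (coproduct_ext F) = (\<lambda>x n. proj (F n) (x n))"
    by (simp_all add: coproduct_ext_def)
  show ?thesis
  proof (rule top_extensionI[OF K.top_ab_C G.top_ab_C], unfold sel)
    show "comm_group X.C" "group_topology X.C (topo X.C)"
      using top_ab_groupD[OF X.top_ab_C] by blast+
    show "(\<lambda>h n. incl (F n) (h n)) \<in> top_hom K.C X.C"
      by (rule K.top_hom_coproduct_map[OF F.top_ab(2) ih])
    show "(\<lambda>x n. proj (F n) (x n)) \<in> top_hom X.C G.C"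
      by (rule X.top_hom_coproduct_map[OF F.top_ab(3) ph])
  next
    fix h assume h: "h \<in> carrier K.C"
    then show "(\<lambda>n. proj (F n) (incl (F n) (h n))) = \<one>\<^bsub>G.C\<^esub>"
      by (auto simp: K.carrier_C)
    assume "(\<lambda>n. incl (F n) (h n)) = \<one>\<^bsub>X.C\<^esub>"
    then have "incl (F n) (h n) = \<one>\<^bsub>mid (F n)\<^esub>" for n by (simp add: fun_eq_iff)
    then have "h n = \<one>\<^bsub>K n\<^esub>" for n using F.incl_eq_oneD h by (simp add: K.carrier_C)
    then show "h = \<one>\<^bsub>K.C\<^esub>" by (simp add: fun_eq_iff)
  next
    fix x assume x: "x \<in> carrier X.C" and px: "(\<lambda>n. proj (F n) (x n)) = \<one>\<^bsub>G.C\<^esub>"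
    have "\<exists>h. h \<in> carrier (K n) \<and> x n = incl (F n) h" for n
    proof (rule F.kernel_projE[of "x n" n])
      show "x n \<in> carrier (mid (F n))" using x by (simp add: X.carrier_C)
      show "proj (F n) (x n) = \<one>\<^bsub>G n\<^esub>" using px by (simp add: fun_eq_iff)
    qed blast
    then obtain h where h: "\<And>n. h n \<in> carrier (K n)" "\<And>n. x n = incl (F n) (h n)"
      by metis
    have "{n. h n \<noteq> \<one>\<^bsub>K n\<^esub>} \<subseteq> {n. x n \<noteq> \<one>\<^bsub>mid (F n)\<^esub>}"
      using h F.incl_eq_oneD by auto
    then have "h \<in> carrier K.C"
      using x h(1) by (auto simp: X.carrier_C K.carrier_C intro: finite_subset)
    then show "\<exists>h\<in>carrier K.C. x = (\<lambda>n. incl (F n) (h n))" using h(2) by blast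
  next
    fix g assume g: "g \<in> carrier G.C"
    have "\<exists>x. x \<in> carrier (mid (F n)) \<and> proj (F n) x = g n \<and> (g n = \<one>\<^bsub>G n\<^esub> \<longrightarrow> x = \<one>\<^bsub>mid (F n)\<^esub>)" for n
    proof (cases "g n = \<one>\<^bsub>G n\<^esub>")
      case False
      have "g n \<in> carrier (G n)" using g by (simp add: G.carrier_C)
      then show ?thesis by (rule F.proj_surj) (use False in blast)
    qed (auto intro: exI[of _ "\<one>\<^bsub>mid (F n)\<^esub>"])
    then obtain x where x: "\<And>n. x n \<in> carrier (mid (F n))" "\<And>n. proj (F n) (x n) = g n"
        "\<And>n. g n = \<one>\<^bsub>G n\<^esub> \<Longrightarrow> x n = \<one>\<^bsub>mid (F n)\<^esub>"
      by metis
    have "{n. x n \<noteq> \<one>\<^bsub>mid (F n)\<^esub>} \<subseteq> {n. g n \<noteq> \<one>\<^bsub>G n\<^esub>}" using x(3) by auto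
    then have "x \<in> carrier X.C"
      using g x(1) by (auto simp: X.carrier_C G.carrier_C intro: finite_subset)
    then show "\<exists>x\<in>carrier X.C. (\<lambda>n. proj (F n) (x n)) = g" using x(2) by blast
  next
    fix U assume "openin (topo K.C) U" "\<one>\<^bsub>K.C\<^esub> \<in> U"
    then obtain V where V: "\<And>n. openin (topo (K n)) (V n)" "\<And>n. \<one>\<^bsub>K n\<^esub> \<in> V n" "K.prod_box V \<subseteq> U"
      using open_nbhd_contains_box[of K U] F.top_ab(1) by blast
    have "\<exists>W. openin (topo (mid (F n))) W \<and> (\<forall>h\<in>carrier (K n). incl (F n) h \<in> W \<longleftrightarrow> h \<in> V n)" for n
      by (rule F.incl_embedding[OF V(1)[of n]]) blast
    then obtain W where W: "\<And>n. openin (topo (mid (F n))) (W n)"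
        "\<And>n h. h \<in> carrier (K n) \<Longrightarrow> incl (F n) h \<in> W n \<longleftrightarrow> h \<in> V n"
      by metis
    have "openin (topo X.C) (X.prod_box W)" by (rule X.openin_box[OF W(1)])
    moreover have "\<one>\<^bsub>mid (F n)\<^esub> \<in> W n" for n
      using W(2)[of "\<one>\<^bsub>K n\<^esub>" n] V(2) by simp
    then have "\<one>\<^bsub>X.C\<^esub> \<in> X.prod_box W"
      using X.C.one_closed by (simp add: X.prod_box_def)
    moreover have "h \<in> U" if "h \<in> carrier K.C" "(\<lambda>n. incl (F n) (h n)) \<in> X.prod_box W" for h
    proof -
      have "h n \<in> V n" for n
        using that W(2)[of "h n" n] by (simp add: X.prod_box_def K.carrier_C)
      then have "h \<in> K.prod_box V" using that(1) by (simp add: K.prod_box_def)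
      then show "h \<in> U" using V(3) by blast
    qed
    ultimately show "\<exists>W. openin (topo X.C) W \<and> \<one>\<^bsub>X.C\<^esub> \<in> W \<and>
        (\<forall>h\<in>carrier K.C. (\<lambda>n. incl (F n) (h n)) \<in> W \<longrightarrow> h \<in> U)"
      by blast
  next
    fix U assume "openin (topo X.C) U" "\<one>\<^bsub>X.C\<^esub> \<in> U"
    then obtain V where V: "\<And>n. openin (topo (mid (F n))) (V n)" "\<And>n. \<one>\<^bsub>mid (F n)\<^esub> \<in> V n"
        "X.prod_box V \<subseteq> U"
      using open_nbhd_contains_box[of "\<lambda>n. mid (F n)" U] F.top_ab(2) by blast
    define W where "W n = proj (F n) ` V n" for n
    have "openin (topo (G n)) (W n)" for n
      using F.open_map_proj[of n] V(1)[of n] by (simp add: W_def open_map_def)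
    then have "openin (topo G.C) (G.prod_box W)" by (rule G.openin_box)
    moreover have "\<one>\<^bsub>G n\<^esub> \<in> W n" for n
      unfolding W_def by (rule image_eqI[OF _ V(2)]) simp
    then have "\<one>\<^bsub>G.C\<^esub> \<in> G.prod_box W"
      using G.C.one_closed by (simp add: G.prod_box_def)
    moreover have "G.prod_box W \<subseteq> (\<lambda>x n. proj (F n) (x n)) ` U"
    proof
      fix g assume g: "g \<in> G.prod_box W"
      have "\<exists>x. x \<in> V n \<and> proj (F n) x = g n \<and> (g n = \<one>\<^bsub>G n\<^esub> \<longrightarrow> x = \<one>\<^bsub>mid (F n)\<^esub>)" for n
      proof (cases "g n = \<one>\<^bsub>G n\<^esub>")
        case False
        have "g n \<in> proj (F n) ` V n" using g by (simp add: G.prod_box_def W_def)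
        with False show ?thesis by auto
      qed (use V(2)[of n] in auto)
      then obtain x where x: "\<And>n. x n \<in> V n" "\<And>n. proj (F n) (x n) = g n"
          "\<And>n. g n = \<one>\<^bsub>G n\<^esub> \<Longrightarrow> x n = \<one>\<^bsub>mid (F n)\<^esub>"
        by metis
      have xc: "x n \<in> carrier (mid (F n))" for n
        using openin_subset[OF V(1)[of n]] x(1)[of n] by auto
      have "{n. x n \<noteq> \<one>\<^bsub>mid (F n)\<^esub>} \<subseteq> {n. g n \<noteq> \<one>\<^bsub>G n\<^esub>}" using x(3) by auto
      moreover have "finite {n. g n \<noteq> \<one>\<^bsub>G n\<^esub>}" using g by (simp add: G.prod_box_def G.carrier_C)
      ultimately have "x \<in> carrier X.C"
        using xc by (auto simp: X.carrier_C intro: finite_subset)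
      then have "x \<in> U" using x(1) V(3) by (auto simp: X.prod_box_def)
      moreover have "g = (\<lambda>n. proj (F n) (x n))" using x(2) by simp
      ultimately show "g \<in> (\<lambda>x n. proj (F n) (x n)) ` U" by blast
    qed
    ultimately show "\<exists>W. openin (topo G.C) W \<and> \<one>\<^bsub>G.C\<^esub> \<in> W \<and> W \<subseteq> (\<lambda>x n. proj (F n) (x n)) ` U"
      by blast
  qed
qed

section \<open>Gluing extensions along a coproduct\<close>

text \<open>The push-out of the coproduct extension along the summation homomorphism \<open>\<Oplus>H \<rightarrow> H\<close> is, up to
  equivalence, the only extension of \<open>\<Oplus>G\<^sub>n\<close> by \<open>H\<close> that restricts to the given extension on each summand.\<close>

lemma glued_extension:
  fixes F :: "nat \<Rightarrow> ('h, 'x, 'g) extension"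
  assumes H: "top_ab_group H" and F: "\<And>n. top_extension H (G n) (F n)"
  obtains Z :: "('h, ('h \<times> (nat \<Rightarrow> 'x)) set, nat \<Rightarrow> 'g) extension"
  where "top_extension H (coproduct UNIV G) Z"
    and "\<And>n. ext_mor H (\<lambda>h. h) (sum_incl UNIV G n) (F n) Z"
    and "\<And>E :: ('h, 'y, nat \<Rightarrow> 'g) extension. \<lbrakk>top_extension H (coproduct UNIV G) E;
      \<And>n. ext_mor H (\<lambda>h. h) (sum_incl UNIV G n) (F n) E\<rbrakk> \<Longrightarrow> ext_equiv H Z E"
proof -
  interpret F: top_ext H "G n" "F n" for n by (rule top_ext.intro[OF F])
  interpret K: coproduct_family "\<lambda>_::nat. H" by unfold_locales (rule H)
  interpret G: coproduct_family G by unfold_locales (rule F.top_ab)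
  interpret X: coproduct_family "\<lambda>n. mid (F n)" by unfold_locales (rule F.top_ab)
  \<comment> \<open>\<open>s\<close> is the summation homomorphism, the identity on each summand.\<close>
  obtain s where s: "s \<in> top_hom K.C H" and s_inc: "\<And>n h. h \<in> carrier H \<Longrightarrow> s (K.inc n h) = h"
    using K.coproduct_universal[OF H, of "\<lambda>_ h. h"] top_hom_id by blast
  let ?E = "coproduct_ext F"
  have E: "top_extension K.C G.C ?E" by (rule top_extension_coproduct[OF F])
  have sel: "mid ?E = X.C" "incl ?E = (\<lambda>h n. incl (F n) (h n))" "proj ?E = (\<lambda>x n. proj (F n) (x n))"
    by (simp_all add: coproduct_ext_def)
  interpret P: pushout_data K.C G.C ?E H s
    by (intro pushout_data.intro pushout_data_axioms.intro top_ext.intro E H s)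
  let ?Z = "pushout_ext K.C H s ?E"
  have incl_inc: "incl ?E (K.inc n h) = X.inc n (incl (F n) h)" if "h \<in> carrier H" for n h
    by (auto simp: sel K.inc_apply X.inc_apply fun_eq_iff)
  have proj_inc: "proj ?E (X.inc n x) = G.inc n (proj (F n) x)" if "x \<in> carrier (mid (F n))" for n x
    by (auto simp: sel G.inc_apply X.inc_apply fun_eq_iff)
  have mor: "ext_mor H (K.inc n) (G.inc n) (F n) ?E" for n
    unfolding ext_mor_def by (rule bexI[of _ "X.inc n"]) (auto simp: incl_inc proj_inc sel(1) X.top_hom_inc)
  have Z: "top_extension H G.C ?Z" by (rule P.top_extension_pushout)
  show thesis
  proof (rule that[of ?Z, OF Z])
    fix n
    have "ext_mor H (\<lambda>h. s (K.inc n h)) (G.inc n) (F n) ?Z"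
      using ext_mor_trans[OF mor P.ext_mor_pushout] K.inc_closed by simp
    then show "ext_mor H (\<lambda>h. h) (G.inc n) (F n) ?Z"
      by (simp add: ext_mor_def s_inc)
  next
    fix E' :: "('h, 'y, nat \<Rightarrow> 'g) extension"
    assume E': "top_extension H G.C E'" and mor': "\<And>n. ext_mor H (\<lambda>h. h) (G.inc n) (F n) E'"
    interpret E': top_ext H G.C E' using E' by (rule top_ext.intro)
    have "\<exists>f. f \<in> top_hom (mid (F n)) (mid E') \<and> (\<forall>h\<in>carrier H. f (incl (F n) h) = incl E' h) \<and>
        (\<forall>x\<in>carrier (mid (F n)). proj E' (f x) = G.inc n (proj (F n) x))" for n
      using mor'[of n] by (auto simp: ext_mor_def)
    then obtain f where f: "\<And>n. f n \<in> top_hom (mid (F n)) (mid E')"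
        and fi: "\<And>n h. h \<in> carrier H \<Longrightarrow> f n (incl (F n) h) = incl E' h"
        and fp: "\<And>n x. x \<in> carrier (mid (F n)) \<Longrightarrow> proj E' (f n x) = G.inc n (proj (F n) x)"
      by metis
    obtain r where r: "r \<in> top_hom X.C (mid E')"
        and r_inc: "\<And>n x. x \<in> carrier (mid (F n)) \<Longrightarrow> r (X.inc n x) = f n x"
      using X.coproduct_universal[OF E'.top_ab(2) f] by blast
    \<comment> \<open>Both compatibilities hold on the summands, hence everywhere.\<close>
    have "r (incl ?E h) = incl E' (s h)" if "h \<in> carrier K.C" for h
    proof (rule K.hom_coproduct_eqI[OF _ _ E'.X.is_group _ that])
      show "(\<lambda>h. r (incl ?E h)) \<in> hom K.C (mid E')"
        using hom_compose[OF P.homs(1)] top_homD(1)[OF r] by (simp add: sel(1) o_def)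
      show "(\<lambda>h. incl E' (s h)) \<in> hom K.C (mid E')"
        using hom_compose[OF top_homD(1)[OF s] E'.homs(1)] by (simp add: o_def)
      show "r (incl ?E (K.inc n h)) = incl E' (s (K.inc n h))" if "h \<in> carrier H" for n h
        using that by (simp add: incl_inc s_inc r_inc fi)
    qed
    moreover have "proj E' (r x) = proj ?E x" if "x \<in> carrier X.C" for x
    proof (rule X.hom_coproduct_eqI[OF _ _ G.C.is_group _ that])
      show "(\<lambda>x. proj E' (r x)) \<in> hom X.C G.C"
        using hom_compose[OF top_homD(1)[OF r] E'.homs(2)] by (simp add: o_def)
      show "proj ?E \<in> hom X.C G.C" using P.homs(2) by (simp add: sel(1))
      show "proj E' (r (X.inc n x)) = proj ?E (X.inc n x)" if "x \<in> carrier (mid (F n))" for n x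
        using that by (simp add: proj_inc r_inc fp)
    qed
    ultimately have "ext_mor K.C s (\<lambda>g. g) ?E E'"
      unfolding ext_mor_def using r by (intro bexI[of _ r]) (auto simp: sel(1))
    then show "ext_equiv H ?Z E'"
      unfolding ext_equiv_iff_ext_mor by (intro P.ext_mor_from_pushout[OF E' top_hom_id])
  qed
qed

section \<open>Equivalence classes\<close>

lemma mem_ext_class: "E' \<in> ext_class H G E \<longleftrightarrow> top_extension H G E' \<and> ext_equiv H E E'"
  by (simp add: ext_class_def)

lemma ext_class_eqI:
  assumes E: "top_extension H G E" and E': "top_extension H G E'" and eq: "ext_equiv H E E'"
  shows "ext_class H G E = ext_class H G E'"
  using ext_equiv_sym[OF E E' eq] eq by (auto simp: mem_ext_class intro: ext_equiv_trans)

lemma ext_class_eqD: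
  assumes E: "top_extension H G E" and E': "top_extension H G E'"
    and eq: "ext_class H G E = ext_class H G E'"
  shows "ext_equiv H E E'"
proof -
  obtain R :: "('a, 'b) repr" where R: "top_extension H G R" "ext_equiv H E R"
    using top_extension_representable[OF E] by blast
  then have "R \<in> ext_class H G E'" using eq by (simp add: mem_ext_class flip: eq)
  then have "ext_equiv H E' R" by (simp add: mem_ext_class)
  then show ?thesis using R ext_equiv_sym[OF E' R(1)] ext_equiv_trans by blast
qed

lemma carrier_ExtE:
  assumes "A \<in> carrier (Ext G H)"
  obtains E :: "('h, 'g) repr" where "top_extension H G E" and "A = ext_class H G E"
proof -
  obtain E where E: "top_extension H G E" "A = ext_rel H G `` {E}"
    using assms by (auto simp: Ext_def quotient_def)
  then have "A = ext_class H G E" by (auto simp: ext_rel_def ext_class_def)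
  with E(1) show thesis by (rule that)
qed

lemma ext_class_in_carrier:
  fixes E :: "('h, 'x, 'g) extension"
  assumes E: "top_extension H G E"
  shows "ext_class H G E \<in> carrier (Ext G H)"
proof -
  obtain R :: "('h, 'g) repr" where R: "top_extension H G R" "ext_equiv H E R"
    using top_extension_representable[OF E] by blast
  have "ext_class H G E = ext_class H G R" by (rule ext_class_eqI[OF E R])
  also have "\<dots> = ext_rel H G `` {R}" using R(1) by (auto simp: ext_rel_def ext_class_def)
  finally show ?thesis using R(1) by (simp add: Ext_def quotientI)
qed

text \<open>A value that does not depend on the representative, applied to a class by means of a union; the
  union is not empty since every extension has a representative.\<close>

lemma ext_class_UN:
  assumes E: "top_extension H G E"
    and f: "\<And>R :: ('h, 'g) repr. \<lbrakk>top_extension H G R; ext_equiv H E R\<rbrakk> \<Longrightarrow> f R = B"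
  shows "(\<Union>R\<in>ext_class H G E. f R) = B"
proof -
  obtain R :: "('h, 'g) repr" where "top_extension H G R" "ext_equiv H E R"
    using top_extension_representable[OF E] by blast
  then have "R \<in> ext_class H G E" by (simp add: mem_ext_class)
  moreover have "f R = B" if "R \<in> ext_class H G E" for R
    using f that by (simp add: mem_ext_class)
  ultimately show ?thesis by auto
qed

text \<open>The Baer sum respects equivalence, so the product of classes can be computed with extensions whose
  middle groups have arbitrary types.\<close>

lemma mult_Ext:
  assumes E: "top_extension H G E" and E': "top_extension H G E'"
  shows "ext_class H G E \<otimes>\<^bsub>Ext G H\<^esub> ext_class H G E' = ext_class H G (baer_sum H G E E')"
proof -
  have "ext_class H G (baer_sum H G R R') = ext_class H G (baer_sum H G E E')"
    if R: "top_extension H G R" "ext_equiv H E R" and R': "top_extension H G R'" "ext_equiv H E' R'"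
    for R R' :: "('a, 'b) repr"
  proof (rule ext_class_eqI[symmetric])
    show "ext_equiv H (baer_sum H G E E') (baer_sum H G R R')"
      using ext_mor_baer_sum[OF E E' R(1) R'(1) top_hom_id] R(2) R'(2)
      by (simp add: ext_equiv_iff_ext_mor)
  qed (rule top_extension_baer_sum; fact)+
  then have "(\<Union>R\<in>ext_class H G E. \<Union>R'\<in>ext_class H G E'. ext_class H G (baer_sum H G R R')) =
      ext_class H G (baer_sum H G E E')"
    by (intro ext_class_UN[OF E] ext_class_UN[OF E'])
  then show ?thesis by (simp add: Ext_def)
qed

text \<open>Both extensions are equivalent to the pull-back of \<open>E\<close> along \<open>t\<close>.\<close>

lemma ext_equiv_over_same_map:
  assumes F: "top_extension H L F" and F': "top_extension H L F'" and E: "top_extension H G E"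
    and t: "t \<in> top_hom L G"
    and mor: "ext_mor H (\<lambda>h. h) t F E" "ext_mor H (\<lambda>h. h) t F' E"
  shows "ext_equiv H F F'"
proof -
  interpret F: top_ext H L F using F by (rule top_ext.intro)
  let ?P = "pullback_ext L t E"
  have P: "top_extension H L ?P" by (rule top_extension_pullback[OF E F.top_ab(3) t])
  have "ext_equiv H F ?P" "ext_equiv H F' ?P"
    unfolding ext_equiv_iff_ext_mor
    using ext_mor_into_pullback[OF F F.top_ab(3) top_hom_id mor(1)]
      ext_mor_into_pullback[OF F' F.top_ab(3) top_hom_id mor(2)] by simp_all
  then show ?thesis using ext_equiv_sym[OF F' P] ext_equiv_trans by blast
qed

section \<open>The isomorphism\<close>

text \<open>The homomorphism \<open>Ext(t, H)\<close>, contravariant in the first argument.\<close>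

definition Ext_restrict :: "'l topgroup \<Rightarrow> 'h topgroup \<Rightarrow> ('l \<Rightarrow> 'g) \<Rightarrow> ('h, 'g) repr set \<Rightarrow> ('h, 'l) repr set" where
  "Ext_restrict L H t A = (\<Union>E\<in>A. ext_class H L (pullback_ext L t E))"

text \<open>The homomorphism \<open>Ext(t, H)\<close> is computed by any extension with a ladder \<open>(id, t)\<close> into the given one.\<close>

lemma Ext_restrict_eq:
  assumes E: "top_extension H G E" and t: "t \<in> top_hom L G"
    and F: "top_extension H L F" and mor: "ext_mor H (\<lambda>h. h) t F E"
  shows "Ext_restrict L H t (ext_class H G E) = ext_class H L F"
  unfolding Ext_restrict_def
proof (rule ext_class_UN[OF E])
  interpret F: top_ext H L F using F by (rule top_ext.intro)
  fix R assume R: "top_extension H G R" "ext_equiv H E R"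
  have P: "top_extension H L (pullback_ext L t R)"
    by (rule top_extension_pullback[OF R(1) F.top_ab(3) t])
  have "ext_mor H (\<lambda>h. h) t F R"
    using ext_mor_trans[OF mor R(2)[unfolded ext_equiv_iff_ext_mor]] by simp
  then show "ext_class H L (pullback_ext L t R) = ext_class H L F"
    by (intro ext_class_eqI[OF P F] ext_equiv_over_same_map[OF P F R(1) t] ext_mor_pullback)
qed

text \<open>The Baer sum of the pull-backs maps to the Baer sum of the original extensions by a ladder
  \<open>(id, t)\<close>, so it represents the image of the sum.\<close>

lemma Ext_restrict_hom:
  fixes L :: "'l topgroup" and G :: "'g topgroup" and H :: "'h topgroup"
  assumes L: "top_ab_group L" and t: "t \<in> top_hom L G"
  shows "Ext_restrict L H t \<in> hom (Ext G H) (Ext L H)"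
proof (rule homI)
  fix A assume "A \<in> carrier (Ext G H)"
  then obtain E :: "('h, 'g) repr" where E: "top_extension H G E" "A = ext_class H G E" by (rule carrier_ExtE)
  let ?F = "pullback_ext L t E"
  have F: "top_extension H L ?F" by (rule top_extension_pullback[OF E(1) L t])
  have A: "Ext_restrict L H t A = ext_class H L ?F"
    unfolding E(2) by (rule Ext_restrict_eq[OF E(1) t F ext_mor_pullback])
  then show "Ext_restrict L H t A \<in> carrier (Ext L H)"
    using ext_class_in_carrier[OF F] by simp
  fix B assume "B \<in> carrier (Ext G H)"
  then obtain E' :: "('h, 'g) repr" where E': "top_extension H G E'" "B = ext_class H G E'" by (rule carrier_ExtE)
  let ?F' = "pullback_ext L t E'"
  have F': "top_extension H L ?F'" by (rule top_extension_pullback[OF E'(1) L t])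
  have B: "Ext_restrict L H t B = ext_class H L ?F'"
    unfolding E'(2) by (rule Ext_restrict_eq[OF E'(1) t F' ext_mor_pullback])
  have "Ext_restrict L H t (ext_class H G (baer_sum H G E E')) = ext_class H L (baer_sum H L ?F ?F')"
    by (intro Ext_restrict_eq[OF top_extension_baer_sum[OF E(1) E'(1)] t top_extension_baer_sum[OF F F']]
        ext_mor_baer_sum[OF F F' E(1) E'(1) t] ext_mor_pullback)
  then show "Ext_restrict L H t (A \<otimes>\<^bsub>Ext G H\<^esub> B) = Ext_restrict L H t A \<otimes>\<^bsub>Ext L H\<^esub> Ext_restrict L H t B"
    unfolding A B unfolding E(2) E'(2) by (simp add: mult_Ext[OF E(1) E'(1)] mult_Ext[OF F F'])
qed

theorem theorem22:
  fixes H :: "'h topgroup" and G :: "nat \<Rightarrow> 'g topgroup"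
  assumes "top_ab_group H" and "\<And>\<alpha>. top_ab_group (G \<alpha>)"
  shows "Ext (coproduct UNIV G) H \<cong> product_group UNIV (\<lambda>\<alpha>. Ext (G \<alpha>) H)"
proof -
  interpret G: coproduct_family G by unfold_locales (rule assms(2))
  let ?\<Phi> = "\<lambda>A n. Ext_restrict (G n) H (G.inc n) A"
  have hom_n: "Ext_restrict (G n) H (G.inc n) \<in> hom (Ext G.C H) (Ext (G n) H)" for n
    by (rule Ext_restrict_hom[OF assms(2) G.top_hom_inc])
  have "?\<Phi> \<in> hom (Ext G.C H) (product_group UNIV (\<lambda>n. Ext (G n) H))"
  proof (rule homI)
    show "?\<Phi> A \<in> carrier (product_group UNIV (\<lambda>n. Ext (G n) H))" if "A \<in> carrier (Ext G.C H)" for A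
      using hom_in_carrier[OF hom_n that] by (simp add: PiE_iff)
    show "?\<Phi> (A \<otimes>\<^bsub>Ext G.C H\<^esub> B) = ?\<Phi> A \<otimes>\<^bsub>product_group UNIV (\<lambda>n. Ext (G n) H)\<^esub> ?\<Phi> B"
      if "A \<in> carrier (Ext G.C H)" "B \<in> carrier (Ext G.C H)" for A B
      using hom_mult[OF hom_n that] by (simp add: restrict_def)
  qed
  moreover have "bij_betw ?\<Phi> (carrier (Ext G.C H)) (carrier (product_group UNIV (\<lambda>n. Ext (G n) H)))"
  proof (rule bij_betwI')
    fix A B assume A: "A \<in> carrier (Ext G.C H)" and B: "B \<in> carrier (Ext G.C H)"
    obtain E :: "('h, nat \<Rightarrow> 'g) repr" where E: "top_extension H G.C E" "A = ext_class H G.C E" using A by (rule carrier_ExtE)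
    obtain E' :: "('h, nat \<Rightarrow> 'g) repr" where E': "top_extension H G.C E'" "B = ext_class H G.C E'" using B by (rule carrier_ExtE)
    show "?\<Phi> A = ?\<Phi> B \<longleftrightarrow> A = B"
    proof
      assume eq: "?\<Phi> A = ?\<Phi> B"
      let ?F = "\<lambda>n. pullback_ext (G n) (G.inc n) E"
      let ?F' = "\<lambda>n. pullback_ext (G n) (G.inc n) E'"
      have F: "top_extension H (G n) (?F n)" for n
        by (rule top_extension_pullback[OF E(1) assms(2) G.top_hom_inc])
      have F': "top_extension H (G n) (?F' n)" for n
        by (rule top_extension_pullback[OF E'(1) assms(2) G.top_hom_inc])
      have mor: "ext_mor H (\<lambda>h. h) (G.inc n) (?F n) E" for n by (rule ext_mor_pullback)
      have mor': "ext_mor H (\<lambda>h. h) (G.inc n) (?F n) E'" for n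
      proof -
        have "ext_class H (G n) (?F n) = ?\<Phi> A n"
          unfolding E(2) by (rule Ext_restrict_eq[OF E(1) G.top_hom_inc F ext_mor_pullback, symmetric])
        also have "\<dots> = ?\<Phi> B n" using eq by (simp add: fun_eq_iff)
        also have "\<dots> = ext_class H (G n) (?F' n)"
          unfolding E'(2) by (rule Ext_restrict_eq[OF E'(1) G.top_hom_inc F' ext_mor_pullback])
        finally have "ext_equiv H (?F n) (?F' n)" by (rule ext_class_eqD[OF F F'])
        from ext_mor_trans[OF this[unfolded ext_equiv_iff_ext_mor] ext_mor_pullback]
        show ?thesis by simp
      qed
      have "ext_equiv H E E'"
      proof (rule glued_extension[of H G ?F, OF assms(1) F])
        fix Z :: "('h, ('h \<times> (nat \<Rightarrow> ('h \<times> (nat \<Rightarrow> 'g)) \<times> 'g)) set, nat \<Rightarrow> 'g) extension"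
        assume Z: "top_extension H G.C Z"
          and univ: "\<And>E :: ('h, nat \<Rightarrow> 'g) repr. \<lbrakk>top_extension H G.C E;
            \<And>n. ext_mor H (\<lambda>h. h) (G.inc n) (?F n) E\<rbrakk> \<Longrightarrow> ext_equiv H Z E"
        have "ext_equiv H Z E" "ext_equiv H Z E'"
          using univ[OF E(1) mor] univ[OF E'(1) mor'] .
        then show "ext_equiv H E E'"
          using ext_equiv_sym[OF Z E(1)] ext_equiv_trans by blast
      qed
      then show "A = B" unfolding E(2) E'(2) by (rule ext_class_eqI[OF E(1) E'(1)])
    qed simp
  next
    show "?\<Phi> A \<in> carrier (product_group UNIV (\<lambda>n. Ext (G n) H))" if "A \<in> carrier (Ext G.C H)" for A
      using hom_in_carrier[OF hom_n that] by (simp add: PiE_iff)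
  next
    fix B assume "B \<in> carrier (product_group UNIV (\<lambda>n. Ext (G n) H))"
    then have "B n \<in> carrier (Ext (G n) H)" for n by (auto simp: PiE_iff)
    then have "\<exists>F :: ('h, 'g) repr. top_extension H (G n) F \<and> B n = ext_class H (G n) F" for n
      by (metis carrier_ExtE)
    then obtain F :: "nat \<Rightarrow> ('h, 'g) repr" where F: "\<And>n. top_extension H (G n) (F n)" "\<And>n. B n = ext_class H (G n) (F n)"
      by metis
    obtain Z :: "('h, ('h \<times> (nat \<Rightarrow> 'h \<times> 'g)) set, nat \<Rightarrow> 'g) extension"
      where Z: "top_extension H G.C Z" and mor: "\<And>n. ext_mor H (\<lambda>h. h) (G.inc n) (F n) Z"
      using glued_extension[of H G F, OF assms(1) F(1)] by metis
    have "?\<Phi> (ext_class H G.C Z) = B"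
      using Ext_restrict_eq[OF Z G.top_hom_inc F(1) mor] F(2) by (simp add: fun_eq_iff)
    then show "\<exists>A\<in>carrier (Ext G.C H). B = ?\<Phi> A"
      using ext_class_in_carrier[OF Z] by blast
  qed
  ultimately show ?thesis by (intro is_isoI) (simp add: iso_def)
qed

end
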